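(* Let $f:\mathbb{C}^2\to\mathbb{C}$ be a non-constant polynomial function of degree $d$. For $a\in\mathbb{C}$ let $\nu_a$ denote the number of branches at infinity of the fiber $f^{-1}(a)$, let $\nu_{\mathrm{gen}}$ be the common value of $\nu_a$ for all but finitely many $a\in\mathbb{C}$, let $\nu_{\min}:=\inf\{\nu_a\mid a\in\mathbb{C}\}$, let $b$ be the number of points at infinity of $f$, and let $B_\infty(f)\subset\mathbb{C}$ be the set of bifurcation points at infinity of $f$. Then: (a) $\# B_\infty(f)\le \min\{\nu_{\mathrm{gen}},\ \nu_{\min}+1\}$. (b) $\#\{a\in\mathbb{C}\mid \nu_a<\nu_{\mathrm{gen}}\}\le \nu_{\mathrm{gen}}-b$. (c) $\#\{a\in\mathbb{C}\mid \nu_a>\nu_{\mathrm{gen}}\}\le \nu_{\min}$. If moreover $\nu_{\mathrm{gen}}>\frac{d}{2}$, then: (d) $\# B_\infty(f)\le \min\{\nu_{\mathrm{gen}}-1,\ \nu_{\min}\}$. (e) $\#\{a\in\mathbb{C}\mid \nu_a>\nu_{\mathrm{gen}}\}\le \nu_{\min}-1$.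
   Context: Embed $\mathbb{C}^2\subset\mathbb{P}^2$ in the standard way, with line at infinity $L_\infty=\mathbb{P}^2\setminus\mathbb{C}^2$. Branches at infinity: for $a\in\mathbb{C}$, $\nu_a$ is the number of local analytic branches, at points of $L_\infty$, of the projective closure $\overline{f^{-1}(a)}\subset\mathbb{P}^2$ of the affine curve $f^{-1}(a)$ taken with its reduced structure; equivalently, the number of points lying over $L_\infty$ in the normalization of $\overline{f^{-1}(a)}$. It is known that $\nu_a$ takes the same value, denoted $\nu_{\mathrm{gen}}$, for all $a\in\mathbb{C}$ except finitely many. Points at infinity: $b:=\#\big(\overline{f^{-1}(a)}\cap L_\infty\big)$; this set does not depend on $a$, and equals the zero set in $L_\infty$ of the top-degree homogeneous part $f_d$ of $f$. Bifurcation points at infinity: $a\in\mathbb{C}$ is not in $B_\infty(f)$ if and only if there are an open disc $D\subset\mathbb{C}$ centered at $a$ and a compact set $K\subset\mathbb{C}^2$ such that the restriction $f: f^{-1}(D)\setminus K\to D$ is a $C^\infty$ trivial fibration. Thus $B_\infty(f)$ is the set of values at which the restriction of $f$ to a neighbourhood of infinity is not a locally trivial bundle. It is a known fact that $a\in B_\infty(f)$ if and only if there is a sequence $(p_k)_{k\in\mathbb{N}}\subset\mathbb{C}^2$ with $\|p_k\|\to\infty$, $\operatorname{grad} f(p_k)\to 0$ and $f(p_k)\to a$ as $k\to\infty$. *)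

theory Defs
  imports "HOL-Analysis.Analysis"
begin

definition polynomial_of_degree :: "(complex^2 \<Rightarrow> complex) \<Rightarrow> nat \<Rightarrow> bool" where
  "polynomial_of_degree f d \<longleftrightarrow>
     (\<exists>c :: nat \<Rightarrow> nat \<Rightarrow> complex.
        (\<forall>p. f p = (\<Sum>(i, j) \<in> {(i, j). i + j \<le> d}. c i j * (p $ 1) ^ i * (p $ 2) ^ j)) \<and>
        (\<exists>i j. i + j = d \<and> c i j \<noteq> 0))"


subsection \<open>The complex projective plane\<close>

definition proj_eq :: "complex^3 \<Rightarrow> complex^3 \<Rightarrow> bool" where
  "proj_eq v w \<longleftrightarrow> v \<noteq> 0 \<and> w \<noteq> 0 \<and> (\<exists>c. w = c *s v)"

quotient_type proj_plane = "complex^3" / partial: proj_eq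
proof (rule part_equivpI)
  have "proj_eq (vector [1, 0, 0]) (vector [1, 0, 0])"
    by (auto simp: proj_eq_def vec_eq_iff forall_3 intro!: exI[of _ 1])
  then show "\<exists>v. proj_eq v v" by blast
  show "symp proj_eq"
  proof (rule sympI)
    fix v w assume *: "proj_eq v w"
    then obtain c where c: "w = c *s v" by (auto simp: proj_eq_def)
    with * have "c \<noteq> 0" by (auto simp: proj_eq_def)
    with c have "v = inverse c *s w" by (simp add: vector_smult_assoc)
    with * show "proj_eq w v" by (auto simp: proj_eq_def)
  qed
  show "transp proj_eq"
    by (rule transpI) (auto simp: proj_eq_def vector_smult_assoc)
qed

text \<open>The quotient topology. As the nonzero vectors form an open set, openness of the preimage
  may be tested in the whole space of vectors.\<close>

instantiation proj_plane :: topological_space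
begin

definition open_proj_plane :: "proj_plane set \<Rightarrow> bool" where
  "open_proj_plane U \<longleftrightarrow> open {v. v \<noteq> 0 \<and> abs_proj_plane v \<in> U}"

instance
proof
  have "{v :: complex^3. v \<noteq> 0} = - {0}" by auto
  then show "open (UNIV :: proj_plane set)"
    by (simp add: open_proj_plane_def open_Compl)
next
  fix S T :: "proj_plane set" assume "open S" "open T"
  moreover have "{v. v \<noteq> 0 \<and> abs_proj_plane v \<in> S \<inter> T} =
      {v. v \<noteq> 0 \<and> abs_proj_plane v \<in> S} \<inter> {v. v \<noteq> 0 \<and> abs_proj_plane v \<in> T}" by auto
  ultimately show "open (S \<inter> T)" by (simp add: open_proj_plane_def open_Int)
next
  fix \<K> :: "proj_plane set set" assume "\<forall>S\<in>\<K>. open S"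
  moreover have "{v. v \<noteq> 0 \<and> abs_proj_plane v \<in> \<Union>\<K>} =
      (\<Union>S\<in>\<K>. {v. v \<noteq> 0 \<and> abs_proj_plane v \<in> S})" by auto
  ultimately show "open (\<Union>\<K>)" by (auto simp: open_proj_plane_def)
qed

end

definition affine_embedding :: "complex^2 \<Rightarrow> proj_plane" where
  "affine_embedding p = abs_proj_plane (vector [p $ 1, p $ 2, 1])"

definition line_at_infinity :: "proj_plane set" where
  "line_at_infinity = - range affine_embedding"

definition proj_closure :: "(complex^2) set \<Rightarrow> proj_plane set" where
  "proj_closure C = closure (affine_embedding ` C)"


subsection \<open>Holomorphic functions and analytic germs in the projective plane\<close>

definition holomorphic_on_open :: "(complex^'n \<Rightarrow> complex) \<Rightarrow> (complex^'n) set \<Rightarrow> bool" where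
  "holomorphic_on_open g U \<longleftrightarrow>
     open U \<and> (\<forall>z\<in>U. \<exists>L. Vector_Spaces.linear (*s) (*) L \<and> (g has_derivative L) (at z))"

definition proj_charts :: "(complex^2 \<Rightarrow> proj_plane) set" where
  "proj_charts =
     {\<lambda>w. abs_proj_plane (vector [1, w $ 1, w $ 2]),
      \<lambda>w. abs_proj_plane (vector [w $ 1, 1, w $ 2]),
      \<lambda>w. abs_proj_plane (vector [w $ 1, w $ 2, 1])}"

definition proj_holomorphic_on :: "(proj_plane \<Rightarrow> complex) \<Rightarrow> proj_plane set \<Rightarrow> bool" where
  "proj_holomorphic_on h U \<longleftrightarrow> (\<forall>\<psi>\<in>proj_charts. holomorphic_on_open (h \<circ> \<psi>) (\<psi> -` U))"

text \<open>The germ of a set at a point is encoded as a filter: two sets induce the same filter iff they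
  coincide on a neighbourhood of the point. The order of filters is inclusion of germs, \<^const>\<open>sup\<close>
  is the union of germs, and \<^const>\<open>bot\<close> is the empty germ.\<close>

definition germ :: "'a::topological_space \<Rightarrow> 'a set \<Rightarrow> 'a filter" where
  "germ p X = inf (nhds p) (principal X)"

definition analytic_germ :: "proj_plane \<Rightarrow> proj_plane filter \<Rightarrow> bool" where
  "analytic_germ p G \<longleftrightarrow>
     (\<exists>U H. open U \<and> p \<in> U \<and> finite H \<and> (\<forall>h\<in>H. proj_holomorphic_on h U) \<and>
            G = germ p {q \<in> U. \<forall>h\<in>H. h q = 0})"

definition irreducible_germ :: "proj_plane \<Rightarrow> proj_plane filter \<Rightarrow> bool" where
  "irreducible_germ p G \<longleftrightarrow>
     analytic_germ p G \<and> G \<noteq> bot \<and>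
     (\<forall>A B. analytic_germ p A \<longrightarrow> analytic_germ p B \<longrightarrow> G = sup A B \<longrightarrow> G = A \<or> G = B)"

text \<open>The local analytic branches of \<open>X\<close> at \<open>p\<close> are the irreducible components of the germ of \<open>X\<close>
  at \<open>p\<close>, i.e.\ its maximal irreducible analytic subgerms. Since germs of sets are used, curves are
  automatically taken with their reduced structure.\<close>

definition branches_at :: "proj_plane set \<Rightarrow> proj_plane \<Rightarrow> proj_plane filter set" where
  "branches_at X p =
     {G. irreducible_germ p G \<and> G \<le> germ p X \<and>
         (\<forall>G'. irreducible_germ p G' \<longrightarrow> G' \<le> germ p X \<longrightarrow> G \<le> G' \<longrightarrow> G' = G)}"


subsection \<open>Branches and points at infinity\<close>

definition fibre_at_infinity :: "(complex^2 \<Rightarrow> complex) \<Rightarrow> complex \<Rightarrow> proj_plane set" where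
  "fibre_at_infinity f a = proj_closure (f -` {a}) \<inter> line_at_infinity"

definition nu :: "(complex^2 \<Rightarrow> complex) \<Rightarrow> complex \<Rightarrow> nat" where
  "nu f a = (\<Sum>p \<in> fibre_at_infinity f a. card (branches_at (proj_closure (f -` {a})) p))"

definition nu_gen :: "(complex^2 \<Rightarrow> complex) \<Rightarrow> nat" where
  "nu_gen f = (THE n. finite {a. nu f a \<noteq> n})"

definition nu_min :: "(complex^2 \<Rightarrow> complex) \<Rightarrow> nat" where
  "nu_min f = (INF a. nu f a)"

text \<open>For a non-constant polynomial \<open>f\<close> the set \<^term>\<open>fibre_at_infinity f a\<close> does not depend
  on \<open>a\<close>, so the common cardinality is taken.\<close>

definition points_at_infinity_count :: "(complex^2 \<Rightarrow> complex) \<Rightarrow> nat" where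
  "points_at_infinity_count f = (THE n. \<forall>a. card (fibre_at_infinity f a) = n)"


subsection \<open>Bifurcation points at infinity\<close>

primrec Ck_on :: "nat \<Rightarrow> ('a::euclidean_space \<Rightarrow> 'b::euclidean_space) \<Rightarrow> 'a set \<Rightarrow> bool" where
  "Ck_on 0 g U \<longleftrightarrow> continuous_on U g"
| "Ck_on (Suc k) g U \<longleftrightarrow>
     (\<forall>x\<in>U. g differentiable (at x)) \<and>
     (\<forall>v. Ck_on k (\<lambda>x. frechet_derivative g (at x) v) U)"

text \<open>Smoothness on an arbitrary subset of a Euclidean space means local extendability to
  \<open>C\<^sup>\<infinity>\<close> maps on open sets; on embedded submanifolds this is the usual notion.\<close>

definition smooth_map_on ::
    "('a::euclidean_space \<Rightarrow> 'b::euclidean_space) \<Rightarrow> 'a set \<Rightarrow> bool" where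
  "smooth_map_on g S \<longleftrightarrow>
     (\<forall>x\<in>S. \<exists>U g'. open U \<and> x \<in> U \<and> (\<forall>k. Ck_on k g' U) \<and> (\<forall>y\<in>U \<inter> S. g' y = g y))"

definition diffeomorphism_between ::
    "'a::euclidean_space set \<Rightarrow> 'b::euclidean_space set \<Rightarrow> ('a \<Rightarrow> 'b) \<Rightarrow> ('b \<Rightarrow> 'a) \<Rightarrow> bool" where
  "diffeomorphism_between M N \<phi> \<psi> \<longleftrightarrow>
     homeomorphism M N \<phi> \<psi> \<and> smooth_map_on \<phi> M \<and> smooth_map_on \<psi> N"

text \<open>\<open>f\<close> restricts to a \<open>C\<^sup>\<infinity>\<close> trivial fibration from the open set \<open>M\<close> to \<open>D\<close>: it is
  the projection of a product up to diffeomorphism. The typical fibre \<open>F\<close> may be sought in the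
  ambient space of \<open>M\<close>, being diffeomorphic to any actual fibre; that \<open>F\<close> is a submanifold there is
  implied, since \<open>f\<close> has smooth local sections through every point of \<open>M\<close> and hence is a submersion.\<close>

definition smooth_trivial_fibration ::
    "('a::euclidean_space \<Rightarrow> 'b::euclidean_space) \<Rightarrow> 'a set \<Rightarrow> 'b set \<Rightarrow> bool" where
  "smooth_trivial_fibration f M D \<longleftrightarrow>
     (\<exists>(F :: 'a set) \<phi> \<psi>. diffeomorphism_between M (F \<times> D) \<phi> \<psi> \<and> (\<forall>x\<in>M. snd (\<phi> x) = f x))"

definition bifurcation_at_infinity :: "(complex^2 \<Rightarrow> complex) \<Rightarrow> complex set" where
  "bifurcation_at_infinity f =
     {a. \<not> (\<exists>r>0. \<exists>K. compact K \<and> smooth_trivial_fibration f (f -` ball a r - K) (ball a r))}"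

end

theory Submission
  imports Defs "HOL-Complex_Analysis.Complex_Analysis" "HOL-Computational_Algebra.Computational_Algebra"
    "HOL-Computational_Algebra.Field_as_Ring"
begin

text \<open>Away from a compact set, the fibre of \<open>f\<close> over \<open>a\<close> is the curve \<open>E(w, y) = a w\<^sup>d\<close> in a chart
  of the projective plane in which \<open>w = 0\<close> is the line at infinity and \<open>E\<close> has degree \<open>d\<close> and constant
  leading coefficient in \<open>y\<close>. By Puiseux's theorem, after \<open>w = u\<^sup>N\<close> with \<open>N = d!\<close>, this curve consists of
  \<open>d\<close> power series \<open>y = H(u)\<close>, and its branches at infinity are the orbits of these series under
  multiplication of \<open>u\<close> by \<open>N\<close>-th roots of unity.

  A pair \<open>(F, q)\<close> of a truncated series and an exponent is dicritical if \<open>f\<close> has a finite, non-constant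
  limit \<open>P(t)\<close> along \<open>y = F + t u\<^sup>q\<close>. Every series \<open>H\<close> of a fibre passes through exactly one
  dicritical. The roots of unity that fix \<open>F\<close> rotate \<open>t\<close> by all \<open>m\<close>-th roots of unity for some \<open>m\<close>, so
  \<open>P(t) = R(t\<^sup>m)\<close>. Let \<open>D\<close> run through representatives of the orbits of dicriticals. The fibre over \<open>a\<close>
  has at least one branch for every solution of \<open>R\<^sub>D = a\<close>, and at most \<open>\<Sum> deg R\<^sub>D\<close> branches unless
  \<open>a = R\<^sub>D(0)\<close> for some \<open>D\<close> with \<open>m\<^sub>D \<ge> 2\<close>; moreover \<open>\<Sum> m\<^sub>D deg R\<^sub>D \<le> d\<close>. Hence \<open>\<nu>\<^sub>g\<^sub>e\<^sub>n = \<Sum> deg R\<^sub>D\<close>.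

  Call \<open>a\<close> special if it is a critical value of some \<open>R\<^sub>D\<close>, or \<open>R\<^sub>D(0)\<close> with \<open>m\<^sub>D \<ge> 2\<close>. Limits of \<open>f\<close> along
  its polar curve \<open>E\<^sub>y = 0\<close> are special, so over a small disc around a non-special value the roots \<open>y\<close> are
  simple near infinity and following them trivialises \<open>f\<close>. It remains to count: \<open>R\<^sub>D\<close> has at most
  \<open>deg R\<^sub>D - 1\<close> critical values, and at most \<open>#R\<^sub>D\<^sup>-\<^sup>1(a) - 1\<close> different from \<open>a\<close>.\<close>

subsection \<open>Puiseux's theorem\<close>

text \<open>The exponent N = d! is fixed before any value a is chosen: the monodromy of d roots, and
  that of the d - 1 roots of the polar, has order dividing d!. So the series of all fibres and of
  the polar lie in one ring of power series in u, where arcs of different fibres can be compared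
  coefficient by coefficient. Let k be the number of orbits of dicriticals and r the number of those
  with m >= 2. There are at most nu_gen - k critical values, at most nu_a - k of them different from
  a, and at most r values R(0) with m >= 2; moreover k <= nu_a for every a. Since r <= k, this gives
  (a) and (c). For (b) one has b <= k, because q > 0 makes a dicritical determine its point at
  infinity. The bounds (d) and (e) gain 1 from r < k, and this is what nu_gen > d/2
  supplies.\<close>

lemma monic_poly_small_value_imp_root_nearby:
  fixes p :: "complex poly"
  assumes "lead_coeff p = 1" "degree p = n" "0 < n" "0 < \<epsilon>" "norm (poly p z) < \<epsilon> ^ n"
  shows "\<exists>y. poly p y = 0 \<and> norm (z - y) < \<epsilon>"
proof (rule ccontr)
  assume *: "\<not> ?thesis"
  have p: "p = (\<Prod>x\<in>#proots p. [:- x, 1:])"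
    using complex_poly_decompose_multiset[of p] assms(1) by simp
  have "p \<noteq> 0" using assms(1) by auto
  have "size (proots p) = n"
    using size_proots_complex assms(2) by metis
  \<comment> \<open>|p(z)| is the product of the distances from z to the roots, so it is at least
    \<open>\<epsilon> ^ n\<close> if no root is closer than \<open>\<epsilon>\<close>.\<close>
  have "norm (poly (\<Prod>x\<in>#A. [:- x, 1:]) z) \<ge> \<epsilon> ^ size A" if "A \<subseteq># proots p" for A
    using that
  proof (induction A)
    case (add x A)
    then have "x \<in># proots p" by (meson mset_subset_eqD union_single_eq_member)
    then have "poly p x = 0" using \<open>p \<noteq> 0\<close> by simp
    then have "\<epsilon> \<le> norm (z - x)" using * by force
    moreover have "A \<subseteq># proots p" using add.prems subset_mset.dual_order.trans by fastforce
    then have "\<epsilon> ^ size A \<le> norm (poly (\<Prod>x\<in>#A. [:- x, 1:]) z)" by (rule add.IH)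
    ultimately have "\<epsilon> * \<epsilon> ^ size A \<le> norm (z - x) * norm (poly (\<Prod>x\<in>#A. [:- x, 1:]) z)"
      using \<open>0 < \<epsilon>\<close> by (intro mult_mono) auto
    then show ?case by (simp add: poly_mult norm_mult del: mult_pCons_left)
  qed auto
  from this[of "proots p"] show False
    using \<open>size (proots p) = n\<close> assms(5) by (simp flip: p)
qed

lemma finite_set_separated:
  fixes Z :: "'a::metric_space set"
  assumes "finite Z"
  obtains \<epsilon> where "0 < \<epsilon>" "\<And>y y'. y \<in> Z \<Longrightarrow> y' \<in> Z \<Longrightarrow> y \<noteq> y' \<Longrightarrow> 2 * \<epsilon> \<le> dist y y'"
proof -
  \<comment> \<open>The element 1 keeps \<open>D\<close> nonempty when \<open>Z\<close> has fewer
    than two points.\<close>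
  define D where "D = insert 1 ((\<lambda>(y, y'). dist y y') ` {(y, y'). y \<in> Z \<and> y' \<in> Z \<and> y \<noteq> y'})"
  have "{(y, y'). y \<in> Z \<and> y' \<in> Z \<and> y \<noteq> y'} \<subseteq> Z \<times> Z" by auto
  then have "finite {(y, y'). y \<in> Z \<and> y' \<in> Z \<and> y \<noteq> y'}"
    using assms finite_subset finite_cartesian_product by blast
  then have "finite D" by (simp add: D_def)
  then have "Min D \<in> D" "\<And>x. x \<in> D \<Longrightarrow> Min D \<le> x"
    using Min_in[of D] by (auto simp: D_def)
  then show ?thesis
    by (intro that[of "Min D / 2"]) (auto simp: D_def)
qed

text \<open>Near \<open>s0\<close> the polynomial \<open>G s\<close> is small at each root of
  \<open>G s0\<close>, hence has a root close to each of them. The discs around these n roots are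
  disjoint and \<open>G s\<close> has just n roots, so each disc contains exactly one, and the
  sheets are the graphs of these roots. The covering is used twice: to lift roots along
  \<open>exp\<close>, and to follow them while the value of f moves.\<close>

lemma covering_space_simple_roots:
  fixes G :: "'a::real_normed_vector \<Rightarrow> complex poly"
  assumes cont: "\<And>y. continuous_on S (\<lambda>s. poly (G s) y)"
    and monic: "\<And>s. s \<in> S \<Longrightarrow> degree (G s) = n" "\<And>s. s \<in> S \<Longrightarrow> lead_coeff (G s) = 1"
    and simple: "\<And>s. s \<in> S \<Longrightarrow> card {y. poly (G s) y = 0} = n" and n: "0 < n"
  shows "covering_space {(s, y). s \<in> S \<and> poly (G s) y = 0} fst S"
proof
  define C where "C = {(s, y). s \<in> S \<and> poly (G s) y = 0}"
  show "continuous_on {(s, y). s \<in> S \<and> poly (G s) y = 0} fst" by (intro continuous_intros)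
  show "fst ` {(s, y). s \<in> S \<and> poly (G s) y = 0} = S"
  proof safe
    fix s assume "s \<in> S"
    then have "{y. poly (G s) y = 0} \<noteq> {}" using simple n by (metis card.empty less_irrefl)
    then show "s \<in> fst ` {(s, y). s \<in> S \<and> poly (G s) y = 0}" using \<open>s \<in> S\<close> by force
  qed auto
  fix s0 assume s0: "s0 \<in> S"
  define Z where "Z = {y. poly (G s0) y = 0}"
  have Z: "finite Z" "card Z = n" unfolding Z_def using simple[OF s0] n by (auto intro: card_ge_0_finite)
  obtain \<epsilon> where \<epsilon>: "0 < \<epsilon>" "\<And>y y'. y \<in> Z \<Longrightarrow> y' \<in> Z \<Longrightarrow> y \<noteq> y' \<Longrightarrow> 2 * \<epsilon> \<le> dist y y'"
    using finite_set_separated[OF Z(1)] by blast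
  define A where "A y = {s \<in> S. norm (poly (G s) y) < \<epsilon> ^ n}" for y
  define T where "T = \<Inter> (A ` Z)"
  have "A y = S \<inter> (\<lambda>s. norm (poly (G s) y)) -` {..<\<epsilon> ^ n}" for y by (auto simp: A_def)
  then have "openin (top_of_set S) (A y)" for y
    by (simp, intro continuous_openin_preimage_gen continuous_intros cont)
  moreover have "Z \<noteq> {}" using Z n by auto
  ultimately have T: "openin (top_of_set S) T" "T \<subseteq> S"
    using Z(1) unfolding T_def by (auto intro!: openin_Inter) (auto simp: A_def)
  have s0T: "s0 \<in> T" using s0 \<epsilon>(1) by (auto simp: T_def A_def Z_def)
  have disj: "y = y'" if "y \<in> Z" "y' \<in> Z" "dist x y < \<epsilon>" "dist x y' < \<epsilon>" for x y y'
    using \<epsilon>(2)[OF that(1,2)] that(3,4) dist_triangle_less_add[of y x \<epsilon> y' \<epsilon>]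
    by (auto simp: dist_commute)
  have ex: "\<exists>z. poly (G s) z = 0 \<and> dist z y < \<epsilon>" if "s \<in> T" "y \<in> Z" for s y
  proof -
    have "s \<in> S" "norm (poly (G s) y) < \<epsilon> ^ n" using that by (auto simp: T_def A_def)
    from monic_poly_small_value_imp_root_nearby[OF monic(2)[OF this(1)] monic(1)[OF this(1)] n \<epsilon>(1) this(2)]
    show ?thesis by (auto simp: dist_norm norm_minus_commute)
  qed
  define \<rho> where "\<rho> y s = (SOME z. poly (G s) z = 0 \<and> dist z y < \<epsilon>)" for y s
  have \<rho>: "poly (G s) (\<rho> y s) = 0" "dist (\<rho> y s) y < \<epsilon>" if "s \<in> T" "y \<in> Z" for s y
    using someI_ex[OF ex[OF that]] by (auto simp: \<rho>_def)
  have img: "(\<lambda>y. \<rho> y s) ` Z = {y. poly (G s) y = 0}" if "s \<in> T" for s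
  proof (rule card_seteq)
    have sS: "s \<in> S" using that T by auto
    show "finite {y. poly (G s) y = 0}" using simple[OF sS] n card_gt_0_iff by fastforce
    show "(\<lambda>y. \<rho> y s) ` Z \<subseteq> {y. poly (G s) y = 0}" using \<rho> that by auto
    have "inj_on (\<lambda>y. \<rho> y s) Z" by (rule inj_onI) (metis \<rho>(2) disj that)
    then show "card {y. poly (G s) y = 0} \<le> card ((\<lambda>y. \<rho> y s) ` Z)"
      using simple[OF sS] Z by (simp add: card_image)
  qed
  have uniq: "z = \<rho> y s" if s: "s \<in> T" and y: "y \<in> Z" and z: "poly (G s) z = 0" "dist z y < \<epsilon>" for s y z
  proof -
    obtain y' where y': "y' \<in> Z" "z = \<rho> y' s" using img[OF s] z(1) by auto
    then have "dist z y' < \<epsilon>" using \<rho>(2) s by auto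
    then show ?thesis using disj[OF y y'(1) z(2)] y'(2) by auto
  qed
  have cont\<rho>: "continuous_on T (\<rho> y)" if y: "y \<in> Z" for y
    unfolding continuous_on_iff
  proof (intro ballI allI impI)
    fix s1 and e :: real assume s1: "s1 \<in> T" and e: "0 < e"
    \<comment> \<open>With this \<open>\<eta>\<close> the root found near \<open>\<rho> y s1\<close>
      still lies in the disc around \<open>y\<close>, where it is the only one.\<close>
    define \<eta> where "\<eta> = min e (\<epsilon> - dist (\<rho> y s1) y)"
    have \<eta>: "0 < \<eta>" "\<eta> \<le> e" "\<eta> \<le> \<epsilon> - dist (\<rho> y s1) y" using e \<rho>(2)[OF s1 y] by (auto simp: \<eta>_def)
    have "s1 \<in> S" using s1 T by auto
    moreover have "0 < \<eta> ^ n" using \<eta>(1) by simp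
    ultimately obtain d where d: "0 < d"
      "\<And>s. s \<in> S \<Longrightarrow> dist s s1 < d \<Longrightarrow> dist (poly (G s) (\<rho> y s1)) (poly (G s1) (\<rho> y s1)) < \<eta> ^ n"
      using cont[of "\<rho> y s1"] unfolding continuous_on_iff by meson
    have "dist (\<rho> y s) (\<rho> y s1) < e" if s: "s \<in> T" "dist s s1 < d" for s
    proof -
      have sS: "s \<in> S" using s T by auto
      have "norm (poly (G s) (\<rho> y s1)) < \<eta> ^ n" using d(2)[OF sS s(2)] \<rho>(1)[OF s1 y] by simp
      then obtain z where z: "poly (G s) z = 0" "norm (\<rho> y s1 - z) < \<eta>"
        using monic_poly_small_value_imp_root_nearby[OF monic(2)[OF sS] monic(1)[OF sS] n \<eta>(1)] by blast
      have "dist z y < \<epsilon>"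
        using z(2) \<eta>(3) dist_triangle[of z y "\<rho> y s1"] by (simp add: dist_norm norm_minus_commute)
      then have "z = \<rho> y s" using uniq s(1) y z(1) by blast
      then show ?thesis using z(2) \<eta>(2) by (simp add: dist_norm norm_minus_commute)
    qed
    then show "\<exists>d>0. \<forall>x'\<in>T. dist x' s1 < d \<longrightarrow> dist (\<rho> y x') (\<rho> y s1) < e" using d(1) by blast
  qed
  define u where "u y = {(s, z). s \<in> T \<and> poly (G s) z = 0 \<and> dist z y < \<epsilon>}" for y
  have "\<Union> (u ` Z) = C \<inter> fst -` T"
  proof safe
    fix s z assume "(s, z) \<in> C" "fst (s, z) \<in> T"
    then have "s \<in> T" "poly (G s) z = 0" by (auto simp: C_def)
    moreover from this obtain y where "y \<in> Z" "z = \<rho> y s" using img by blast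
    ultimately show "(s, z) \<in> \<Union> (u ` Z)" using \<rho>(2) by (auto simp: u_def)
  qed (use T in \<open>auto simp: u_def C_def\<close>)
  moreover have "openin (top_of_set C) (u y)" for y
  proof -
    have "openin (top_of_set C) (C \<inter> fst -` T)"
      using T(1) by (intro continuous_openin_preimage[of _ _ S] continuous_intros) (auto simp: C_def)
    moreover have "openin (top_of_set C) (C \<inter> snd -` ball y \<epsilon>)"
      by (intro continuous_openin_preimage_gen continuous_intros) auto
    ultimately have "openin (top_of_set C) ((C \<inter> fst -` T) \<inter> (C \<inter> snd -` ball y \<epsilon>))" by blast
    moreover have "(C \<inter> fst -` T) \<inter> (C \<inter> snd -` ball y \<epsilon>) = u y"
      using T(2) by (auto simp: C_def u_def dist_commute)
    ultimately show ?thesis by simp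
  qed
  moreover have "pairwise disjnt (u ` Z)"
    unfolding pairwise_def disjnt_def using disj by (fastforce simp: u_def)
  moreover have "homeomorphism (u y) T fst (\<lambda>s. (s, \<rho> y s))" if "y \<in> Z" for y
  proof
    show "continuous_on (u y) fst" by (intro continuous_intros)
    show "continuous_on T (\<lambda>s. (s, \<rho> y s))" by (intro continuous_intros cont\<rho> that)
  qed (use that \<rho> uniq in \<open>auto simp: u_def\<close>)
  ultimately show "\<exists>T. s0 \<in> T \<and> openin (top_of_set S) T \<and>
      (\<exists>v. \<Union> v = {(s, y). s \<in> S \<and> poly (G s) y = 0} \<inter> fst -` T \<and>
        (\<forall>u\<in>v. openin (top_of_set {(s, y). s \<in> S \<and> poly (G s) y = 0}) u) \<and>
        pairwise disjnt v \<and> (\<forall>u\<in>v. \<exists>q. homeomorphism u T fst q))"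
    using s0T T(1) unfolding C_def[symmetric] by (intro exI[of _ T] exI[of _ "u ` Z"] conjI) blast+
qed

text \<open>Euclid's algorithm in y over the rational functions of x, with pseudo-division to stay
  among polynomials. The result \<open>r\<close> depends on x alone, and wherever it does not vanish
  all roots y are simple.\<close>

lemma irreducible_bezout_pderiv:
  fixes G :: "complex poly poly"
  assumes irr: "irreducible G" and deg: "0 < degree G"
  shows "\<exists>A B r. r \<noteq> 0 \<and> A * G + B * pderiv G = [:r:]"
proof -
  define I where "I g \<longleftrightarrow> g \<noteq> 0 \<and> (\<exists>A B. g = A * G + B * pderiv G)" for g
  have "G \<noteq> 0" using deg by auto
  then have "I G" unfolding I_def by (intro conjI exI[of _ 1] exI[of _ 0]) auto
  from ex_has_least_nat[of I G degree] this obtain g where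
    g: "I g" and min: "\<And>h. I h \<Longrightarrow> degree g \<le> degree h" by blast
  obtain A B where AB: "g = A * G + B * pderiv G" and "g \<noteq> 0" using g unfolding I_def by blast
  have dvd: "\<exists>k. g dvd smult (lead_coeff g ^ k) f" if f: "f = C * G + D * pderiv G" for f C D
  proof -
    obtain q r where qr: "pseudo_divmod f g = (q, r)" by fastforce
    from pseudo_divmod[OF \<open>g \<noteq> 0\<close> qr] obtain k where
      k: "smult (lead_coeff g ^ k) f = g * q + r" and r: "r = 0 \<or> degree r < degree g" by blast
    have "r = smult (lead_coeff g ^ k) f - g * q" using k by simp
    also have "\<dots> = (smult (lead_coeff g ^ k) C - q * A) * G + (smult (lead_coeff g ^ k) D - q * B) * pderiv G"
      by (simp add: f AB algebra_simps smult_add_right)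
    finally have "r \<noteq> 0 \<Longrightarrow> I r" unfolding I_def by blast
    then have "r = 0" using min[of r] r by linarith
    then show ?thesis using k by (metis add.right_neutral dvd_triv_left)
  qed
  have "degree g = 0"
  proof (rule ccontr)
    \<comment> \<open>\<open>g\<close> divides G and its derivative up to powers of its leading
      coefficient. The cofactor \<open>q\<close> has smaller degree than G, so the prime G divides
      \<open>g\<close>; but the degree of \<open>g\<close> is at most that of the
      derivative.\<close>
    assume pos: "degree g \<noteq> 0"
    obtain k where "g dvd smult (lead_coeff g ^ k) G" using dvd[of G 1 0] by auto
    then obtain q where q: "smult (lead_coeff g ^ k) G = g * q" by (elim dvdE)
    have prime: "prime_elem G" using irr by (rule irreducible_imp_prime_elem_gcd)
    have lc: "lead_coeff g ^ k \<noteq> 0" for k using \<open>g \<noteq> 0\<close> by auto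
    have "smult (lead_coeff g ^ k) G \<noteq> 0" using lc[of k] \<open>G \<noteq> 0\<close> by (simp only: smult_eq_0_iff) simp
    then have "q \<noteq> 0" unfolding q by auto
    have "degree G = degree g + degree q"
      using degree_mult_eq[OF \<open>g \<noteq> 0\<close> \<open>q \<noteq> 0\<close>] degree_smult_eq[of "lead_coeff g ^ k" G] lc[of k]
      unfolding q by (simp only: if_False)
    then have "\<not> G dvd q" using pos dvd_imp_degree_le[of G q] \<open>q \<noteq> 0\<close> by linarith
    moreover have "G dvd g * q" unfolding q[symmetric] by (rule dvd_smult) simp
    ultimately have "G dvd g" using prime prime_elem_dvd_multD by blast
    obtain l where "g dvd smult (lead_coeff g ^ l) (pderiv G)" using dvd[of "pderiv G" 0 1] by auto
    then have "degree g \<le> degree (pderiv G)"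
      using dvd_imp_degree_le[of g "smult (lead_coeff g ^ l) (pderiv G)"] lc[of l] deg
      by (simp only: smult_eq_0_iff degree_smult_eq pderiv_eq_0_iff) simp
    moreover have "degree G \<le> degree g" using \<open>G dvd g\<close> \<open>g \<noteq> 0\<close> by (rule dvd_imp_degree_le)
    ultimately show False using deg by (simp add: degree_pderiv)
  qed
  then obtain r where "g = [:r:]" by (rule degree_eq_zeroE)
  then show ?thesis using AB \<open>g \<noteq> 0\<close> by (intro exI[of _ A] exI[of _ B] exI[of _ r]) auto
qed

section \<open>Bivariate polynomials: y is the outer variable, x the inner one\<close>

definition eval_inner :: "'a::comm_ring_1 \<Rightarrow> 'a poly poly \<Rightarrow> 'a poly" where
  "eval_inner x G = map_poly (\<lambda>q. poly q x) G"

lemma eval_inner_pCons [simp]: "eval_inner x (pCons q G) = pCons (poly q x) (eval_inner x G)"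
  and eval_inner_0 [simp]: "eval_inner x 0 = 0"
  by (simp_all add: eval_inner_def map_poly_pCons)

lemma coeff_eval_inner: "coeff (eval_inner x G) k = poly (coeff G k) x"
  by (simp add: eval_inner_def coeff_map_poly)

lemma eval_inner_add: "eval_inner x (G + H) = eval_inner x G + eval_inner x H"
  and eval_inner_diff: "eval_inner x (G - H) = eval_inner x G - eval_inner x H"
  and eval_inner_smult: "eval_inner x (smult q G) = smult (poly q x) (eval_inner x G)"
  by (auto intro!: poly_eqI simp: coeff_eval_inner)

lemma eval_inner_mult: "eval_inner x (G * H) = eval_inner x G * eval_inner x H"
  by (induction G) (simp_all add: eval_inner_add eval_inner_smult)

lemma eval_inner_pderiv:
  fixes G :: "'a::idom poly poly"
  shows "eval_inner x (pderiv G) = pderiv (eval_inner x G)"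
  by (auto intro!: poly_eqI simp: coeff_eval_inner coeff_pderiv poly_mult)

lemma degree_eval_inner:
  fixes G :: "'a::idom poly poly"
  assumes "lead_coeff G = [:c:]" "c \<noteq> 0"
  shows "degree (eval_inner x G) = degree G" "lead_coeff (eval_inner x G) = c"
proof -
  show "degree (eval_inner x G) = degree G"
    using assms by (intro antisym le_degree degree_le) (auto simp: coeff_eval_inner coeff_eq_0)
  then show "lead_coeff (eval_inner x G) = c"
    using assms by (simp add: coeff_eval_inner)
qed

lemma eval_inner_has_derivative:
  fixes G :: "complex poly poly"
  shows "((\<lambda>(x, y). poly (eval_inner x G) y) has_derivative
    (\<lambda>(v, w). poly (eval_inner x0 (map_poly pderiv G)) y0 * v +
      poly (pderiv (eval_inner x0 G)) y0 * w)) (at (x0, y0))"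
proof (induction G)
  case (pCons q G)
  define a where "a = poly (eval_inner x0 (map_poly pderiv G)) y0"
  have a: "((\<lambda>p. poly (eval_inner (fst p) G) (snd p)) has_derivative
    (\<lambda>p. a * fst p + poly (pderiv (eval_inner x0 G)) y0 * snd p)) (at (x0, y0))"
    using pCons.IH by (simp add: case_prod_unfold a_def)
  have "((\<lambda>x. poly q x) has_derivative (\<lambda>v. poly (pderiv q) (fst (x0, y0)) * v)) (at (fst (x0, y0)))"
    using poly_DERIV[of q] by (simp add: has_field_derivative_def)
  from has_derivative_add[OF has_derivative_compose[OF has_derivative_fst[OF has_derivative_ident] this]
      has_derivative_mult[OF has_derivative_snd[OF has_derivative_ident] a]]
  have "((\<lambda>p. poly q (fst p) + snd p * poly (eval_inner (fst p) G) (snd p)) has_derivative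
    (\<lambda>p. poly (pderiv q) x0 * fst p + (y0 * (a * fst p + poly (pderiv (eval_inner x0 G)) y0 * snd p)
      + snd p * poly (eval_inner x0 G) y0))) (at (x0, y0))"
    by simp
  moreover have "(\<lambda>p. poly (pderiv q) x0 * fst p + (y0 * (a * fst p + poly (pderiv (eval_inner x0 G)) y0 * snd p)
      + snd p * poly (eval_inner x0 G) y0)) = (\<lambda>p. (poly (pderiv q) x0 + y0 * a) * fst p +
        poly (pderiv (eval_inner x0 (pCons q G))) y0 * snd p)"
    by (simp add: fun_eq_iff pderiv_pCons algebra_simps)
  moreover have "poly (eval_inner x0 (map_poly pderiv (pCons q G))) y0 = poly (pderiv q) x0 + y0 * a"
    by (simp add: map_poly_pCons a_def)
  ultimately show ?case by (simp add: case_prod_unfold)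
qed (simp add: case_prod_unfold)

text \<open>With k the increment of Y, the derivative of A bounds \<open>L h + a * k\<close> by a
  small multiple of \<open>norm h + norm k\<close>. Absorbing half of \<open>norm a\<close> on the
  left makes Y Lipschitz at \<open>z0\<close>, and inserting this into the same bound gives the
  derivative. The source is any normed space, because the lemma serves holomorphic as well as real
  smooth functions.\<close>

lemma implicit_has_derivative:
  fixes Y :: "'e::real_normed_vector \<Rightarrow> complex" and A :: "'e \<times> complex \<Rightarrow> complex"
  assumes A: "(A has_derivative (\<lambda>(h, w). L h + a * w)) (at (z0, Y z0))" and a: "a \<noteq> 0"
    and Y: "isCont Y z0" and ev: "eventually (\<lambda>z. A (z, Y z) = 0) (nhds z0)"
  shows "(Y has_derivative (\<lambda>h. - L h / a)) (at z0)"
proof -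
  have "bounded_linear (\<lambda>h :: 'e. (h, 0 :: complex))"
    by (intro bounded_linear_Pair bounded_linear_ident bounded_linear_zero)
  from bounded_linear_compose[OF has_derivative_bounded_linear[OF A] this]
  have L: "bounded_linear L" by simp
  then obtain K where K: "0 < K" "\<And>h. norm (L h) \<le> norm h * K"
    using bounded_linear.pos_bounded by blast
  from eventually_nhds_x_imp_x[OF ev] have A0: "A (z0, Y z0) = 0" .
  have key: "\<exists>d>0. \<forall>z. norm (z - z0) < d \<longrightarrow>
      norm (L (z - z0) + a * (Y z - Y z0)) \<le> e * (norm (z - z0) + norm (Y z - Y z0))" if e: "0 < e" for e
  proof -
    obtain d where d: "0 < d" "\<And>p. norm (p - (z0, Y z0)) < d \<Longrightarrow>
        norm (A p - A (z0, Y z0) - (\<lambda>(h, w). L h + a * w) (p - (z0, Y z0))) \<le> e * norm (p - (z0, Y z0))"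
      using A e unfolding has_derivative_at_alt by blast
    have "isCont (\<lambda>z. (z, Y z)) z0" using Y by (intro continuous_intros)
    then have "eventually (\<lambda>z. dist (z, Y z) (z0, Y z0) < d) (nhds z0)"
      unfolding isCont_def tendsto_at_iff_tendsto_nhds[of "\<lambda>z. (z, Y z)"] using d(1) by (rule tendstoD)
    then have "eventually (\<lambda>z. norm (L (z - z0) + a * (Y z - Y z0)) \<le>
        e * (norm (z - z0) + norm (Y z - Y z0))) (nhds z0)"
      using ev
    proof eventually_elim
      case (elim z)
      have "norm (L (z - z0) + a * (Y z - Y z0)) \<le> e * norm ((z, Y z) - (z0, Y z0))"
        using d(2)[of "(z, Y z)"] elim A0 norm_minus_cancel[of "L (z - z0) + a * (Y z - Y z0)"]
        by (simp add: dist_norm)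
      also have "\<dots> \<le> e * (norm (z - z0) + norm (Y z - Y z0))"
        using e by (intro mult_left_mono) (auto simp: norm_Pair sqrt_sum_squares_le_sum)
      finally show ?case .
    qed
    then show ?thesis by (auto simp: eventually_nhds_metric dist_norm)
  qed
  obtain d0 where d0: "0 < d0" "\<And>z. norm (z - z0) < d0 \<Longrightarrow>
      norm (L (z - z0) + a * (Y z - Y z0)) \<le> norm a / 2 * (norm (z - z0) + norm (Y z - Y z0))"
    using key[of "norm a / 2"] a by auto
  \<comment> \<open>Solving |a| k <= |a|/2 (h + k) + K h for k gives k <= M h.\<close>
  define M where "M = (2 * K + norm a) / norm a"
  have M: "0 < M" using K(1) a by (simp add: M_def add_pos_pos)
  have lip: "norm (Y z - Y z0) \<le> M * norm (z - z0)" if "norm (z - z0) < d0" for z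
  proof -
    have "norm a * norm (Y z - Y z0) \<le> norm (L (z - z0) + a * (Y z - Y z0)) + norm (L (z - z0))"
      using norm_triangle_ineq4[of "L (z - z0) + a * (Y z - Y z0)" "L (z - z0)"] by (simp add: norm_mult)
    also have "\<dots> \<le> norm a / 2 * (norm (z - z0) + norm (Y z - Y z0)) + norm (z - z0) * K"
      by (intro add_mono d0(2)[OF that] K(2))
    finally have "norm a * norm (Y z - Y z0) \<le> (2 * K + norm a) * norm (z - z0)"
      by (simp add: algebra_simps)
    then show ?thesis using a by (simp add: M_def pos_le_divide_eq mult.commute)
  qed
  show ?thesis
    unfolding has_derivative_at_alt
  proof (intro conjI allI impI)
    show "bounded_linear (\<lambda>h. - L h / a)"
      using bounded_linear_compose[OF bounded_linear_mult_right[of "- inverse a"] L]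
      by (simp add: divide_inverse mult.commute)
    fix e :: real assume e: "0 < e"
    have "0 < e * norm a / (1 + M)" using e a M by simp
    from key[OF this] obtain d where d: "0 < d" "\<And>z. norm (z - z0) < d \<Longrightarrow>
      norm (L (z - z0) + a * (Y z - Y z0)) \<le> e * norm a / (1 + M) * (norm (z - z0) + norm (Y z - Y z0))" by blast
    have "norm (Y z - Y z0 - - L (z - z0) / a) \<le> e * norm (z - z0)" if z: "norm (z - z0) < min d d0" for z
    proof -
      have "Y z - Y z0 - - L (z - z0) / a = (L (z - z0) + a * (Y z - Y z0)) / a"
        using a by (simp add: add_divide_distrib)
      then have "norm (Y z - Y z0 - - L (z - z0) / a) = norm (L (z - z0) + a * (Y z - Y z0)) / norm a"
        by (simp add: norm_divide)
      also have "\<dots> \<le> e * norm a / (1 + M) * (norm (z - z0) + M * norm (z - z0)) / norm a"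
        using lip[of z] z e a M
        by (intro divide_right_mono order_trans[OF d(2)[of z] mult_left_mono]) auto
      also have "norm (z - z0) + M * norm (z - z0) = (1 + M) * norm (z - z0)" by (simp add: algebra_simps)
      also have "e * norm a / (1 + M) * ((1 + M) * norm (z - z0)) / norm a = e * norm (z - z0)"
        using a M by simp
      finally show ?thesis .
    qed
    then show "\<exists>d>0. \<forall>z. norm (z - z0) < d \<longrightarrow> norm (Y z - Y z0 - - L (z - z0) / a) \<le> e * norm (z - z0)"
      using d(1) d0(1) by (intro exI[of _ "min d d0"]) auto
  qed
qed

lemma poly_eval_inner: "poly (eval_inner x G) y = poly (poly G [:y:]) x"
  by (induction G) auto

lemma card_roots_rsquarefree:
  fixes p :: "complex poly"
  assumes "rsquarefree p"
  shows "card {z. poly p z = 0} = degree p"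
proof -
  have "p \<noteq> 0" using assms by (simp add: rsquarefree_def)
  then have "degree p = degree (\<Prod>z | poly p z = 0. [:- z, 1:])"
    using complex_poly_decompose_rsquarefree[OF assms] by (metis degree_smult_eq leading_coeff_0_iff)
  also have "\<dots> = card {z. poly p z = 0}"
    by (subst degree_prod_sum_eq) auto
  finally show ?thesis ..
qed

text \<open>If |y| > 1, compare \<open>y ^ n\<close> with the lower terms, each of which is at most
  \<open>M * norm y ^ (n - 1)\<close>. This keeps the roots bounded near the puncture, so that they
  extend over 0.\<close>

lemma monic_poly_root_bound:
  fixes p :: "complex poly"
  assumes "lead_coeff p = 1" "degree p = n" "\<And>i. i < n \<Longrightarrow> norm (coeff p i) \<le> M" "poly p y = 0"
  shows "norm y \<le> max 1 (real n * M)"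
proof (cases "norm y \<le> 1")
  case False
  have "n \<noteq> 0"
  proof
    assume "n = 0"
    then obtain c where "p = [:c:]" using assms(2) by (metis degree_eq_zeroE)
    then show False using assms(1,4) by simp
  qed
  have "0 = (\<Sum>i\<le>n. coeff p i * y ^ i)" using assms(2,4) by (simp add: poly_altdef)
  also have "\<dots> = (\<Sum>i<n. coeff p i * y ^ i) + y ^ n"
    using assms(1,2) by (simp flip: lessThan_Suc_atMost)
  finally have "y ^ n = - (\<Sum>i<n. coeff p i * y ^ i)" by (simp add: eq_neg_iff_add_eq_0 add.commute)
  then have "norm y ^ n = norm (\<Sum>i<n. coeff p i * y ^ i)" by (metis norm_minus_cancel norm_power)
  also have "\<dots> \<le> (\<Sum>i<n. M * norm y ^ (n - 1))"
  proof (rule sum_norm_le)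
    fix i assume "i \<in> {..<n}"
    then have "norm (coeff p i) * norm y ^ i \<le> M * norm y ^ (n - 1)"
      using assms(3)[of i] False by (intro mult_mono power_increasing) (auto intro: order_trans[OF norm_ge_zero])
    then show "norm (coeff p i * y ^ i) \<le> M * norm y ^ (n - 1)" by (simp add: norm_mult norm_power)
  qed
  finally have "norm y * norm y ^ (n - 1) \<le> real n * M * norm y ^ (n - 1)"
    using \<open>n \<noteq> 0\<close> by (simp flip: power_Suc)
  moreover have "0 < norm y ^ (n - 1)" using False by (intro zero_less_power) auto
  ultimately show ?thesis by (simp add: mult_le_cancel_right)
qed auto

lemma poly_eq_prod_linear_factors:
  fixes p :: "complex poly"
  assumes "lead_coeff p = 1" "finite A" "card A = degree p" "\<And>y. y \<in> A \<Longrightarrow> poly p y = 0"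
  shows "p = (\<Prod>y\<in>A. [:- y, 1:])"
proof -
  let ?q = "\<Prod>y\<in>A. [:- y, 1:] :: complex poly"
  have q: "degree ?q = card A" "lead_coeff ?q = 1"
    by (subst degree_prod_sum_eq) (auto simp: lead_coeff_prod)
  show ?thesis
  proof (rule ccontr)
    assume "p \<noteq> ?q"
    have "card A \<noteq> 0"
    proof
      assume "card A = 0"
      then obtain c where "p = [:c:]" "A = {}" using assms(2,3) by (metis degree_eq_zeroE card_0_eq)
      then show False using assms(1) \<open>p \<noteq> ?q\<close> by (simp add: one_pCons)
    qed
    have "degree (p - ?q) \<le> card A"
      using assms(3) q(1) by (intro degree_diff_le) auto
    moreover have "coeff (p - ?q) (card A) = 0" using assms(1,3) q by simp
    then have "degree (p - ?q) \<noteq> card A"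
      using \<open>p \<noteq> ?q\<close> by (metis leading_coeff_0_iff right_minus_eq)
    ultimately have "degree (p - ?q) < card A" by linarith
    moreover have "A \<subseteq> {y. poly (p - ?q) y = 0}"
      using assms(2,4) by (auto simp: poly_prod intro: prod_zero)
    moreover have "p - ?q \<noteq> 0" using \<open>p \<noteq> ?q\<close> by simp
    note card_mono[OF poly_roots_finite[OF this], of A] card_poly_roots_bound[OF this]
    ultimately show False by linarith
  qed
qed

text \<open>The roots are lifted along \<open>exp\<close>, the universal cover of the punctured disc. A deck transformation
  permutes the \<open>n\<close> lifts, so its \<open>n!\<close>-th power fixes them.\<close>

lemma continuous_root_along_exp:
  fixes G :: "complex poly poly"
  assumes lc: "lead_coeff G = 1" and n: "degree G = n" "0 < n"
    and sq: "\<And>x. 0 < norm x \<Longrightarrow> norm x < \<delta> \<Longrightarrow> rsquarefree (eval_inner x G)" and \<delta>: "0 < \<delta>"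
  defines "H \<equiv> {w. Re w < ln \<delta>}"
  shows "\<exists>\<Y>. finite \<Y> \<and> card \<Y> = n \<and>
    (\<forall>Y\<in>\<Y>. Y holomorphic_on H \<and> (\<forall>w\<in>H. Y (w + 2 * pi * of_nat (fact n) * \<i>) = Y w)) \<and>
    (\<forall>w\<in>H. eval_inner (exp w) G = (\<Prod>Y\<in>\<Y>. [:- Y w, 1:]))"
proof -
  have lc': "lead_coeff G = [:1:]" using lc by (simp add: one_pCons)
  note deg = degree_eval_inner[OF lc', simplified]
  define S where "S = {x::complex. 0 < norm x \<and> norm x < \<delta>}"
  have cov: "covering_space {(x, y). x \<in> S \<and> poly (eval_inner x G) y = 0} fst S"
  proof (rule covering_space_simple_roots)
    show "continuous_on S (\<lambda>x. poly (eval_inner x G) y)" for y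
      unfolding poly_eval_inner by (intro continuous_intros)
    show "card {y. poly (eval_inner x G) y = 0} = n" if "x \<in> S" for x
      using that card_roots_rsquarefree[OF sq] deg n by (auto simp: S_def)
  qed (use deg n in auto)
  have expS: "exp w \<in> S" if "w \<in> H" for w
  proof -
    have "exp (Re w) < exp (ln \<delta>)" using that by (simp only: exp_less_cancel_iff H_def mem_Collect_eq)
    then show ?thesis using \<delta> by (simp add: S_def)
  qed
  have H: "convex H" "open H" unfolding H_def by (auto intro: convex_halfspace_Re_lt open_halfspace_Re_lt)
  define isroot where "isroot Y \<longleftrightarrow> continuous_on H Y \<and> (\<forall>w\<in>H. poly (eval_inner (exp w) G) (Y w) = 0)" for Y
  have uniq: "Y1 w = Y2 w" if "isroot Y1" "isroot Y2" "w1 \<in> H" "Y1 w1 = Y2 w1" "w \<in> H" for Y1 Y2 w w1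
  proof -
    have "(exp w, Y1 w) = (exp w, Y2 w)"
    proof (rule covering_space_lift_unique[OF cov, of "\<lambda>w. (exp w, Y1 w)" w1 "\<lambda>w. (exp w, Y2 w)" H exp])
    qed (use that expS convex_connected[OF H(1)] in \<open>auto simp: isroot_def intro!: continuous_intros\<close>)
    then show ?thesis by simp
  qed
  define w0 where "w0 = complex_of_real (ln \<delta> - 1)"
  have w0: "w0 \<in> H" by (simp add: w0_def H_def)
  define R where "R = {y. poly (eval_inner (exp w0) G) y = 0}"
  have cardR: "card R = n" unfolding R_def
    using expS[OF w0] card_roots_rsquarefree[OF sq] deg n by (auto simp: S_def)
  then have finR: "finite R" using n(2) by (auto intro: card_ge_0_finite)
  have "\<exists>Y. isroot Y \<and> Y w0 = y" if y: "y \<in> R" for y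
  proof -
    have 1: "(exp w0, y) \<in> {(x, y). x \<in> S \<and> poly (eval_inner x G) y = 0}"
      using y expS[OF w0] by (simp add: R_def)
    have 2: "continuous_on H exp" "exp \<in> H \<rightarrow> S" "exp w0 = fst (exp w0, y)"
      using expS by (auto intro: continuous_intros)
    obtain g where g: "continuous_on H g" "g \<in> H \<rightarrow> {(x, y). x \<in> S \<and> poly (eval_inner x G) y = 0}"
      "g w0 = (exp w0, y)" "\<And>w. w \<in> H \<Longrightarrow> fst (g w) = exp w"
      by (rule covering_space_lift_strong[OF cov 1 w0 convex_imp_simply_connected[OF H(1)]
          convex_imp_locally_path_connected[OF H(1)] 2]) (rule that)
    have "isroot (\<lambda>w. snd (g w))"
      unfolding isroot_def
    proof (intro conjI ballI)
      show "continuous_on H (\<lambda>w. snd (g w))" using g(1) by (intro continuous_intros)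
      fix w assume "w \<in> H"
      then have "g w \<in> {(x, y). x \<in> S \<and> poly (eval_inner x G) y = 0}" "fst (g w) = exp w"
        by (rule funcset_mem[OF g(2)], rule g(4))
      then show "poly (eval_inner (exp w) G) (snd (g w)) = 0" by (simp add: case_prod_unfold)
    qed
    then show ?thesis using g(3) by (intro exI[of _ "\<lambda>w. snd (g w)"]) auto
  qed
  then obtain Y where Y: "\<And>y. y \<in> R \<Longrightarrow> isroot (Y y)" "\<And>y. y \<in> R \<Longrightarrow> Y y w0 = y" by metis
  have inj: "inj_on (\<lambda>y. Y y w) R" if w: "w \<in> H" for w
  proof (rule inj_onI)
    fix y y' assume y: "y \<in> R" "y' \<in> R" "Y y w = Y y' w"
    from uniq[OF Y(1)[OF y(1)] Y(1)[OF y(2)] w y(3) w0] show "y = y'" using Y(2) y by simp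
  qed
  have period: "Y y (w + 2 * pi * of_nat (fact n) * \<i>) = Y y w" if y: "y \<in> R" and w: "w \<in> H" for y w
  proof -
    define s where "s k w = w + 2 * pi * of_nat k * \<i>" for k and w :: complex
    have sH: "s k w \<in> H \<longleftrightarrow> w \<in> H" for k w by (simp add: s_def H_def)
    have sexp: "exp (s k w) = exp w" for k w
      using exp_of_nat_mult[of k "2 * of_real pi * \<i>"] by (simp add: s_def exp_add mult_ac)
    have sadd: "s j (s k w) = s (j + k) w" for j k w by (simp add: s_def algebra_simps)
    have root: "isroot (\<lambda>w. Y y (s k w))" for k
    proof -
      have "continuous_on H (\<lambda>w. Y y (s k w))"
      proof (rule continuous_on_compose2[of H "Y y"])
        show "continuous_on H (s k)" unfolding s_def by (intro continuous_intros)
      qed (use Y(1)[OF y] sH in \<open>auto simp: isroot_def\<close>)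
      moreover have "poly (eval_inner (exp w) G) (Y y (s k w)) = 0" if "w \<in> H" for w
      proof -
        have "s k w \<in> H" using that sH by simp
        then have "poly (eval_inner (exp (s k w)) G) (Y y (s k w)) = 0"
          using Y(1)[OF y] by (simp add: isroot_def)
        then show ?thesis by (simp only: sexp)
      qed
      ultimately show ?thesis by (simp add: isroot_def)
    qed
    \<comment> \<open>Among n + 1 shifts by multiples of 2 pi i two agree at \<open>w0\<close>, as
      there are only n roots, and then they agree everywhere. So \<open>j - i\<close>, which is at
      most n, counts the turns of a period of Y.\<close>
    have "\<not> inj_on (\<lambda>k. Y y (s k w0)) {..n}"
    proof (rule pigeonhole)
      have "(\<lambda>k. Y y (s k w0)) ` {..n} \<subseteq> R" using root w0 by (auto simp: isroot_def R_def)
      from card_mono[OF finR this] show "card ((\<lambda>k. Y y (s k w0)) ` {..n}) < card {..n}"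
        using cardR by simp
    qed
    then obtain i j where ij: "i < j" "j \<le> n" "Y y (s i w0) = Y y (s j w0)"
    proof -
      obtain i j where *: "i \<le> n" "j \<le> n" "i \<noteq> j" "Y y (s i w0) = Y y (s j w0)"
        using \<open>\<not> inj_on _ _\<close> unfolding inj_on_def by blast
      show thesis
      proof (cases "i < j")
        case True
        then show ?thesis using that * by blast
      next
        case False
        then have "j < i" using *(3) by simp
        from that[OF this *(1) *(4)[symmetric]] show ?thesis .
      qed
    qed
    have eq: "Y y (s i w) = Y y (s j w)" if "w \<in> H" for w
      using uniq[OF root root w0 ij(3) that] .
    have "Y y (s (j - i) w) = Y y w" if "w \<in> H" for w
    proof -
      define w' where "w' = w - 2 * pi * of_nat i * \<i>"
      have "w' \<in> H" using that by (simp add: w'_def H_def)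
      moreover have "s i w' = w" "s j w' = s (j - i) w" using ij(1) by (simp_all add: s_def w'_def of_nat_diff algebra_simps)
      ultimately show ?thesis using eq[of w'] by simp
    qed note step = this
    have "Y y (s (m * (j - i)) w) = Y y w" if "w \<in> H" for m w using that
    proof (induction m)
      case (Suc m)
      have "s (Suc m * (j - i)) w = s (j - i) (s (m * (j - i)) w)" by (simp add: sadd)
      then show ?case using step[of "s (m * (j - i)) w"] Suc sH by simp
    qed (simp add: s_def)
    moreover have "(j - i) dvd fact n" using ij by (intro dvd_fact) auto
    then obtain m where m: "fact n = m * (j - i)" by (metis dvd_div_mult_self)
    ultimately have "Y y (s (fact n) w) = Y y w" using w by (simp only: m)
    then show ?thesis by (simp add: s_def)
  qed
  have holo: "Y y holomorphic_on H" if y: "y \<in> R" for y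
    unfolding holomorphic_on_open[OF H(2)]
  proof (intro ballI)
    fix z assume z: "z \<in> H"
    have ev: "eventually (\<lambda>w. w \<in> H) (nhds z)" using H(2) z by (rule eventually_nhds_in_open)
    define b where "b = poly (pderiv (eval_inner (exp z) G)) (Y y z)"
    define a where "a = poly (eval_inner (exp z) (map_poly pderiv G)) (Y y z)"
    have a: "((\<lambda>(x, y). poly (eval_inner x G) y) has_derivative (\<lambda>(v, w). a * v + b * w)) (at (exp z, Y y z))"
      unfolding a_def b_def by (rule eval_inner_has_derivative)
    have e: "((\<lambda>(x, y). (exp x, y)) has_derivative (\<lambda>(h, w). (exp z * h, w))) (at (z, Y y z))"
    proof -
      have "(exp has_derivative (\<lambda>v. exp z * v)) (at (fst (z, Y y z)))"
        using DERIV_exp[of z] by (simp add: has_field_derivative_def)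
      from has_derivative_Pair[OF has_derivative_compose[OF has_derivative_fst[OF has_derivative_ident] this]
          has_derivative_snd[OF has_derivative_ident]]
      show ?thesis by (simp add: case_prod_unfold)
    qed
    have "((\<lambda>(w, y). poly (eval_inner (exp w) G) y) has_derivative (\<lambda>(h, w). a * exp z * h + b * w)) (at (z, Y y z))"
      using has_derivative_compose[OF e, of "\<lambda>(x, y). poly (eval_inner x G) y" "\<lambda>(v, w). a * v + b * w"] a
      by (simp add: case_prod_unfold mult.assoc)
    moreover have "b \<noteq> 0"
      using sq[of "exp z"] expS[OF z] Y(1)[OF y] z unfolding rsquarefree_roots b_def isroot_def S_def by blast
    moreover have "isCont (Y y) z"
      using Y(1)[OF y] H(2) z unfolding isroot_def by (auto simp: continuous_on_eq_continuous_at)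
    moreover have "eventually (\<lambda>w. (\<lambda>(w, y). poly (eval_inner (exp w) G) y) (w, Y y w) = 0) (nhds z)"
      using ev Y(1)[OF y] by (auto simp: isroot_def elim: eventually_mono)
    ultimately have "(Y y has_derivative (\<lambda>h. - (a * exp z * h) / b)) (at z)"
      by (rule implicit_has_derivative)
    moreover have "(\<lambda>h. - (a * exp z * h) / b) = (*) (- (a * exp z) / b)" by (simp add: fun_eq_iff)
    ultimately have "(Y y has_field_derivative (- (a * exp z) / b)) (at z)"
      by (simp add: has_field_derivative_def)
    then show "\<exists>f'. (Y y has_field_derivative f') (at z)" by blast
  qed
  have fact: "eval_inner (exp w) G = (\<Prod>y\<in>R. [:- Y y w, 1:])" if w: "w \<in> H" for w
  proof -
    have "eval_inner (exp w) G = (\<Prod>v\<in>(\<lambda>y. Y y w) ` R. [:- v, 1:])"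
    proof (rule poly_eq_prod_linear_factors)
      show "card ((\<lambda>y. Y y w) ` R) = degree (eval_inner (exp w) G)"
        using deg n cardR by (simp add: card_image[OF inj[OF w]])
    qed (use deg finR Y(1) w in \<open>auto simp: isroot_def\<close>)
    then show ?thesis by (simp add: prod.reindex[OF inj[OF w]])
  qed
  have "inj_on Y R" by (rule inj_onI) (metis Y(2))
  show ?thesis
  proof (intro exI[of _ "Y ` R"] conjI ballI)
    show "card (Y ` R) = n" using card_image[OF \<open>inj_on Y R\<close>] cardR by simp
    show "eval_inner (exp w) G = (\<Prod>Y\<in>Y ` R. [:- Y w, 1:])" if "w \<in> H" for w
      using fact[OF that] by (simp add: prod.reindex[OF \<open>inj_on Y R\<close>])
  qed (use finR holo period in auto)
qed

text \<open>Across its cut \<open>Ln\<close> jumps by 2 pi i, so the argument of Y jumps by a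
  period. Off the positive axis the branch \<open>Ln (- u) + \<i> * pi\<close> is holomorphic and
  yields the same values of Y, and the two slit discs cover the punctured disc.\<close>

lemma periodic_function_of_Ln:
  fixes Y :: "complex \<Rightarrow> complex"
  assumes holo: "Y holomorphic_on {w. Re w < ln \<delta>}" and \<delta>: "0 < \<delta>" and N: "0 < N"
    and per: "\<And>w. Re w < ln \<delta> \<Longrightarrow> Y (w + 2 * pi * of_nat N * \<i>) = Y w"
  shows "(\<lambda>u. Y (of_nat N * Ln u)) holomorphic_on (ball 0 (root N \<delta>) - {0})"
proof -
  have per': "Y (w + 2 * pi * of_nat (m * N) * \<i>) = Y w" if "Re w < ln \<delta>" for w m using that
  proof (induction m)
    case (Suc m)
    have "Y (w + 2 * pi * of_nat (Suc m * N) * \<i>) = Y ((w + 2 * pi * of_nat (m * N) * \<i>) + 2 * pi * of_nat N * \<i>)"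
      by (simp add: algebra_simps)
    then show ?case using Suc per[of "w + 2 * pi * of_nat (m * N) * \<i>"] by simp
  qed simp
  have per_int: "Y (of_nat N * w1) = Y (of_nat N * w2)"
    if eq: "exp w1 = exp w2" and w: "Re (of_nat N * w1) < ln \<delta>" for w1 w2
  proof -
    obtain k :: int where k: "w1 = w2 + of_int (2 * k) * pi * \<i>" using eq by (auto simp: exp_eq)
    then have re: "Re (of_nat N * w2) < ln \<delta>" using w by simp
    show ?thesis
    proof (cases "0 \<le> k")
      case True
      then have "of_nat N * w1 = of_nat N * w2 + 2 * pi * of_nat (nat k * N) * \<i>"
        by (simp add: k algebra_simps of_nat_nat)
      then show ?thesis using per'[OF re, of "nat k"] by simp
    next
      case False
      then have "of_nat N * w2 = of_nat N * w1 + 2 * pi * of_nat (nat (- k) * N) * \<i>"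
        by (simp add: k algebra_simps of_nat_nat)
      then show ?thesis using per'[OF w, of "nat (- k)"] by simp
    qed
  qed
  have re: "Re (of_nat N * Ln u) < ln \<delta>" if "u \<in> ball 0 (root N \<delta>) - {0}" for u
  proof -
    have u: "0 < norm u" "norm u < root N \<delta>" using that by auto
    then have "norm u ^ N < root N \<delta> ^ N" using N by (intro power_strict_mono) auto
    then have "norm u ^ N < \<delta>" using N \<delta> by simp
    then have "ln (norm u ^ N) < ln \<delta>" using u \<delta> by (subst ln_less_cancel_iff) auto
    then show ?thesis using u by (simp add: ln_realpow)
  qed
  have holo1: "(\<lambda>u. Y (of_nat N * Ln u)) holomorphic_on (ball 0 (root N \<delta>) - \<real>\<^sub>\<le>\<^sub>0)"
  proof (rule holomorphic_on_compose_gen[OF _ holo, unfolded o_def])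
    show "(\<lambda>u. of_nat N * Ln u) ` (ball 0 (root N \<delta>) - \<real>\<^sub>\<le>\<^sub>0) \<subseteq> {w. Re w < ln \<delta>}"
    proof safe
      fix u :: complex assume "u \<in> ball 0 (root N \<delta>)" "u \<notin> \<real>\<^sub>\<le>\<^sub>0"
      then have "u \<in> ball 0 (root N \<delta>) - {0}" by auto
      then show "Re (of_nat N * Ln u) < ln \<delta>" by (rule re)
    qed
  qed (intro holomorphic_intros, auto)
  have holo2: "(\<lambda>u. Y (of_nat N * Ln u)) holomorphic_on (ball 0 (root N \<delta>) - \<real>\<^sub>\<ge>\<^sub>0)"
  proof (rule holomorphic_transform)
    show "(\<lambda>u. Y (of_nat N * (Ln (- u) + \<i> * pi))) holomorphic_on (ball 0 (root N \<delta>) - \<real>\<^sub>\<ge>\<^sub>0)"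
    proof (rule holomorphic_on_compose_gen[OF _ holo, unfolded o_def])
      show "(\<lambda>u. of_nat N * (Ln (- u) + \<i> * pi)) holomorphic_on (ball 0 (root N \<delta>) - \<real>\<^sub>\<ge>\<^sub>0)"
        by (intro holomorphic_intros) (auto simp: complex_nonpos_Reals_iff complex_nonneg_Reals_iff)
      show "(\<lambda>u. of_nat N * (Ln (- u) + \<i> * pi)) ` (ball 0 (root N \<delta>) - \<real>\<^sub>\<ge>\<^sub>0) \<subseteq> {w. Re w < ln \<delta>}"
      proof safe
        fix u :: complex assume u: "u \<in> ball 0 (root N \<delta>)" "u \<notin> \<real>\<^sub>\<ge>\<^sub>0"
        then have "- u \<in> ball 0 (root N \<delta>) - {0}" by (auto simp: dist_norm)
        from re[OF this] show "Re (of_nat N * (Ln (- u) + \<i> * pi)) < ln \<delta>" by simp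
      qed
    qed
    fix u :: complex assume u: "u \<in> ball 0 (root N \<delta>) - \<real>\<^sub>\<ge>\<^sub>0"
    then have "u \<noteq> 0" by auto
    then have "exp (Ln u) = exp (Ln (- u) + \<i> * pi)" by (simp add: exp_add)
    moreover have "Re (of_nat N * Ln u) < ln \<delta>" using u \<open>u \<noteq> 0\<close> by (intro re) auto
    ultimately show "Y (of_nat N * (Ln (- u) + \<i> * pi)) = Y (of_nat N * Ln u)"
      using per_int by metis
  qed
  have "u = 0" if "u \<in> \<real>\<^sub>\<le>\<^sub>0" "u \<in> \<real>\<^sub>\<ge>\<^sub>0" for u :: complex
    using that by (simp add: complex_nonpos_Reals_iff complex_nonneg_Reals_iff complex_eq_iff)
  then have "ball 0 (root N \<delta>) - {0} = (ball 0 (root N \<delta>) - \<real>\<^sub>\<le>\<^sub>0) \<union> (ball 0 (root N \<delta>) - (\<real>\<^sub>\<ge>\<^sub>0 :: complex set))"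
    by auto
  moreover have "open (ball 0 (root N \<delta>) - (\<real>\<^sub>\<le>\<^sub>0 :: complex set))" "open (ball 0 (root N \<delta>) - (\<real>\<^sub>\<ge>\<^sub>0 :: complex set))"
    by (intro open_Diff open_ball closed_nonpos_Reals_complex closed_nonneg_Reals_complex)+
  ultimately show ?thesis
    using holomorphic_on_Un[OF holo1 holo2] by simp
qed

text \<open>Inserting \<open>w = of_nat N * Ln u\<close> turns the periodic lifts into functions on
  a punctured disc. They are bounded, as roots of monic polynomials with bounded coefficients, so
  they extend to u = 0, and the factorisation extends by continuity.\<close>

lemma puiseux_rsquarefree:
  fixes G :: "complex poly poly"
  assumes lc: "lead_coeff G = 1" and n: "degree G = n" "0 < n"
    and N: "fact n dvd N" "0 < N"
    and sq: "\<And>x. 0 < norm x \<Longrightarrow> norm x < \<delta> \<Longrightarrow> rsquarefree (eval_inner x G)" and \<delta>: "0 < \<delta>"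
  shows "\<exists>\<rho>>0. \<exists>hs. length hs = n \<and> (\<forall>h\<in>set hs. h holomorphic_on ball 0 \<rho>) \<and>
    (\<forall>u\<in>ball 0 \<rho>. eval_inner (u ^ N) G = (\<Prod>h\<leftarrow>hs. [:- h u, 1:]))"
proof -
  have lc': "lead_coeff G = [:1:]" using lc by (simp add: one_pCons)
  note deg = degree_eval_inner[OF lc', simplified]
  obtain \<Y> where \<Y>: "finite \<Y>" "card \<Y> = n"
    "\<And>Y. Y \<in> \<Y> \<Longrightarrow> Y holomorphic_on {w. Re w < ln \<delta>}"
    "\<And>Y w. Y \<in> \<Y> \<Longrightarrow> Re w < ln \<delta> \<Longrightarrow> Y (w + 2 * pi * of_nat (fact n) * \<i>) = Y w"
    "\<And>w. Re w < ln \<delta> \<Longrightarrow> eval_inner (exp w) G = (\<Prod>Y\<in>\<Y>. [:- Y w, 1:])"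
    using continuous_root_along_exp[OF lc n sq \<delta>] by auto
  define \<rho> where "\<rho> = root N \<delta>"
  have \<rho>: "0 < \<rho>" using N \<delta> by (simp add: \<rho>_def)
  have perN: "Y (w + 2 * pi * of_nat N * \<i>) = Y w" if Y: "Y \<in> \<Y>" and w: "Re w < ln \<delta>" for Y w
  proof -
    have "Y (w + 2 * pi * of_nat (m * fact n) * \<i>) = Y w" for m
    proof (induction m)
      case (Suc m)
      have "Y (w + 2 * pi * of_nat (Suc m * fact n) * \<i>) =
        Y ((w + 2 * pi * of_nat (m * fact n) * \<i>) + 2 * pi * of_nat (fact n) * \<i>)"
        by (simp add: algebra_simps)
      then show ?case using Suc \<Y>(4)[OF Y, of "w + 2 * pi * of_nat (m * fact n) * \<i>"] w by simp
    qed simp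
    moreover obtain m where "N = m * fact n" using N(1) by (metis dvd_div_mult_self)
    ultimately show ?thesis by simp
  qed
  define k where "k Y u = Y (of_nat N * Ln u)" for Y :: "complex \<Rightarrow> complex" and u :: complex
  have holo: "k Y holomorphic_on (ball 0 \<rho> - {0})" if "Y \<in> \<Y>" for Y
    unfolding k_def \<rho>_def using periodic_function_of_Ln[OF \<Y>(3)[OF that] \<delta> N(2)] perN[OF that] by blast
  have small: "norm (u ^ N) < \<delta>" if "u \<in> ball 0 \<rho>" for u :: complex
  proof -
    have "norm u ^ N < root N \<delta> ^ N" using that N by (intro power_strict_mono) (auto simp: \<rho>_def)
    then show ?thesis using N \<delta> by (simp add: norm_power)
  qed
  have fact: "eval_inner (u ^ N) G = (\<Prod>Y\<in>\<Y>. [:- k Y u, 1:])" if u: "u \<in> ball 0 \<rho> - {0}" for u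
  proof -
    have "exp (of_nat N * Ln u) = u ^ N" using u by (simp add: exp_of_nat_mult)
    moreover have "ln (norm (u ^ N)) < ln \<delta>" using u small[of u] \<delta> by (subst ln_less_cancel_iff) auto
    then have "Re (of_nat N * Ln u) < ln \<delta>" using u by (simp add: ln_realpow norm_power)
    ultimately show ?thesis using \<Y>(5)[of "of_nat N * Ln u"] by (simp add: k_def)
  qed
  have "\<exists>M. \<forall>x\<in>cball 0 \<delta>. norm (coeff (eval_inner x G) i) \<le> M" for i
  proof -
    have "compact ((\<lambda>x. coeff (eval_inner x G) i) ` cball 0 \<delta>)"
      unfolding coeff_eval_inner by (intro compact_continuous_image continuous_intros compact_cball)
    from compact_imp_bounded[OF this] show ?thesis by (auto simp: bounded_iff)
  qed
  then obtain M where M: "\<And>x i. x \<in> cball 0 \<delta> \<Longrightarrow> norm (coeff (eval_inner x G) i) \<le> M i" by metis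
  define B where "B = max 1 (real n * Max (M ` {..<n}))"
  have bound: "norm (k Y u) \<le> B" if u: "u \<in> ball 0 \<rho> - {0}" and Y: "Y \<in> \<Y>" for Y u
    unfolding B_def
  proof (rule monic_poly_root_bound)
    show "poly (eval_inner (u ^ N) G) (k Y u) = 0"
      using fact[OF u] Y \<Y>(1) by (auto simp: poly_prod intro: prod_zero)
    fix i assume "i < n"
    then have "M i \<le> Max (M ` {..<n})" by (intro Max_ge) auto
    moreover have "norm (coeff (eval_inner (u ^ N) G) i) \<le> M i"
      using small[of u] u by (intro M) auto
    ultimately show "norm (coeff (eval_inner (u ^ N) G) i) \<le> Max (M ` {..<n})" by linarith
  qed (use deg n in auto)
  have "\<exists>h. h holomorphic_on ball 0 \<rho> \<and> (\<forall>u\<in>ball 0 \<rho> - {0}. h u = k Y u)" if Y: "Y \<in> \<Y>" for Y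
  proof -
    have "eventually (\<lambda>u. u \<in> ball 0 \<rho> - {0}) (at (0::complex))"
      using \<rho> by (auto simp: eventually_at_filter intro!: eventually_mono[OF eventually_nhds_in_open[of "ball 0 \<rho>" 0]])
    then have "eventually (\<lambda>u. norm (k Y u) \<le> B) (at 0)" by eventually_elim (use bound Y in blast)
    then show ?thesis
      using holomorphic_on_extend_bounded[OF holo[OF Y]] \<rho> by (auto simp: interior_open)
  qed
  then obtain h where h: "\<And>Y. Y \<in> \<Y> \<Longrightarrow> h Y holomorphic_on ball 0 \<rho>"
    "\<And>Y u. Y \<in> \<Y> \<Longrightarrow> u \<in> ball 0 \<rho> - {0} \<Longrightarrow> h Y u = k Y u" by metis
  have fact': "eval_inner (u ^ N) G = (\<Prod>Y\<in>\<Y>. [:- h Y u, 1:])" if u: "u \<in> ball 0 \<rho>" for u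
  proof (cases "u = 0")
    case False
    then show ?thesis using fact[of u] u h(2) by (auto intro!: prod.cong)
  next
    case True
    have "poly (eval_inner (u ^ N) G) y = poly (\<Prod>Y\<in>\<Y>. [:- h Y u, 1:]) y" for y
    proof -
      define D where "D u = poly (eval_inner (u ^ N) G) y - (\<Prod>Y\<in>\<Y>. y - h Y u)" for u
      have "continuous_on (ball 0 \<rho>) D"
        unfolding D_def poly_eval_inner
        by (intro continuous_intros holomorphic_on_imp_continuous_on h(1))
      then have "isCont D 0" using \<rho> by (simp add: continuous_on_eq_continuous_at)
      then have "D \<midarrow>0\<rightarrow> D 0" by (simp add: isCont_def)
      moreover have "eventually (\<lambda>u. D u = 0) (at 0)"
      proof -
        have "eventually (\<lambda>u. u \<in> ball 0 \<rho> - {0}) (at (0::complex))"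
          using \<rho> by (auto simp: eventually_at_filter intro!: eventually_mono[OF eventually_nhds_in_open[of "ball 0 \<rho>" 0]])
        then show ?thesis
        proof eventually_elim
          case (elim u)
          then show ?case using fact[OF elim] h(2)[OF _ elim] by (simp add: D_def poly_prod)
        qed
      qed
      then have "D \<midarrow>0\<rightarrow> 0" by (rule tendsto_eventually)
      ultimately have "D 0 = 0" using LIM_unique by blast
      then show ?thesis using True by (simp add: D_def poly_prod)
    qed
    then show ?thesis by (simp add: poly_eq_poly_eq_iff[symmetric] fun_eq_iff)
  qed
  obtain Ys where Ys: "set Ys = \<Y>" "distinct Ys" using finite_distinct_list[OF \<Y>(1)] by blast
  show ?thesis
  proof (intro exI[of _ \<rho>] conjI exI[of _ "map h Ys"] ballI \<rho>)
    show "length (map h Ys) = n" using Ys \<Y>(2) distinct_card by fastforce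
    fix u :: complex assume "u \<in> ball 0 \<rho>"
    from fact'[OF this] show "eval_inner (u ^ N) G = (\<Prod>h\<leftarrow>map h Ys. [:- h u, 1:])"
      using prod.distinct_set_conv_list[OF Ys(2), of "\<lambda>Y. [:- h Y u, 1:]"] Ys(1) by (simp add: o_def)
  qed (use h(1) Ys in auto)
qed

text \<open>An irreducible polynomial has simple roots over a small punctured disc, namely off the
  zeros of its Bezout polynomial. A reducible one splits into monic factors of smaller degree;
  concatenating their lists keeps multiplicities, and since both factorials divide N the factors
  share the parameter u.\<close>

lemma puiseux_monic:
  fixes G :: "complex poly poly"
  assumes "lead_coeff G = 1" "degree G = n" "fact n dvd N" "0 < N"
  shows "\<exists>\<rho>>0. \<exists>hs. length hs = n \<and> (\<forall>h\<in>set hs. h holomorphic_on ball 0 \<rho>) \<and>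
    (\<forall>u\<in>ball 0 \<rho>. eval_inner (u ^ N) G = (\<Prod>h\<leftarrow>hs. [:- h u, 1:]))"
  using assms
proof (induction n arbitrary: G rule: less_induct)
  case (less n)
  note lc = less.prems(1) and deg = less.prems(2)
  show ?case
  proof (cases "n = 0")
    case True
    then obtain c where "G = [:c:]" using deg by (metis degree_eq_zeroE)
    then have "G = 1" using lc by (simp add: one_pCons)
    then show ?thesis using True by (intro exI[of _ 1] conjI exI[of _ "[]"]) (auto simp: one_pCons)
  next
    case n: False
    show ?thesis
    proof (cases "irreducible G")
      case True
      then obtain A B r where r: "r \<noteq> 0" "A * G + B * pderiv G = [:r:]"
        using irreducible_bezout_pderiv n deg by blast
      have "finite {x. poly r x = 0}" using r(1) by (rule poly_roots_finite)
      \<comment> \<open>The point 0 may itself be a zero of \<open>r\<close>; the punctured disc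
        does not contain it.\<close>
      then have "finite ({x. poly r x = 0} - {0})" by simp
      from finite_imp_closed[OF this] have "open (- ({x. poly r x = 0} - {0}))" by (rule open_Compl)
      then obtain \<delta> where \<delta>: "0 < \<delta>" "ball 0 \<delta> \<subseteq> - ({x. poly r x = 0} - {0})"
        by (metis Compl_iff Diff_iff insertI1 open_contains_ball)
      show ?thesis
      proof (rule puiseux_rsquarefree[OF lc deg _ less.prems(3,4) _ \<delta>(1)])
        fix x :: complex assume x: "0 < norm x" "norm x < \<delta>"
        then have rx: "poly r x \<noteq> 0" using \<delta>(2) by (auto simp: subset_iff)
        have "eval_inner x A * eval_inner x G + eval_inner x B * pderiv (eval_inner x G) = [:poly r x:]"
          using arg_cong[OF r(2), of "eval_inner x"] by (simp add: eval_inner_add eval_inner_mult eval_inner_pderiv)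
        then have eq: "poly (eval_inner x A) a * poly (eval_inner x G) a +
            poly (eval_inner x B) a * poly (pderiv (eval_inner x G)) a = poly r x" for a
          by (metis poly_add poly_mult poly_const_conv)
        show "rsquarefree (eval_inner x G)"
          unfolding rsquarefree_roots
        proof (intro allI notI, elim conjE)
          fix a assume "poly (eval_inner x G) a = 0" "poly (pderiv (eval_inner x G)) a = 0"
          then show False using eq[of a] rx by simp
        qed
      qed (use n in auto)
    next
      case False
      have "G \<noteq> 0" using deg n by auto
      moreover have "\<not> is_unit G"
        using deg n dvd_imp_degree_le[of G 1] by auto
      ultimately obtain A B where AB: "G = A * B" "\<not> is_unit A" "\<not> is_unit B" using False by (auto simp: irreducible_def)
      have AB0: "A \<noteq> 0" "B \<noteq> 0" using AB \<open>G \<noteq> 0\<close> by auto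
      have l: "lead_coeff A * lead_coeff B = 1" using lc AB(1) by (simp add: lead_coeff_mult)
      \<comment> \<open>The leading coefficients are inverse to each other, so exchanging them makes
        both factors monic.\<close>
      define A' where "A' = smult (lead_coeff B) A"
      define B' where "B' = smult (lead_coeff A) B"
      have G: "G = A' * B'" using l AB(1) by (simp add: A'_def B'_def mult.commute)
      have lc': "lead_coeff A' = 1" "lead_coeff B' = 1" using l by (auto simp: A'_def B'_def mult.commute)
      have "degree G = degree A + degree B" using AB0 AB(1) by (simp add: degree_mult_eq)
      moreover have unit: "is_unit F" if "degree F = 0" "lead_coeff F * c = 1" for F :: "complex poly poly" and c
        using that by (elim degree_eq_zeroE) (auto simp: is_unit_const_poly_iff intro: dvdI[of 1 _ c])
      moreover have "degree A \<noteq> 0" "degree B \<noteq> 0"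
        using unit[of A] unit[of B] AB(2,3) l by (metis mult.commute)+
      moreover have "degree A' = degree A" "degree B' = degree B"
        using AB0 by (auto simp: A'_def B'_def)
      ultimately have d: "degree A' < n" "degree B' < n" "n = degree A' + degree B'" using deg by auto
      have fd: "fact (degree A') dvd N" "fact (degree B') dvd N"
        using d less.prems(3) fact_dvd[of "degree A'" n] fact_dvd[of "degree B'" n] by (metis dvd_trans less_imp_le)+
      obtain \<rho>1 hs1 where 1: "\<rho>1 > 0" "length hs1 = degree A'" "\<forall>h\<in>set hs1. h holomorphic_on ball 0 \<rho>1"
        "\<forall>u\<in>ball 0 \<rho>1. eval_inner (u ^ N) A' = (\<Prod>h\<leftarrow>hs1. [:- h u, 1:])"
        using less.IH[OF d(1) lc'(1) refl fd(1) less.prems(4)] by blast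
      obtain \<rho>2 hs2 where 2: "\<rho>2 > 0" "length hs2 = degree B'" "\<forall>h\<in>set hs2. h holomorphic_on ball 0 \<rho>2"
        "\<forall>u\<in>ball 0 \<rho>2. eval_inner (u ^ N) B' = (\<Prod>h\<leftarrow>hs2. [:- h u, 1:])"
        using less.IH[OF d(2) lc'(2) refl fd(2) less.prems(4)] by blast
      show ?thesis
      proof (intro exI[of _ "min \<rho>1 \<rho>2"] conjI exI[of _ "hs1 @ hs2"])
        show "\<forall>h\<in>set (hs1 @ hs2). h holomorphic_on ball 0 (min \<rho>1 \<rho>2)"
          using 1(3) 2(3) by (auto intro: holomorphic_on_subset[of _ "ball 0 \<rho>1"] holomorphic_on_subset[of _ "ball 0 \<rho>2"])
      qed (use 1 2 d(3) in \<open>auto simp: G eval_inner_mult\<close>)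
    qed
  qed
qed

subsection \<open>Dicriticals\<close>

text \<open>The substitution of \<open>z * u\<close> for u; if \<open>z ^ N = 1\<close>, it is a
  deck transformation of the covering w = u^N.\<close>

definition fps_act :: "complex \<Rightarrow> complex fps \<Rightarrow> complex fps" where
  "fps_act z F = Abs_fps (\<lambda>n. z ^ n * fps_nth F n)"

lemma fps_act_nth [simp]: "fps_nth (fps_act z F) n = z ^ n * fps_nth F n"
  by (simp add: fps_act_def)

lemma fps_act_add: "fps_act z (F + G) = fps_act z F + fps_act z G"
  and fps_act_0 [simp]: "fps_act z 0 = 0"
  and fps_act_1 [simp]: "fps_act 1 F = F"
  and fps_act_act: "fps_act z (fps_act w F) = fps_act (z * w) F"
  and fps_act_const [simp]: "fps_act z (fps_const c) = fps_const c"
  and fps_act_X_power: "fps_act z (fps_X ^ k) = fps_const (z ^ k) * fps_X ^ k"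
  by (auto simp: fps_eq_iff algebra_simps power_mult_distrib fps_X_power_nth)

lemma fps_act_mult: "fps_act z (F * G) = fps_act z F * fps_act z G"
  by (auto simp: fps_eq_iff fps_mult_nth sum_distrib_left mult_ac simp flip: power_add intro!: sum.cong)

lemma fps_act_poly: "fps_act z (poly W F) = poly (map_poly (fps_act z) W) (fps_act z F)"
  by (induction W) (simp_all add: fps_act_add fps_act_mult map_poly_pCons)

lemma fps_act_cutoff: "fps_act z (fps_cutoff q F) = fps_cutoff q (fps_act z F)"
  by (simp add: fps_eq_iff)

definition agree_upto :: "nat \<Rightarrow> 'a::zero fps \<Rightarrow> 'a fps \<Rightarrow> bool" where
  "agree_upto q F G \<longleftrightarrow> (\<forall>n<q. fps_nth F n = fps_nth G n)"

lemma agree_upto_iff_cutoff: "agree_upto q F G \<longleftrightarrow> fps_cutoff q F = fps_cutoff q G"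
  by (auto simp: agree_upto_def fps_eq_iff)

lemma agree_upto_imp_eq_add:
  fixes F G :: "'a::comm_ring_1 fps"
  assumes "agree_upto q F G"
  shows "F = G + fps_shift q (F - G) * fps_X ^ q"
proof -
  have "F - G = fps_shift q (F - G) * fps_X ^ q"
    using assms by (auto simp: fps_eq_iff agree_upto_def fps_X_power_mult_right_nth)
  then show ?thesis by (simp add: algebra_simps)
qed

text \<open>\<open>exponent_at q R\<close> is the order of \<open>R + t X\<^sup>q\<close> for generic \<open>t\<close>, and \<open>leading_at q R\<close>
  its leading coefficient as a polynomial in \<open>t\<close>.\<close>

definition exponent_at :: "nat \<Rightarrow> complex fps \<Rightarrow> nat" where
  "exponent_at q R = (if agree_upto q R 0 then q else subdegree R)"

definition leading_at :: "nat \<Rightarrow> complex fps \<Rightarrow> complex poly" where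
  "leading_at q R = (if agree_upto q R 0 then [:fps_nth R q, 1:] else [:fps_nth R (subdegree R):])"

lemma not_agree_zeroD:
  assumes "\<not> agree_upto q R 0"
  shows "R \<noteq> 0" "subdegree R < q" "fps_nth R (subdegree R) \<noteq> 0"
proof -
  obtain n where n: "n < q" "fps_nth R n \<noteq> 0" using assms by (auto simp: agree_upto_def)
  then show "R \<noteq> 0" by auto
  then show "fps_nth R (subdegree R) \<noteq> 0" by simp
  show "subdegree R < q" using n subdegree_leI[of R n] by simp
qed

lemma leading_at_nonzero: "leading_at q R \<noteq> 0"
  using not_agree_zeroD[of q R] by (auto simp: leading_at_def)

lemma degree_leading_at: "degree (leading_at q R) = (if agree_upto q R 0 then 1 else 0)"
  by (simp add: leading_at_def)

text \<open>The perturbation \<open>\<delta>\<close> is a whole series and not just a number t: its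
  higher terms do not reach the leading coefficient. So limits can be taken along all arcs that
  begin with F + t u^q.\<close>

lemma expand_factor:
  "\<exists>S. R + \<delta> * fps_X ^ q = fps_X ^ exponent_at q R * S \<and> fps_nth S 0 = poly (leading_at q R) (fps_nth \<delta> 0)"
proof (cases "agree_upto q R 0")
  case True
  then have R: "fps_shift q R * fps_X ^ q = R" using agree_upto_imp_eq_add[of q R 0, symmetric] by simp
  have "R + \<delta> * fps_X ^ q = fps_X ^ q * (fps_shift q R + \<delta>)"
    by (subst R[symmetric]) (simp only: algebra_simps)
  then show ?thesis using True by (intro exI[of _ "fps_shift q R + \<delta>"]) (simp add: exponent_at_def leading_at_def)
next
  case False
  define s where "s = subdegree R"
  have s: "s < q" using not_agree_zeroD[OF False] by (simp add: s_def)
  have R: "fps_shift s R * fps_X ^ s = R" unfolding s_def by (rule subdegree_decompose[symmetric])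
  have X: "fps_X ^ (q - s) * (fps_X ^ s :: complex fps) = fps_X ^ q" using s by (simp flip: power_add)
  have "R + \<delta> * fps_X ^ q = fps_X ^ s * (fps_shift s R + \<delta> * fps_X ^ (q - s))"
    by (subst R[symmetric], subst X[symmetric]) (simp only: algebra_simps)
  moreover have "fps_nth (fps_shift s R + \<delta> * fps_X ^ (q - s)) 0 = fps_nth R s"
    using s by (simp add: fps_X_power_mult_right_nth)
  ultimately show ?thesis
    using False by (intro exI[of _ "fps_shift s R + \<delta> * fps_X ^ (q - s)"])
      (simp add: exponent_at_def leading_at_def s_def)
qed

lemma expand_product:
  "\<exists>S. (\<Prod>R\<leftarrow>Rs. R + \<delta> * fps_X ^ q) = fps_X ^ (\<Sum>R\<leftarrow>Rs. exponent_at q R) * S \<and>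
    fps_nth S 0 = poly (\<Prod>R\<leftarrow>Rs. leading_at q R) (fps_nth \<delta> 0)"
proof (induction Rs)
  case (Cons R Rs)
  then obtain S where S: "(\<Prod>R\<leftarrow>Rs. R + \<delta> * fps_X ^ q) = fps_X ^ (\<Sum>R\<leftarrow>Rs. exponent_at q R) * S"
    "fps_nth S 0 = poly (\<Prod>R\<leftarrow>Rs. leading_at q R) (fps_nth \<delta> 0)" by blast
  obtain S' where S': "R + \<delta> * fps_X ^ q = fps_X ^ exponent_at q R * S'"
    "fps_nth S' 0 = poly (leading_at q R) (fps_nth \<delta> 0)" using expand_factor by blast
  show ?case
    by (intro exI[of _ "S' * S"]) (simp add: S S' power_add mult_ac)
qed (auto intro!: exI[of _ 1])

lemma prod_list_nonzero_iff:
  fixes f :: "'b \<Rightarrow> 'a::idom"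
  shows "(\<Prod>x\<leftarrow>xs. f x) = 0 \<longleftrightarrow> (\<exists>x\<in>set xs. f x = 0)"
  by (induction xs) auto

lemma poly_prod_list_map: "poly (\<Prod>x\<leftarrow>xs. f x) t = (\<Prod>x\<leftarrow>xs. poly (f x) t)"
  by (induction xs) auto

lemma degree_prod_list_map:
  fixes f :: "'b \<Rightarrow> 'a::idom poly"
  assumes "\<And>x. f x \<noteq> 0"
  shows "degree (\<Prod>x\<leftarrow>xs. f x) = (\<Sum>x\<leftarrow>xs. degree (f x))"
  using assms by (induction xs) (auto simp: degree_mult_eq prod_list_nonzero_iff)

text \<open>\<open>W\<close> is a polynomial in \<open>y\<close> over the series in \<open>u\<close>, where \<open>w = u\<^sup>N\<close>; the roots of \<open>W - a u\<^bsup>Nd\<^esup>\<close>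
  parametrise the fibre over \<open>a\<close> at infinity.\<close>

locale fibre_series =
  fixes W :: "complex fps poly" and lc :: complex and d N :: nat
  assumes d_pos: "0 < d" and N_pos: "0 < N" and lc_nonzero: "lc \<noteq> 0"
    and W_invariant: "\<And>z. z ^ N = 1 \<Longrightarrow> map_poly (fps_act z) W = W"
    and W_splits: "\<And>a. \<exists>Hs. length Hs = d \<and>
      W - [:fps_const a * fps_X ^ (N * d):] = smult (fps_const lc) (\<Prod>H\<leftarrow>Hs. [:- H, 1:])"
begin

text \<open>A list, because multiplicities enter the degrees of the limit polynomials.\<close>

definition root_list :: "complex \<Rightarrow> complex fps list" where
  "root_list a = (SOME Hs. length Hs = d \<and>
      W - [:fps_const a * fps_X ^ (N * d):] = smult (fps_const lc) (\<Prod>H\<leftarrow>Hs. [:- H, 1:]))"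

lemma root_list: "length (root_list a) = d"
  "W - [:fps_const a * fps_X ^ (N * d):] = smult (fps_const lc) (\<Prod>H\<leftarrow>root_list a. [:- H, 1:])"
  using someI_ex[OF W_splits[of a]] by (auto simp: root_list_def)

definition fibre :: "complex \<Rightarrow> complex fps set" where
  "fibre a = {H. poly W H = fps_const a * fps_X ^ (N * d)}"

lemma poly_W_eq:
  "poly W F = fps_const a * fps_X ^ (N * d) + fps_const lc * (\<Prod>H\<leftarrow>root_list a. F - H)"
proof -
  have "poly W F - fps_const a * fps_X ^ (N * d) = fps_const lc * (\<Prod>H\<leftarrow>root_list a. F - H)"
    using arg_cong[OF root_list(2)[of a], of "\<lambda>p. poly p F"] by (simp add: poly_prod_list_map)
  then show ?thesis by (simp add: algebra_simps)
qed

lemma fibre_eq: "fibre a = set (root_list a)"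
  using lc_nonzero prod_list_nonzero_iff[of "\<lambda>H. _ - H" "root_list a"]
  by (auto simp: fibre_def poly_W_eq[of _ a])

lemma finite_fibre: "finite (fibre a)" by (simp add: fibre_eq)

text \<open>\<open>dicritical F q P\<close>: along the arcs \<open>y = F + t u\<^sup>q\<close> the polynomial has the finite limit \<open>P t\<close>,
  which is not constant in \<open>t\<close>.\<close>

definition dicritical :: "complex fps \<Rightarrow> nat \<Rightarrow> complex poly \<Rightarrow> bool" where
  "dicritical F q P \<longleftrightarrow> 0 < degree P \<and>
    (\<forall>\<delta>. (\<forall>n<N * d. fps_nth (poly W (F + \<delta> * fps_X ^ q)) n = 0) \<and>
      fps_nth (poly W (F + \<delta> * fps_X ^ q)) (N * d) = poly P (fps_nth \<delta> 0))"

lemma dicriticalD: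
  assumes "dicritical F q P"
  shows "0 < degree P" "n < N * d \<Longrightarrow> fps_nth (poly W (F + \<delta> * fps_X ^ q)) n = 0"
    "fps_nth (poly W (F + \<delta> * fps_X ^ q)) (N * d) = poly P (fps_nth \<delta> 0)"
  using assms by (auto simp: dicritical_def)

text \<open>Relative to any reference value a, the order of f - a along an arc becomes a sum of
  contact orders with the series over a, and its leading coefficient a product of linear or constant
  factors in t.\<close>

lemma expand_W:
  "\<exists>S. poly W (F + \<delta> * fps_X ^ q) = fps_const a * fps_X ^ (N * d) +
      fps_X ^ (\<Sum>H\<leftarrow>root_list a. exponent_at q (F - H)) * S \<and>
    fps_nth S 0 = lc * poly (\<Prod>H\<leftarrow>root_list a. leading_at q (F - H)) (fps_nth \<delta> 0)"
proof -
  obtain S where S: "(\<Prod>R\<leftarrow>map (\<lambda>H. F - H) (root_list a). R + \<delta> * fps_X ^ q) =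
      fps_X ^ (\<Sum>R\<leftarrow>map (\<lambda>H. F - H) (root_list a). exponent_at q R) * S"
    "fps_nth S 0 = poly (\<Prod>R\<leftarrow>map (\<lambda>H. F - H) (root_list a). leading_at q R) (fps_nth \<delta> 0)"
    using expand_product by blast
  have "(\<Prod>H\<leftarrow>root_list a. F + \<delta> * fps_X ^ q - H) = (\<Prod>R\<leftarrow>map (\<lambda>H. F - H) (root_list a). R + \<delta> * fps_X ^ q)"
    by (simp add: o_def algebra_simps)
  then show ?thesis
    using S by (intro exI[of _ "fps_const lc * S"]) (simp add: poly_W_eq[of _ a] o_def mult_ac)
qed

text \<open>The hypothesis is that f stays bounded along F. Compare F with the series over a value c
  that is not its limit, and let q be the largest contact order. Then t = 0 is no zero of the
  leading polynomial L, and yet L is not constant, because a series of maximal contact contributes a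
  linear factor. The limit is c + L(t).\<close>

lemma dicritical_exists:
  assumes fin: "\<And>n. n < N * d \<Longrightarrow> fps_nth (poly W F) n = 0"
  shows "\<exists>q P. dicritical F q P"
proof -
  define c where "c = fps_nth (poly W F) (N * d) + 1"
  have c_ne: "fps_nth (poly W F) (N * d) \<noteq> c" by (simp add: c_def)
  let ?Rs = "map (\<lambda>H. F - H) (root_list c)"
  have nz: "fps_const lc * (\<Prod>H\<leftarrow>root_list c. F - H) \<noteq> 0"
  proof
    assume "fps_const lc * (\<Prod>H\<leftarrow>root_list c. F - H) = 0"
    then have "poly W F = fps_const c * fps_X ^ (N * d)" by (simp add: poly_W_eq[of _ c])
    then have "fps_nth (poly W F) (N * d) = c" by simp
    then show False using c_ne by simp
  qed
  then have R0: "F - H \<noteq> 0" if "H \<in> set (root_list c)" for H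
    using that by (auto simp: prod_list_nonzero_iff)
  define q where "q = Max ((\<lambda>H. subdegree (F - H)) ` set (root_list c))"
  have ne: "root_list c \<noteq> []" using root_list(1)[of c] d_pos by auto
  have le: "subdegree (F - H) \<le> q" if "H \<in> set (root_list c)" for H
    unfolding q_def using that by (intro Max_ge) auto
  have "q \<in> (\<lambda>H. subdegree (F - H)) ` set (root_list c)"
    unfolding q_def using ne by (intro Max_in) auto
  then obtain H0 where H0: "H0 \<in> set (root_list c)" "subdegree (F - H0) = q" by (metis imageE)
  have agree: "agree_upto q (F - H) 0 \<longleftrightarrow> subdegree (F - H) = q" if H: "H \<in> set (root_list c)" for H
  proof
    assume *: "agree_upto q (F - H) 0"
    have "\<not> subdegree (F - H) < q"
      using * nth_subdegree_nonzero[OF R0[OF H]] by (auto simp: agree_upto_def)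
    then show "subdegree (F - H) = q" using le[OF H] by simp
  next
    assume *: "subdegree (F - H) = q"
    show "agree_upto q (F - H) 0"
      unfolding agree_upto_def *[symmetric] using nth_less_subdegree_zero[of _ "F - H"] by (metis fps_zero_nth)
  qed
  define L where "L = smult lc (\<Prod>H\<leftarrow>root_list c. leading_at q (F - H))"
  have "poly (leading_at q (F - H)) 0 \<noteq> 0" if H: "H \<in> set (root_list c)" for H
    using agree[OF H] nth_subdegree_nonzero[OF R0[OF H]] by (auto simp: leading_at_def)
  then have L0: "poly L 0 \<noteq> 0"
    using lc_nonzero by (simp add: L_def poly_prod_list_map prod_list_nonzero_iff)
  define e where "e = (\<Sum>H\<leftarrow>root_list c. exponent_at q (F - H))"
  have exp: "\<exists>S. poly W (F + \<delta> * fps_X ^ q) = fps_const c * fps_X ^ (N * d) + fps_X ^ e * S \<and>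
      fps_nth S 0 = poly L (fps_nth \<delta> 0)" for \<delta>
    using expand_W[of F \<delta> q c] by (simp add: L_def e_def)
  \<comment> \<open>At t = 0 the difference from c has order exactly \<open>e\<close>. An order
    below \<open>N * d\<close> contradicts boundedness, an order above it the choice of c.\<close>
  have e: "e = N * d"
  proof -
    obtain S where S: "poly W F = fps_const c * fps_X ^ (N * d) + fps_X ^ e * S" "fps_nth S 0 = poly L 0"
      using exp[of 0] by auto
    have "e < N * d \<Longrightarrow> fps_nth (poly W F) e = poly L 0" using S by (simp add: fps_X_power_mult_nth)
    then have "\<not> e < N * d" using fin[of e] L0 by auto
    moreover have "N * d < e \<Longrightarrow> fps_nth (poly W F) (N * d) = c" using S by (simp add: fps_X_power_mult_nth)
    then have "\<not> N * d < e" using c_ne by blast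
    ultimately show ?thesis by simp
  qed
  have degL: "0 < degree L"
  proof -
    have "degree L = (\<Sum>H\<leftarrow>root_list c. degree (leading_at q (F - H)))"
      using lc_nonzero by (simp add: L_def degree_prod_list_map leading_at_nonzero)
    moreover have "degree (leading_at q (F - H0)) \<le> (\<Sum>H\<leftarrow>root_list c. degree (leading_at q (F - H)))"
      using H0(1) by (intro member_le_sum_list) auto
    ultimately show ?thesis using agree[OF H0(1)] H0(2) by (simp add: degree_leading_at)
  qed
  have "(\<forall>n<N * d. fps_nth (poly W (F + \<delta> * fps_X ^ q)) n = 0) \<and>
      fps_nth (poly W (F + \<delta> * fps_X ^ q)) (N * d) = poly ([:c:] + L) (fps_nth \<delta> 0)" for \<delta>
  proof -
    obtain S where S: "poly W (F + \<delta> * fps_X ^ q) = fps_const c * fps_X ^ (N * d) + fps_X ^ e * S"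
      "fps_nth S 0 = poly L (fps_nth \<delta> 0)" using exp by blast
    then show ?thesis by (simp add: e fps_X_power_mult_nth)
  qed
  moreover have "0 < degree ([:c:] + L)" using degL by (simp add: degree_add_eq_right)
  ultimately have "dicritical F q ([:c:] + L)" unfolding dicritical_def by blast
  then show ?thesis by blast
qed

text \<open>Again the exponent must be \<open>N * d\<close>, but for arbitrary a both sides may
  vanish at t = 0; a t at which neither vanishes is used instead.\<close>

lemma dicritical_factor:
  assumes dic: "dicritical F q P"
  shows "P - [:a:] = smult lc (\<Prod>H\<leftarrow>root_list a. leading_at q (F - H))"
proof -
  define L where "L = smult lc (\<Prod>H\<leftarrow>root_list a. leading_at q (F - H))"
  have "L \<noteq> 0" using lc_nonzero by (auto simp: L_def prod_list_nonzero_iff leading_at_nonzero)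
  have "P - [:a:] \<noteq> 0" using dicriticalD(1)[OF dic] by (auto simp: degree_pCons_0)
  define e where "e = (\<Sum>H\<leftarrow>root_list a. exponent_at q (F - H))"
  have exp: "\<exists>S. poly W (F + fps_const t * fps_X ^ q) = fps_const a * fps_X ^ (N * d) + fps_X ^ e * S \<and>
      fps_nth S 0 = poly L t" for t
    using expand_W[of F "fps_const t" q a] by (simp add: L_def e_def)
  have "finite ({t. poly L t = 0} \<union> {t. poly (P - [:a:]) t = 0})"
    using poly_roots_finite[OF \<open>L \<noteq> 0\<close>] poly_roots_finite[OF \<open>P - [:a:] \<noteq> 0\<close>] by simp
  then obtain t where t: "poly L t \<noteq> 0" "poly (P - [:a:]) t \<noteq> 0"
    using infinite_UNIV_char_0[where 'a = complex] ex_new_if_finite by blast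
  have e: "e = N * d"
  proof -
    obtain S where S: "poly W (F + fps_const t * fps_X ^ q) = fps_const a * fps_X ^ (N * d) + fps_X ^ e * S"
      "fps_nth S 0 = poly L t" using exp by blast
    have "e < N * d \<Longrightarrow> fps_nth (poly W (F + fps_const t * fps_X ^ q)) e = poly L t"
      using S by (simp add: fps_X_power_mult_nth)
    then have "\<not> e < N * d" using dicriticalD(2)[OF dic, of e "fps_const t"] t(1) by auto
    moreover have "N * d < e \<Longrightarrow> fps_nth (poly W (F + fps_const t * fps_X ^ q)) (N * d) = a"
      using S by (simp add: fps_X_power_mult_nth)
    then have "\<not> N * d < e" using dicriticalD(3)[OF dic, of "fps_const t"] t(2) by auto
    ultimately show ?thesis by simp
  qed
  have "poly (P - [:a:]) t = poly L t" for t
  proof -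
    obtain S where S: "poly W (F + fps_const t * fps_X ^ q) = fps_const a * fps_X ^ (N * d) + fps_X ^ e * S"
      "fps_nth S 0 = poly L t" using exp by blast
    then have "a + poly L t = poly P t"
      using dicriticalD(3)[OF dic, of "fps_const t"] by (simp add: e fps_X_power_mult_nth)
    then show ?thesis by (simp add: algebra_simps)
  qed
  then show ?thesis unfolding L_def by (simp add: poly_eq_poly_eq_iff[symmetric] fun_eq_iff)
qed

text \<open>A series that agrees with F below q contributes a linear factor to P - a, any other a
  nonzero constant. Hence \<open>degree P\<close> series of every fibre, with multiplicity, pass
  through the dicritical.\<close>

lemma dicritical_roots:
  assumes dic: "dicritical F q P"
  shows "{t. poly P t = a} = (\<lambda>H. fps_nth H q - fps_nth F q) ` {H \<in> fibre a. agree_upto q H F}"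
    and "degree P = length (filter (\<lambda>H. agree_upto q H F) (root_list a))"
proof -
  have ag: "agree_upto q (F - H) 0 \<longleftrightarrow> agree_upto q H F" for H by (auto simp: agree_upto_def)
  have lead: "poly (leading_at q (F - H)) t = 0 \<longleftrightarrow> agree_upto q H F \<and> t = fps_nth H q - fps_nth F q" for H t
    using not_agree_zeroD(3)[of q "F - H"] by (auto simp: leading_at_def ag algebra_simps eq_neg_iff_add_eq_0)
  have "poly P t = a \<longleftrightarrow> (\<exists>H\<in>fibre a. agree_upto q H F \<and> t = fps_nth H q - fps_nth F q)" for t
  proof -
    have "poly P t = a \<longleftrightarrow> poly (P - [:a:]) t = 0" by simp
    also have "\<dots> \<longleftrightarrow> (\<exists>H\<in>set (root_list a). poly (leading_at q (F - H)) t = 0)"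
      unfolding dicritical_factor[OF dic] using lc_nonzero by (simp add: poly_prod_list_map prod_list_nonzero_iff)
    finally show ?thesis by (simp only: lead fibre_eq)
  qed
  then show "{t. poly P t = a} = (\<lambda>H. fps_nth H q - fps_nth F q) ` {H \<in> fibre a. agree_upto q H F}"
    by blast
  have "degree P = degree (P - [:a:])"
  proof -
    have "P - [:a:] = P + [:- a:]" by simp
    moreover have "degree (P + [:- a:]) = degree P"
      using dicriticalD(1)[OF dic] by (intro degree_add_eq_left) simp
    ultimately show ?thesis by metis
  qed
  also have "\<dots> = (\<Sum>H\<leftarrow>root_list a. degree (leading_at q (F - H)))"
    unfolding dicritical_factor[OF dic] using lc_nonzero
    by (simp add: degree_prod_list_map leading_at_nonzero)
  also have "\<dots> = length (filter (\<lambda>H. agree_upto q H F) xs)" if "xs = root_list a" for xs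
    unfolding that[symmetric] by (induction xs) (auto simp: degree_leading_at ag)
  finally show "degree P = length (filter (\<lambda>H. agree_upto q H F) (root_list a))" by simp
qed

lemma dicritical_unique_poly:
  assumes "dicritical F q P" "dicritical F q P'"
  shows "P = P'"
proof -
  have "poly P t = poly P' t" for t
    using dicriticalD(3)[OF assms(1), of "fps_const t"] dicriticalD(3)[OF assms(2), of "fps_const t"] by simp
  then show ?thesis by (simp add: poly_eq_poly_eq_iff[symmetric] fun_eq_iff)
qed

lemma dicritical_shift:
  assumes "dicritical F q P"
  shows "dicritical (F + \<delta> * fps_X ^ q) q (pcompose P [:fps_nth \<delta> 0, 1:])"
proof -
  have eq: "F + \<delta> * fps_X ^ q + \<delta>' * fps_X ^ q = F + (\<delta> + \<delta>') * fps_X ^ q" for \<delta>'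
    by (simp add: algebra_simps)
  show ?thesis
    using dicriticalD[OF assms] unfolding dicritical_def eq
    by (simp add: poly_pcompose degree_pcompose)
qed

text \<open>For a larger exponent q', the term t u^q' is a perturbation
  \<open>\<delta> * fps_X ^ q\<close> in which \<open>\<delta>\<close> has no constant term, so the
  limit could not depend on t.\<close>

lemma dicritical_le:
  assumes "dicritical F q P" "dicritical F q' P'"
  shows "q' \<le> q"
proof (rule ccontr)
  assume "\<not> q' \<le> q"
  then have X: "fps_X ^ q' = fps_X ^ (q' - q) * (fps_X ^ q :: complex fps)" by (simp flip: power_add)
  have "poly P' t = poly P 0" for t
  proof -
    have "poly P' t = fps_nth (poly W (F + fps_const t * fps_X ^ q')) (N * d)"
      using dicriticalD(3)[OF assms(2), of "fps_const t"] by simp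
    also have "\<dots> = fps_nth (poly W (F + (fps_const t * fps_X ^ (q' - q)) * fps_X ^ q)) (N * d)"
      by (simp only: X mult.assoc)
    also have "\<dots> = poly P 0"
      using dicriticalD(3)[OF assms(1), of "fps_const t * fps_X ^ (q' - q)"] \<open>\<not> q' \<le> q\<close> by simp
    finally show ?thesis .
  qed
  then have "P' = [:poly P 0:]" by (simp add: poly_eq_poly_eq_iff[symmetric] fun_eq_iff)
  then show False using dicriticalD(1)[OF assms(2)] by (metis degree_pCons_0 less_irrefl)
qed

lemma dicritical_unique: "dicritical F q P \<Longrightarrow> dicritical F q' P' \<Longrightarrow> q' = q"
  using dicritical_le by (meson antisym)

text \<open>For q = 0 every constant series is of the form F + \<open>\<delta>\<close>. But
  \<open>W\<close> does not vanish at u = 0 along a generic constant, since its leading coefficient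
  in y is the nonzero constant \<open>lc\<close>.\<close>

lemma dicritical_pos:
  assumes "dicritical F q P"
  shows "0 < q"
proof (rule ccontr)
  assume "\<not> 0 < q"
  have "finite ((\<lambda>H. fps_nth H 0) ` set (root_list 0))" by simp
  then obtain t where t: "t \<notin> (\<lambda>H. fps_nth H 0) ` set (root_list 0)"
    using infinite_UNIV_char_0[where 'a = complex] ex_new_if_finite by blast
  have "poly W (fps_const t) = fps_const lc * (\<Prod>H\<leftarrow>root_list 0. fps_const t - H)"
    using poly_W_eq[of "fps_const t" 0] by simp
  moreover have "fps_nth (poly W (F + (fps_const t - F) * fps_X ^ q)) 0 = 0"
    using dicriticalD(2)[OF assms] N_pos d_pos by simp
  ultimately have "fps_nth (fps_const lc * (\<Prod>H\<leftarrow>root_list 0. fps_const t - H)) 0 = 0"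
    using \<open>\<not> 0 < q\<close> by simp
  moreover have "fps_nth (\<Prod>H\<leftarrow>Hs. fps_const t - H) 0 = (\<Prod>H\<leftarrow>Hs. t - fps_nth H 0)" for Hs
    by (induction Hs) auto
  ultimately show False using t lc_nonzero by (auto simp: prod_list_nonzero_iff)
qed

text \<open>Substituting z u for u turns t u^q into z^q t u^q, which accounts for the rescaling of
  t, and leaves \<open>W\<close> unchanged.\<close>

lemma dicritical_act:
  assumes dic: "dicritical F q P" and z: "z ^ N = 1"
  shows "dicritical (fps_act z F) q (pcompose P [:0, inverse (z ^ q):])"
proof -
  have z0: "z \<noteq> 0" using z N_pos by (auto simp: power_0_left)
  have "poly W (fps_act z F + \<delta> * fps_X ^ q) =
    fps_act z (poly W (F + (fps_const (inverse (z ^ q)) * fps_act (inverse z) \<delta>) * fps_X ^ q))" for \<delta>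
  proof -
    have "fps_act z (F + (fps_const (inverse (z ^ q)) * fps_act (inverse z) \<delta>) * fps_X ^ q) =
        fps_act z F + (fps_const (inverse (z ^ q)) * fps_const (z ^ q)) * \<delta> * fps_X ^ q"
      using z0 by (simp only: fps_act_add fps_act_mult fps_act_const fps_act_X_power fps_act_act) (simp add: mult_ac)
    also have "fps_const (inverse (z ^ q)) * fps_const (z ^ q) = 1"
      using z0 by (simp flip: fps_const_mult del: fps_const_inverse)
    finally show ?thesis by (simp add: fps_act_poly W_invariant[OF z])
  qed
  moreover have "z ^ (N * d) = 1" using z by (simp add: power_mult)
  ultimately show ?thesis
    using dicriticalD[OF dic] z0 unfolding dicritical_def
    by (simp add: poly_pcompose degree_pcompose) (simp add: mult.commute)
qed

lemma fps_act_fibre: "H \<in> fibre a \<Longrightarrow> z ^ N = 1 \<Longrightarrow> fps_act z H \<in> fibre a"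
proof -
  assume H: "H \<in> fibre a" and z: "z ^ N = 1"
  have zd: "z ^ (N * d) = 1" using z by (simp add: power_mult)
  have "poly W (fps_act z H) = fps_act z (poly W H)" by (simp add: fps_act_poly W_invariant[OF z])
  also have "\<dots> = fps_const a * fps_X ^ (N * d)"
    using H by (simp add: fibre_def fps_act_mult fps_act_X_power zd)
  finally show ?thesis by (simp add: fibre_def)
qed

section \<open>Truncated dicriticals and the series that pass through them\<close>

lemma fibre_order:
  assumes "H \<in> fibre a"
  shows "n < N * d \<Longrightarrow> fps_nth (poly W H) n = 0" "fps_nth (poly W H) (N * d) = a"
  using assms by (auto simp: fibre_def)

text \<open>The terms of F from q on only translate t; cutting them off leaves one pair for each
  family of arcs.\<close>

definition dicriticals :: "(complex fps \<times> nat) set" where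
  "dicriticals = {(F, q). fps_cutoff q F = F \<and> (\<exists>P. dicritical F q P)}"

definition limit_poly :: "complex fps \<times> nat \<Rightarrow> complex poly" where
  "limit_poly D = (THE P. dicritical (fst D) (snd D) P)"

lemma limit_poly: "D \<in> dicriticals \<Longrightarrow> dicritical (fst D) (snd D) (limit_poly D)"
  unfolding limit_poly_def dicriticals_def by (rule theI') (auto intro: dicritical_unique_poly)

lemma limit_poly_eq: "dicritical F q P \<Longrightarrow> limit_poly (F, q) = P"
  unfolding limit_poly_def by (auto intro: the_equality dicritical_unique_poly)

definition lies_on :: "complex fps \<Rightarrow> complex fps \<times> nat \<Rightarrow> bool" where
  "lies_on F D \<longleftrightarrow> agree_upto (snd D) F (fst D)"

lemma lies_on_dicritical:
  assumes "D \<in> dicriticals" "lies_on F D"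
  shows "dicritical F (snd D) (pcompose (limit_poly D) [:fps_nth F (snd D), 1:])"
proof -
  have eq: "F = fst D + fps_shift (snd D) (F - fst D) * fps_X ^ snd D"
    using assms(2) unfolding lies_on_def by (rule agree_upto_imp_eq_add)
  have "fps_cutoff (snd D) (fst D) = fst D" using assms(1) by (auto simp: dicriticals_def)
  then have "fps_nth (fst D) (snd D) = 0" by (metis fps_cutoff_nth less_irrefl)
  then show ?thesis
    using dicritical_shift[OF limit_poly[OF assms(1)], of "fps_shift (snd D) (F - fst D)"]
    by (subst (1) eq) simp
qed

text \<open>Both pairs make F itself dicritical, so their exponents agree, and then both are the
  same truncation of F.\<close>

lemma lies_on_unique:
  assumes "D \<in> dicriticals" "D' \<in> dicriticals" "lies_on F D" "lies_on F D'"
  shows "D = D'"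
proof -
  have "snd D' = snd D"
    using dicritical_unique[OF lies_on_dicritical[OF assms(1,3)] lies_on_dicritical[OF assms(2,4)]] .
  moreover have "fst D = fps_cutoff (snd D) F" "fst D' = fps_cutoff (snd D') F"
    using assms unfolding lies_on_def dicriticals_def agree_upto_iff_cutoff by force+
  ultimately show ?thesis by (metis prod_eq_iff)
qed

lemma lies_on_exists:
  assumes "\<And>n. n < N * d \<Longrightarrow> fps_nth (poly W F) n = 0"
  shows "\<exists>D\<in>dicriticals. lies_on F D"
proof -
  obtain q P where qP: "dicritical F q P" using dicritical_exists[OF assms] by blast
  have ag: "agree_upto q (fps_cutoff q F) F" by (simp add: agree_upto_def)
  have "\<exists>P. dicritical (fps_cutoff q F) q P"
    by (subst agree_upto_imp_eq_add[OF ag]) (rule exI, rule dicritical_shift[OF qP])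
  moreover have "fps_cutoff q (fps_cutoff q F) = fps_cutoff q F" by (simp add: fps_eq_iff)
  ultimately show ?thesis
    by (intro bexI[of _ "(fps_cutoff q F, q)"]) (simp_all add: dicriticals_def lies_on_def agree_upto_def)
qed

lemma fibre_lies_on: "H \<in> fibre a \<Longrightarrow> \<exists>D\<in>dicriticals. lies_on H D"
  using lies_on_exists fibre_order by blast

lemma limit_poly_roots:
  assumes "D \<in> dicriticals"
  shows "{t. poly (limit_poly D) t = a} = (\<lambda>H. fps_nth H (snd D)) ` {H \<in> fibre a. lies_on H D}"
    and "degree (limit_poly D) = length (filter (\<lambda>H. lies_on H D) (root_list a))"
proof -
  have "fps_cutoff (snd D) (fst D) = fst D" using assms by (auto simp: dicriticals_def)
  then have "fps_nth (fst D) (snd D) = 0" by (metis fps_cutoff_nth less_irrefl)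
  then show "{t. poly (limit_poly D) t = a} = (\<lambda>H. fps_nth H (snd D)) ` {H \<in> fibre a. lies_on H D}"
    "degree (limit_poly D) = length (filter (\<lambda>H. lies_on H D) (root_list a))"
    using dicritical_roots[OF limit_poly[OF assms]] by (simp_all add: lies_on_def)
qed

lemma lies_on_fibre_exists:
  assumes "D \<in> dicriticals" "poly (limit_poly D) t = a"
  shows "\<exists>H\<in>fibre a. lies_on H D \<and> fps_nth H (snd D) = t"
proof -
  have "t \<in> {t. poly (limit_poly D) t = a}" using assms(2) by simp
  then show ?thesis unfolding limit_poly_roots(1)[OF assms(1)] by auto
qed

text \<open>A nonconstant limit polynomial takes the value 0, so every dicritical is met by one of
  the finitely many series over 0, and each of these meets only one.\<close>

lemma finite_dicriticals: "finite dicriticals"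
proof -
  have "dicriticals \<subseteq> (\<Union>H\<in>fibre 0. {D \<in> dicriticals. lies_on H D})"
  proof
    fix D assume D: "D \<in> dicriticals"
    obtain t where "poly (limit_poly D) t = 0"
      using alg_closed_imp_poly_has_root[of "limit_poly D"] dicriticalD(1)[OF limit_poly[OF D]] by blast
    then show "D \<in> (\<Union>H\<in>fibre 0. {D \<in> dicriticals. lies_on H D})"
      using lies_on_fibre_exists[OF D] D by blast
  qed
  moreover have "finite {D \<in> dicriticals. lies_on H D}" for H
  proof (cases "\<exists>D\<in>dicriticals. lies_on H D")
    case True
    then obtain D where "D \<in> dicriticals" "lies_on H D" by blast
    then have "{D \<in> dicriticals. lies_on H D} \<subseteq> {D}" using lies_on_unique by blast
    then show ?thesis by (rule finite_subset) simp
  next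
    case False
    then have "{D \<in> dicriticals. lies_on H D} = {}" by blast
    then show ?thesis by (simp only: finite.emptyI)
  qed
  ultimately show ?thesis using finite_fibre by (meson finite_UN_I finite_subset)
qed

section \<open>Roots of unity acting on dicriticals\<close>

definition act :: "complex \<Rightarrow> complex fps \<times> nat \<Rightarrow> complex fps \<times> nat" where
  "act z D = (fps_act z (fst D), snd D)"

lemma act_dicriticals:
  assumes "D \<in> dicriticals" "z ^ N = 1"
  shows "act z D \<in> dicriticals" "limit_poly (act z D) = pcompose (limit_poly D) [:0, inverse (z ^ snd D):]"
proof -
  note dic = dicritical_act[OF limit_poly[OF assms(1)] assms(2)]
  have "fps_cutoff (snd D) (fps_act z (fst D)) = fps_act z (fst D)"
    using assms(1) by (auto simp: dicriticals_def simp flip: fps_act_cutoff)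
  then show "act z D \<in> dicriticals" using dic by (auto simp: dicriticals_def act_def)
  show "limit_poly (act z D) = pcompose (limit_poly D) [:0, inverse (z ^ snd D):]"
    unfolding act_def by (rule limit_poly_eq[OF dic])
qed

lemma root_of_unity_nonzero:
  fixes z :: complex
  assumes "z ^ N = 1"
  shows "z \<noteq> 0"
proof
  assume "z = 0"
  then have "z ^ N = 0" using N_pos by simp
  with assms show False by simp
qed

lemma act_act [simp]: "act z (act w D) = act (z * w) D" and act_1 [simp]: "act 1 D = D"
  and snd_act [simp]: "snd (act z D) = snd D"
  by (simp_all add: act_def fps_act_act)

lemma lies_on_act: "lies_on F D \<Longrightarrow> lies_on (fps_act z F) (act z D)"
  by (simp add: lies_on_def act_def agree_upto_def)

text \<open>The rotations of \<open>t\<close> in \<open>y = F + t u\<^sup>q\<close> that come from substitutions \<open>u \<mapsto> z u\<close> fixing \<open>F\<close>.\<close>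

definition rotations :: "complex fps \<times> nat \<Rightarrow> complex set" where
  "rotations D = (\<lambda>z. z ^ snd D) ` {z. z ^ N = 1 \<and> act z D = D}"

definition ramification :: "complex fps \<times> nat \<Rightarrow> nat" where
  "ramification D = card (rotations D)"

text \<open>The rotations form a finite group, of order m say. Multiplication by an element w
  permutes it, and comparing the products of all elements gives w^m = 1; as this equation has just m
  solutions, all of them occur.\<close>

lemma rotations_eq: "rotations D = {w. w ^ ramification D = 1}" and ramification_pos: "0 < ramification D"
proof -
  have fin: "finite (rotations D)"
    unfolding rotations_def using finite_roots_unity[of N] N_pos
    by (auto intro!: finite_imageI intro: finite_subset[of _ "{z. z ^ N = 1}"])
  have one: "1 \<in> rotations D" unfolding rotations_def by (rule image_eqI[of _ _ 1]) auto
  show pos: "0 < ramification D" using fin one by (auto simp: ramification_def card_gt_0_iff)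
  have closed: "w * w' \<in> rotations D" if w: "w \<in> rotations D" "w' \<in> rotations D" for w w'
  proof -
    obtain z z' where z: "z ^ N = 1" "act z D = D" "w = z ^ snd D" "z' ^ N = 1" "act z' D = D" "w' = z' ^ snd D"
      using w unfolding rotations_def by blast
    then have "act (z * z') D = D" by (metis act_act)
    then show ?thesis unfolding rotations_def
      using z by (intro image_eqI[of _ _ "z * z'"]) (auto simp: power_mult_distrib)
  qed
  have nz: "w \<noteq> 0" if w: "w \<in> rotations D" for w
  proof -
    obtain z where "z ^ N = 1" "w = z ^ snd D" using w unfolding rotations_def by blast
    then show ?thesis using root_of_unity_nonzero by (metis power_eq_0_iff)
  qed
  have "w ^ ramification D = 1" if w: "w \<in> rotations D" for w
  proof -
    have inj: "inj_on ((*) w) (rotations D)" using nz[OF w] by (auto intro: inj_onI)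
    have "(*) w ` rotations D = rotations D"
      using closed[OF w] fin inj by (intro endo_inj_surj) auto
    then have "(\<Prod>x\<in>rotations D. x) = (\<Prod>x\<in>rotations D. w * x)"
      using prod.reindex[OF inj, of "\<lambda>x. x"] by (simp add: o_def)
    also have "\<dots> = w ^ ramification D * (\<Prod>x\<in>rotations D. x)" by (simp add: prod.distrib ramification_def)
    finally show ?thesis using nz fin by (auto simp: prod_zero_iff)
  qed
  then show "rotations D = {w. w ^ ramification D = 1}"
    using pos card_roots_unity_eq[of "ramification D"]
    by (intro card_seteq finite_roots_unity) (auto simp: ramification_def)
qed

lemma limit_poly_rotate:
  assumes "D \<in> dicriticals" "w ^ ramification D = 1"
  shows "poly (limit_poly D) (w * t) = poly (limit_poly D) t"
proof -
  obtain z where z: "z ^ N = 1" "act z D = D" "w = z ^ snd D"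
    using assms(2) rotations_eq[of D] unfolding rotations_def by blast
  have "limit_poly D = pcompose (limit_poly D) [:0, inverse w:]"
    using act_dicriticals(2)[OF assms(1) z(1)] z by simp
  then have "poly (limit_poly D) (w * t) = poly (limit_poly D) (inverse w * (w * t))"
    by (metis (no_types, lifting) poly_pcompose mult.commute poly_pCons add_0 mult_zero_right poly_0 add.right_neutral)
  moreover have "inverse w * (w * t) = t" using root_of_unity_nonzero[OF z(1)] z(3) by simp
  ultimately show ?thesis by simp
qed

end

text \<open>Comparing the coefficients of P(w t) and P(t) for a primitive m-th root of unity w kills
  every exponent that m does not divide.\<close>

lemma pcompose_monom_of_invariant:
  fixes P :: "complex poly"
  assumes m: "0 < m" and inv: "\<And>w t. w ^ m = 1 \<Longrightarrow> poly P (w * t) = poly P t"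
  shows "\<exists>R. P = pcompose R (monom 1 m)"
proof -
  define w where "w = exp (2 * of_real pi * \<i> / of_nat m)"
  have w: "w ^ m = 1" using m by (simp add: w_def flip: exp_of_nat_mult)
  have wk: "w ^ k = 1 \<longleftrightarrow> m dvd k" for k
    using complex_root_unity_eq_1[of m k] m by (simp add: w_def mult_ac flip: exp_of_nat_mult)
  have "pcompose P [:0, w:] = P"
    by (simp add: poly_eq_poly_eq_iff[symmetric] fun_eq_iff poly_pcompose inv[OF w] mult.commute[of _ w])
  moreover have "coeff (pcompose P [:0, w:]) k = w ^ k * coeff P k" for k
    by (rule coeff_pcompose_linear)
  ultimately have co: "coeff P k = 0" if "\<not> m dvd k" for k
    using wk[of k] that by (metis mult_cancel_right1)
  \<comment> \<open>The upper limit \<open>degree P\<close> is generous: for large j the coefficient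
    of index \<open>m * j\<close> is zero.\<close>
  define R where "R = (\<Sum>j\<le>degree P. monom (coeff P (m * j)) j)"
  have "poly P t = poly R (t ^ m)" for t
  proof -
    have "poly R (t ^ m) = (\<Sum>j\<le>degree P. coeff P (m * j) * t ^ (m * j))"
      by (simp add: R_def poly_sum poly_monom power_mult)
    also have "\<dots> = (\<Sum>i\<in>(*) m ` {..degree P}. coeff P i * t ^ i)"
      using m by (subst sum.reindex) (auto intro: inj_onI)
    also have "\<dots> = (\<Sum>i\<le>m * degree P. coeff P i * t ^ i)"
    proof (rule sum.mono_neutral_left)
      show "\<forall>i\<in>{..m * degree P} - (*) m ` {..degree P}. coeff P i * t ^ i = 0"
      proof
        fix i assume i: "i \<in> {..m * degree P} - (*) m ` {..degree P}"
        have "\<not> m dvd i"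
        proof
          assume "m dvd i"
          then obtain k where "i = m * k" by (rule dvdE)
          then show False using i m by auto
        qed
        then show "coeff P i * t ^ i = 0" by (simp add: co)
      qed
    qed auto
    also have "\<dots> = (\<Sum>i\<le>degree P. coeff P i * t ^ i)"
      using m by (intro sum.mono_neutral_right) (auto simp: coeff_eq_0)
    finally show ?thesis by (simp add: poly_altdef)
  qed
  then show ?thesis
    by (intro exI[of _ R]) (simp add: poly_eq_poly_eq_iff[symmetric] fun_eq_iff poly_pcompose poly_monom)
qed

section \<open>Counting orbits of series by means of dicriticals\<close>

context fibre_series begin

definition orbit :: "complex fps \<Rightarrow> complex fps set" where
  "orbit H = (\<lambda>z. fps_act z H) ` {z. z ^ N = 1}"

lemma orbit_eq_iff: "orbit H = orbit H' \<longleftrightarrow> (\<exists>z. z ^ N = 1 \<and> H' = fps_act z H)"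
proof
  assume eq: "orbit H = orbit H'"
  have "H' \<in> orbit H'" unfolding orbit_def by (rule image_eqI[of _ _ 1]) auto
  then show "\<exists>z. z ^ N = 1 \<and> H' = fps_act z H" unfolding eq[symmetric] by (auto simp: orbit_def)
next
  assume "\<exists>z. z ^ N = 1 \<and> H' = fps_act z H"
  then obtain z where z: "z ^ N = 1" "H' = fps_act z H" by blast
  have nz: "z \<noteq> 0" using z(1) by (rule root_of_unity_nonzero)
  show "orbit H = orbit H'"
  proof
    show "orbit H' \<subseteq> orbit H"
      using z by (auto simp: orbit_def fps_act_act power_mult_distrib intro!: image_eqI[of _ _ "_ * z"])
    show "orbit H \<subseteq> orbit H'"
    proof
      fix F assume "F \<in> orbit H"
      then obtain w where w: "w ^ N = 1" "F = fps_act w H" by (auto simp: orbit_def)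
      then have "F = fps_act (w / z) H'" "(w / z) ^ N = 1" using z nz by (simp_all add: fps_act_act power_divide)
      then show "F \<in> orbit H'" by (auto simp: orbit_def)
    qed
  qed
qed

definition orbit_count :: "complex \<Rightarrow> nat" where
  "orbit_count a = card (orbit ` fibre a)"

text \<open>The choice depends on the orbit only as a set, so conjugate dicriticals receive the same
  representative.\<close>

definition base_dicriticals :: "(complex fps \<times> nat) set" where
  "base_dicriticals = (\<lambda>D. SOME D'. D' \<in> (\<lambda>z. act z D) ` {z. z ^ N = 1}) ` dicriticals"

lemma act_orbit_eq:
  assumes "z ^ N = 1"
  shows "(\<lambda>w. act w (act z D)) ` {w. w ^ N = 1} = (\<lambda>w. act w D) ` {w. w ^ N = 1}"
proof -
  have nz: "z \<noteq> 0" using assms by (rule root_of_unity_nonzero)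
  show ?thesis
  proof (intro subset_antisym image_subsetI)
    fix w :: complex assume w: "w \<in> {w. w ^ N = 1}"
    show "act w (act z D) \<in> (\<lambda>w. act w D) ` {w. w ^ N = 1}"
      using w assms by (intro image_eqI[of _ _ "w * z"]) (auto simp: power_mult_distrib)
    show "act w D \<in> (\<lambda>w. act w (act z D)) ` {w. w ^ N = 1}"
      using w assms nz by (intro image_eqI[of _ _ "w / z"]) (auto simp: power_divide)
  qed
qed

lemma base_dicriticals_exists:
  assumes "D \<in> dicriticals"
  shows "\<exists>z. z ^ N = 1 \<and> act z D \<in> base_dicriticals"
proof -
  have "act 1 D \<in> (\<lambda>z. act z D) ` {z. z ^ N = 1}" by (intro imageI) simp
  then have "(SOME D'. D' \<in> (\<lambda>z. act z D) ` {z. z ^ N = 1}) \<in> (\<lambda>z. act z D) ` {z. z ^ N = 1}"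
    by (rule someI)
  then obtain z where z: "z ^ N = 1" "(SOME D'. D' \<in> (\<lambda>z. act z D) ` {z. z ^ N = 1}) = act z D" by blast
  have "act z D \<in> base_dicriticals"
    unfolding base_dicriticals_def z(2)[symmetric] using assms by (rule imageI)
  then show ?thesis using z(1) by blast
qed

lemma base_dicriticals_subset: "base_dicriticals \<subseteq> dicriticals"
proof
  fix D assume "D \<in> base_dicriticals"
  then obtain D0 where D0: "D0 \<in> dicriticals" "D = (SOME D'. D' \<in> (\<lambda>z. act z D0) ` {z. z ^ N = 1})"
    by (auto simp: base_dicriticals_def)
  have "act 1 D0 \<in> (\<lambda>z. act z D0) ` {z. z ^ N = 1}" by (intro imageI) simp
  then have "D \<in> (\<lambda>z. act z D0) ` {z. z ^ N = 1}" unfolding D0(2) by (rule someI)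
  then show "D \<in> dicriticals" using act_dicriticals(1)[OF D0(1)] by blast
qed

lemma base_dicriticals_unique:
  assumes "D \<in> base_dicriticals" "D' \<in> base_dicriticals" "z ^ N = 1" "D' = act z D"
  shows "D' = D"
proof -
  define O' where "O' D = (\<lambda>z. act z D) ` {z::complex. z ^ N = 1}" for D
  have O': "O' (act z D) = O' D" if "z ^ N = 1" for z D
    unfolding O'_def using that by (rule act_orbit_eq)
  have rep: "D = (SOME E. E \<in> O' D)" if D: "D \<in> base_dicriticals" for D
  proof -
    obtain D0 where D0: "D = (SOME E. E \<in> O' D0)" using D by (auto simp: base_dicriticals_def O'_def)
    have "act 1 D0 \<in> O' D0" unfolding O'_def by (intro imageI) simp
    then have "D \<in> O' D0" unfolding D0 by (rule someI)
    then obtain z where "z ^ N = 1" "D = act z D0" by (auto simp: O'_def)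
    then have "O' D = O' D0" using O' by simp
    then show ?thesis using D0 by simp
  qed
  show ?thesis using rep[OF assms(1)] rep[OF assms(2)] O'[OF assms(3), of D] assms(4) by simp
qed

lemma finite_base_dicriticals: "finite base_dicriticals"
  using finite_dicriticals base_dicriticals_subset by (rule rev_finite_subset)

text \<open>\<^term>\<open>limit_poly D\<close> is invariant under the rotations of \<open>D\<close>, so such an \<open>R\<close> exists.\<close>

definition branch_poly :: "complex fps \<times> nat \<Rightarrow> complex poly" where
  "branch_poly D = (SOME R. limit_poly D = pcompose R (monom 1 (ramification D)))"

lemma branch_poly:
  assumes "D \<in> dicriticals"
  shows "limit_poly D = pcompose (branch_poly D) (monom 1 (ramification D))"
    "poly (limit_poly D) t = poly (branch_poly D) (t ^ ramification D)"
    "degree (limit_poly D) = ramification D * degree (branch_poly D)" "0 < degree (branch_poly D)"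
proof -
  have "\<exists>R. limit_poly D = pcompose R (monom 1 (ramification D))"
    using ramification_pos limit_poly_rotate[OF assms] by (rule pcompose_monom_of_invariant)
  then show *: "limit_poly D = pcompose (branch_poly D) (monom 1 (ramification D))"
    unfolding branch_poly_def by (rule someI_ex)
  show "poly (limit_poly D) t = poly (branch_poly D) (t ^ ramification D)"
    by (simp add: * poly_pcompose poly_monom)
  show deg: "degree (limit_poly D) = ramification D * degree (branch_poly D)"
    by (subst *) (simp add: degree_pcompose degree_monom_eq)
  show "0 < degree (branch_poly D)"
    using deg dicriticalD(1)[OF limit_poly[OF assms]] by (auto intro: gr0I)
qed

text \<open>For each solution s of R_D = a take t with t^m = s and a series over a that leaves D
  with coefficient t. If z conjugates two chosen series, it carries the one representative D to the
  other, so it fixes D. Then \<open>z ^ snd D\<close> is a rotation, hence an m-th root of unity,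
  and s = t^m is the same for both.\<close>

lemma sum_roots_le_orbit_count:
  "(\<Sum>D\<in>base_dicriticals. card {s. poly (branch_poly D) s = a}) \<le> orbit_count a"
proof -
  define S where "S = Sigma base_dicriticals (\<lambda>D. {s. poly (branch_poly D) s = a})"
  have "\<exists>H\<in>fibre a. lies_on H D \<and> fps_nth H (snd D) ^ ramification D = s" if "(D, s) \<in> S" for D s
  proof -
    have D: "D \<in> dicriticals" and s: "poly (branch_poly D) s = a"
      using that base_dicriticals_subset by (auto simp: S_def)
    obtain t where t: "t ^ ramification D = s"
    proof (cases "s = 0")
      case True
      then show ?thesis using that[of 0] ramification_pos[of D] by (simp add: zero_power)
    next
      case False
      then have "exp (Ln s / of_nat (ramification D)) ^ ramification D = s"
        using ramification_pos[of D] by (simp flip: exp_of_nat_mult)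
      then show ?thesis by (rule that)
    qed
    have "poly (limit_poly D) t = a" using branch_poly(2)[OF D] t s by simp
    from lies_on_fibre_exists[OF D this] show ?thesis using t by blast
  qed
  then have "\<forall>p\<in>S. \<exists>H. H \<in> fibre a \<and> lies_on H (fst p) \<and> fps_nth H (snd (fst p)) ^ ramification (fst p) = snd p"
    by fastforce
  from bchoice[OF this] obtain h where h': "\<forall>p\<in>S. h p \<in> fibre a \<and> lies_on (h p) (fst p) \<and>
      fps_nth (h p) (snd (fst p)) ^ ramification (fst p) = snd p" by blast
  then have h: "h (D, s) \<in> fibre a \<and> lies_on (h (D, s)) D \<and> fps_nth (h (D, s)) (snd D) ^ ramification D = s"
    if "(D, s) \<in> S" for D s using that by force
  have "inj_on (\<lambda>p. orbit (h p)) S"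
  proof (rule inj_onI, clarify)
    fix D s D' s' assume S: "(D, s) \<in> S" "(D', s') \<in> S" and "orbit (h (D, s)) = orbit (h (D', s'))"
    then obtain z where z: "z ^ N = 1" "h (D', s') = fps_act z (h (D, s))" by (auto simp: orbit_eq_iff)
    have bD: "D \<in> base_dicriticals" "D' \<in> base_dicriticals" using S by (auto simp: S_def)
    then have D: "D \<in> dicriticals" "D' \<in> dicriticals" using base_dicriticals_subset by auto
    have "lies_on (h (D', s')) (act z D)" using h[OF S(1)] by (simp add: z(2) lies_on_act)
    then have eq: "D' = act z D"
      using lies_on_unique[OF D(2) act_dicriticals(1)[OF D(1) z(1)]] h[OF S(2)] by blast
    then have "D' = D" using base_dicriticals_unique[OF bD z(1)] by simp
    moreover have "z ^ snd D \<in> rotations D" using z(1) eq \<open>D' = D\<close> by (auto simp: rotations_def)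
    then have "(z ^ snd D) ^ ramification D = 1" using rotations_eq[of D] by simp
    moreover have "s' = (z ^ snd D * fps_nth (h (D, s)) (snd D)) ^ ramification D"
      using h[OF S(2)] z(2) \<open>D' = D\<close> by simp
    then have "s' = (z ^ snd D) ^ ramification D * s"
      using h[OF S(1)] by (simp add: power_mult_distrib)
    ultimately show "D = D' \<and> s = s'" by simp
  qed
  moreover have "(\<lambda>p. orbit (h p)) ` S \<subseteq> orbit ` fibre a" using h by auto
  ultimately have "card S \<le> orbit_count a"
    unfolding orbit_count_def using finite_fibre by (intro card_inj_on_le) auto
  moreover have "card S = (\<Sum>D\<in>base_dicriticals. card {s. poly (branch_poly D) s = a})"
    unfolding S_def
  proof (rule card_SigmaI[OF finite_base_dicriticals], rule ballI)
    fix D assume "D \<in> base_dicriticals"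
    then have "branch_poly D - [:a:] \<noteq> 0"
      using branch_poly(4) base_dicriticals_subset by (metis degree_pCons_0 eq_iff_diff_eq_0 less_irrefl subsetD)
    from poly_roots_finite[OF this] show "finite {s. poly (branch_poly D) s = a}" by simp
  qed
  ultimately show ?thesis by simp
qed

text \<open>Exactly m deg R series pass through D, with multiplicity, and each orbit uses up at
  least m of them: the rotations of D give m different coefficients at u^q, unless this coefficient
  is 0.\<close>

lemma orbit_count_le_sum_degree:
  assumes a: "\<And>D. D \<in> base_dicriticals \<Longrightarrow> 2 \<le> ramification D \<Longrightarrow> poly (branch_poly D) 0 \<noteq> a"
  shows "orbit_count a \<le> (\<Sum>D\<in>base_dicriticals. degree (branch_poly D))"
proof -
  define Y where "Y D = {H \<in> fibre a. lies_on H D}" for D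
  have finY: "finite (Y D)" for D using finite_fibre by (simp add: Y_def)
  have "orbit ` fibre a \<subseteq> (\<Union>D\<in>base_dicriticals. orbit ` Y D)"
  proof
    fix \<O> assume "\<O> \<in> orbit ` fibre a"
    then obtain H where H: "H \<in> fibre a" "\<O> = orbit H" by blast
    obtain D where D: "D \<in> dicriticals" "lies_on H D" using fibre_lies_on[OF H(1)] by blast
    obtain z where z: "z ^ N = 1" "act z D \<in> base_dicriticals" using base_dicriticals_exists[OF D(1)] by blast
    have "fps_act z H \<in> Y (act z D)" using H(1) D(2) z(1) by (simp add: Y_def fps_act_fibre lies_on_act)
    moreover have "orbit (fps_act z H) = \<O>" unfolding H(2) by (rule sym) (use z(1) in \<open>auto simp: orbit_eq_iff\<close>)
    ultimately show "\<O> \<in> (\<Union>D\<in>base_dicriticals. orbit ` Y D)" using z(2) by blast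
  qed
  then have "orbit_count a \<le> card (\<Union>D\<in>base_dicriticals. orbit ` Y D)"
    unfolding orbit_count_def using finY finite_base_dicriticals by (intro card_mono) auto
  also have "\<dots> \<le> (\<Sum>D\<in>base_dicriticals. card (orbit ` Y D))"
    by (rule card_UN_le[OF finite_base_dicriticals])
  also have "\<dots> \<le> (\<Sum>D\<in>base_dicriticals. degree (branch_poly D))"
  proof (rule sum_mono)
    fix D assume bD: "D \<in> base_dicriticals"
    then have D: "D \<in> dicriticals" using base_dicriticals_subset by auto
    have many: "ramification D \<le> card {H' \<in> Y D. orbit H' = orbit H}" if H: "H \<in> Y D" for H
    proof -
      define f where "f = (\<lambda>w. w * fps_nth H (snd D))"
      have "inj_on f (rotations D)"
      proof (cases "fps_nth H (snd D) = 0")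
        \<comment> \<open>A zero coefficient is fixed by all rotations; here it forces R(0) = a, and
          the hypothesis on a leaves only m = 1.\<close>
        case True
        have "fps_nth H (snd D) \<in> {t. poly (limit_poly D) t = a}"
          unfolding limit_poly_roots(1)[OF D] using H by (auto simp: Y_def)
        then have "poly (branch_poly D) 0 = a"
          using True branch_poly(2)[OF D, of 0] ramification_pos[of D] by (simp add: zero_power)
        then have "ramification D = 1" using a[OF bD] ramification_pos[of D] by force
        then show ?thesis by (auto simp: rotations_eq inj_on_def)
      qed (auto simp: f_def inj_on_def)
      moreover have "f ` rotations D \<subseteq> (\<lambda>H'. fps_nth H' (snd D)) ` {H' \<in> Y D. orbit H' = orbit H}"
      proof
        fix x assume "x \<in> f ` rotations D"
        then obtain z where z: "z ^ N = 1" "act z D = D" "x = z ^ snd D * fps_nth H (snd D)"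
          by (auto simp: f_def rotations_def)
        have "fps_act z H \<in> Y D"
          using H z(1) lies_on_act[of H D z] unfolding z(2) by (simp add: Y_def fps_act_fibre)
        moreover have "orbit (fps_act z H) = orbit H" by (rule sym) (use z(1) in \<open>auto simp: orbit_eq_iff\<close>)
        ultimately show "x \<in> (\<lambda>H'. fps_nth H' (snd D)) ` {H' \<in> Y D. orbit H' = orbit H}"
          using z(3) by (intro image_eqI[of _ _ "fps_act z H"]) auto
      qed
      ultimately have "card (rotations D) \<le> card ((\<lambda>H'. fps_nth H' (snd D)) ` {H' \<in> Y D. orbit H' = orbit H})"
        using finY by (intro card_inj_on_le) auto
      also have "\<dots> \<le> card {H' \<in> Y D. orbit H' = orbit H}" using finY by (intro card_image_le) simp
      finally show ?thesis by (simp add: ramification_def)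
    qed
    have "ramification D * card (orbit ` Y D) = (\<Sum>\<O>\<in>orbit ` Y D. ramification D)" by simp
    also have "\<dots> \<le> (\<Sum>\<O>\<in>orbit ` Y D. card {H' \<in> Y D. orbit H' = \<O>})"
      using many by (intro sum_mono) auto
    also have "\<dots> = card (Y D)" using sum.image_gen[OF finY[of D], of "\<lambda>_. 1::nat" orbit] by simp
    also have "\<dots> \<le> length (filter (\<lambda>H. lies_on H D) (root_list a))"
    proof -
      have "Y D = set (filter (\<lambda>H. lies_on H D) (root_list a))" by (auto simp: Y_def fibre_eq)
      then show ?thesis using card_length by metis
    qed
    also have "\<dots> = ramification D * degree (branch_poly D)"
      using limit_poly_roots(2)[OF D, of a] branch_poly(3)[OF D] by simp
    finally show "card (orbit ` Y D) \<le> degree (branch_poly D)" using ramification_pos[of D] by simp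
  qed
  finally show ?thesis .
qed

text \<open>Since q > 0, a series has the constant term of its dicritical, and substituting z u for
  u does not change it.\<close>

lemma card_constant_terms_le: "card ((\<lambda>H. fps_nth H 0) ` fibre a) \<le> card base_dicriticals"
proof -
  have "(\<lambda>H. fps_nth H 0) ` fibre a \<subseteq> (\<lambda>D. fps_nth (fst D) 0) ` base_dicriticals"
  proof
    fix x assume "x \<in> (\<lambda>H. fps_nth H 0) ` fibre a"
    then obtain H where H: "H \<in> fibre a" "x = fps_nth H 0" by blast
    obtain D where D: "D \<in> dicriticals" "lies_on H D" using fibre_lies_on[OF H(1)] by blast
    obtain z where z: "z ^ N = 1" "act z D \<in> base_dicriticals" using base_dicriticals_exists[OF D(1)] by blast
    have "0 < snd D" using dicritical_pos[OF limit_poly[OF D(1)]] .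
    then have "fps_nth (fst (act z D)) 0 = x" using D(2) H(2) by (simp add: act_def lies_on_def agree_upto_def)
    then show "x \<in> (\<lambda>D. fps_nth (fst D) 0) ` base_dicriticals" using z(2) by blast
  qed
  then show ?thesis using finite_base_dicriticals by (meson card_image_le card_mono finite_imageI le_trans)
qed

text \<open>m deg R counts the series over 0 that pass through D. Distinct dicriticals share none,
  so the counts add up to at most d; indices of the list are counted to respect
  multiplicities.\<close>

lemma sum_ramification_degree_le: "(\<Sum>D\<in>base_dicriticals. ramification D * degree (branch_poly D)) \<le> d"
proof -
  define I where "I D = {i. i < d \<and> lies_on (root_list 0 ! i) D}" for D
  have "ramification D * degree (branch_poly D) = card (I D)" if "D \<in> base_dicriticals" for D
    using that base_dicriticals_subset branch_poly(3)[of D] limit_poly_roots(2)[of D 0] root_list(1)[of 0]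
    by (auto simp: length_filter_conv_card I_def)
  then have "(\<Sum>D\<in>base_dicriticals. ramification D * degree (branch_poly D)) = (\<Sum>D\<in>base_dicriticals. card (I D))"
    by simp
  also have "\<dots> = card (\<Union>D\<in>base_dicriticals. I D)"
  proof (rule card_UN_disjoint[symmetric, OF finite_base_dicriticals])
    show "\<forall>D\<in>base_dicriticals. \<forall>D'\<in>base_dicriticals. D \<noteq> D' \<longrightarrow> I D \<inter> I D' = {}"
      using lies_on_unique base_dicriticals_subset by (fastforce simp: I_def)
  qed (simp add: I_def)
  also have "\<dots> \<le> card {..<d}" by (intro card_mono) (auto simp: I_def)
  finally show ?thesis by simp
qed

text \<open>Expand \<open>W\<close> around F in powers of the increment of y. On the polar curve the
  linear term is absent, so the limit polynomial at F has no linear term in t, and its value at t =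
  0 is a.\<close>

lemma polar_limit:
  assumes pol: "poly (pderiv W) F = 0" and fin: "\<And>n. n < N * d \<Longrightarrow> fps_nth (poly W F) n = 0"
    and a: "fps_nth (poly W F) (N * d) = a"
  shows "\<exists>D\<in>base_dicriticals. a \<in> poly (branch_poly D) ` {s. poly (pderiv (branch_poly D)) s = 0} \<or>
    2 \<le> ramification D \<and> a = poly (branch_poly D) 0"
proof -
  obtain D where D: "D \<in> dicriticals" "lies_on F D" using lies_on_exists[OF fin] by blast
  define q where "q = snd D"
  define P where "P = pcompose (limit_poly D) [:fps_nth F q, 1:]"
  have dic: "dicritical F q P" unfolding q_def P_def by (rule lies_on_dicritical[OF D])
  have q: "0 < q" using dic by (rule dicritical_pos)
  define V where "V = pcompose W [:F, 1:]"
  have V1: "coeff V 1 = 0"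
  proof -
    have "coeff V 1 = poly (pderiv V) 0" by (simp add: poly_0_coeff_0 coeff_pderiv)
    also have "\<dots> = 0" using pol by (simp add: V_def pderiv_pcompose poly_pcompose pderiv_pCons)
    finally show ?thesis .
  qed
  \<comment> \<open>The power \<open>t ^ k\<close> in the limit comes only from the k-th coefficient
    of this expansion.\<close>
  define Q where "Q = (\<Sum>k\<le>degree V. monom (fps_nth (coeff V k * fps_X ^ (q * k)) (N * d)) k)"
  have "poly P t = poly Q t" for t
  proof -
    have "poly P t = fps_nth (poly W (F + fps_const t * fps_X ^ q)) (N * d)"
      using dicriticalD(3)[OF dic, of "fps_const t"] by simp
    also have "poly W (F + fps_const t * fps_X ^ q) = poly V (fps_const t * fps_X ^ q)"
      by (simp add: V_def poly_pcompose add.commute)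
    also have "\<dots> = (\<Sum>k\<le>degree V. fps_const (t ^ k) * (coeff V k * fps_X ^ (q * k)))"
      unfolding poly_altdef by (intro sum.cong) (simp_all add: power_mult_distrib mult_ac flip: power_mult)
    also have "fps_nth \<dots> (N * d) = poly Q t"
      by (simp add: Q_def fps_sum_nth poly_sum poly_monom mult.commute)
    finally show ?thesis .
  qed
  then have "P = Q" by (simp add: poly_eq_poly_eq_iff[symmetric] fun_eq_iff)
  moreover have "coeff Q 1 = (\<Sum>k\<le>degree V. if k = 1 then fps_nth (coeff V 1 * fps_X ^ (q * k)) (N * d) else 0)"
    unfolding Q_def coeff_sum by (intro sum.cong) auto
  ultimately have P1: "coeff P 1 = 0" unfolding V1 by simp
  have P0: "poly P 0 = a" using dicriticalD(3)[OF dic, of 0] a by simp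
  define \<tau> where "\<tau> = fps_nth F q"
  have "poly (pderiv (limit_poly D)) \<tau> = poly (pderiv P) 0"
    by (simp add: P_def pderiv_pcompose poly_pcompose pderiv_pCons \<tau>_def)
  also have "\<dots> = 0" using P1 by (simp add: poly_0_coeff_0 coeff_pderiv)
  finally have crit: "poly (pderiv (limit_poly D)) \<tau> = 0" .
  have val: "poly (limit_poly D) \<tau> = a" using P0 by (simp add: P_def poly_pcompose \<tau>_def)
  obtain z where z: "z ^ N = 1" "act z D \<in> base_dicriticals" using base_dicriticals_exists[OF D(1)] by blast
  define D' where "D' = act z D"
  have D': "D' \<in> dicriticals" using z(2) base_dicriticals_subset by (auto simp: D'_def)
  have nz: "z \<noteq> 0" using z(1) by (rule root_of_unity_nonzero)
  have l: "limit_poly D' = pcompose (limit_poly D) [:0, inverse (z ^ q):]"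
    unfolding D'_def q_def by (rule act_dicriticals(2)[OF D(1) z(1)])
  define \<sigma> where "\<sigma> = z ^ q * \<tau>"
  have \<sigma>: "\<sigma> * inverse (z ^ q) = \<tau>" using nz by (simp add: \<sigma>_def)
  have val': "poly (limit_poly D') \<sigma> = a" using val by (simp add: l poly_pcompose \<sigma>)
  have crit': "poly (pderiv (limit_poly D')) \<sigma> = 0"
    using crit by (simp add: l pderiv_pcompose poly_pcompose \<sigma>)
  have "poly (pderiv (branch_poly D')) (\<sigma> ^ ramification D') * (of_nat (ramification D') * \<sigma> ^ (ramification D' - 1)) = 0"
    using crit' branch_poly(1)[OF D'] by (simp add: pderiv_pcompose poly_pcompose pderiv_monom poly_monom)
  \<comment> \<open>The derivative of R(t^m) vanishes where that of R does, and also at t = 0 if m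
    >= 2: these are the two kinds of special values.\<close>
  then consider "poly (pderiv (branch_poly D')) (\<sigma> ^ ramification D') = 0" | "\<sigma> = 0" "2 \<le> ramification D'"
    using ramification_pos[of D'] by (cases "ramification D' = 1") auto
  then show ?thesis
  proof cases
    case 1
    then show ?thesis using z(2) val' branch_poly(2)[OF D', of \<sigma>] by (auto simp: D'_def intro!: bexI[of _ "act z D"])
  next
    case 2
    then have "poly (branch_poly D') 0 = a" using val' branch_poly(2)[OF D', of \<sigma>] by (simp add: zero_power)
    then show ?thesis using z(2) 2 by (auto simp: D'_def intro!: bexI[of _ "act z D"])
  qed
qed

end

subsection \<open>Series solutions of polynomial equations\<close>

definition series_of :: "nat \<Rightarrow> complex poly \<Rightarrow> complex fps" where
  "series_of N q = fps_of_poly (pcompose q (monom 1 N))"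

definition series_poly :: "nat \<Rightarrow> complex poly poly \<Rightarrow> complex fps poly" where
  "series_poly N G = map_poly (series_of N) G"

lemma series_of_0 [simp]: "series_of N 0 = 0"
  by (simp add: series_of_def)

lemma coeff_series_poly: "coeff (series_poly N G) k = series_of N (coeff G k)"
  by (simp add: series_poly_def coeff_map_poly)

lemma series_of_nth: "0 < N \<Longrightarrow> fps_nth (series_of N q) n = (if N dvd n then coeff q (n div N) else 0)"
proof -
  assume N: "0 < N"
  have "pcompose q (monom 1 N) = (\<Sum>i\<le>degree q. monom (coeff q i) (N * i))"
    by (simp add: poly_eq_poly_eq_iff[symmetric] fun_eq_iff poly_pcompose poly_sum poly_monom power_mult)
       (simp add: poly_altdef)
  then have "fps_nth (series_of N q) n = (\<Sum>i\<le>degree q. if N * i = n then coeff q i else 0)"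
    by (simp add: series_of_def coeff_sum)
  also have "\<dots> = (\<Sum>i\<le>degree q. if i = n div N \<and> N dvd n then coeff q i else 0)"
    using N by (intro sum.cong) auto
  also have "\<dots> = (if N dvd n then coeff q (n div N) else 0)"
    by (auto simp: coeff_eq_0)
  finally show ?thesis .
qed

lemma series_of_add: "series_of N (p + q) = series_of N p + series_of N q"
  and series_of_diff: "series_of N (p - q) = series_of N p - series_of N q"
  by (simp_all add: series_of_def pcompose_add pcompose_diff fps_of_poly_add fps_of_poly_diff)

lemma series_of_monom: "series_of N (monom c k) = fps_const c * fps_X ^ (N * k)"
proof -
  have "pcompose (monom c k) (monom 1 N) = monom c (N * k)"
    by (simp add: poly_eq_poly_eq_iff[symmetric] fun_eq_iff poly_pcompose poly_monom power_mult)
  then show ?thesis by (simp add: series_of_def fps_of_poly_monom)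
qed

lemma series_of_expansion: "(\<lambda>u. poly q (u ^ N)) has_fps_expansion series_of N q"
  unfolding has_fps_expansion_def series_of_def
  by (simp add: poly_pcompose poly_monom)

lemma fps_act_series_of:
  assumes "0 < N" "z ^ N = 1"
  shows "fps_act z (series_of N q) = series_of N q"
  using assms by (auto simp: fps_eq_iff series_of_nth power_mult elim!: dvdE)

lemma eval_fps_act: "eval_fps (fps_act z H) u = eval_fps H (z * u)"
  by (simp add: eval_fps_def power_mult_distrib mult_ac)

lemma coeff_prod_linear_expansion:
  fixes hs :: "(complex \<Rightarrow> complex) list"
  assumes "\<And>h. h \<in> set hs \<Longrightarrow> h has_fps_expansion F h"
  shows "(\<lambda>u. coeff (\<Prod>h\<leftarrow>hs. [:- h u, 1:]) k) has_fps_expansion coeff (\<Prod>h\<leftarrow>hs. [:- F h, 1:]) k"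
  using assms
proof (induction hs arbitrary: k)
  case Nil
  then show ?case by (cases "k = 0") (simp_all add: one_pCons coeff_pCons split: nat.split)
next
  case (Cons h hs)
  have IH: "(\<lambda>u. coeff (\<Prod>h\<leftarrow>hs. [:- h u, 1:]) k) has_fps_expansion coeff (\<Prod>h\<leftarrow>hs. [:- F h, 1:]) k" for k
    using Cons by simp
  have h: "h has_fps_expansion F h" using Cons.prems by simp
  show ?case
  proof (cases k)
    case 0
    have "(\<lambda>u. - (h u * coeff (\<Prod>h\<leftarrow>hs. [:- h u, 1:]) 0)) has_fps_expansion
      - (F h * coeff (\<Prod>h\<leftarrow>hs. [:- F h, 1:]) 0)"
      by (intro has_fps_expansion_minus has_fps_expansion_mult[OF h IH])
    then show ?thesis using 0 by (simp add: mult_pCons_left)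
  next
    case (Suc j)
    have "(\<lambda>u. - (h u * coeff (\<Prod>h\<leftarrow>hs. [:- h u, 1:]) (Suc j)) + coeff (\<Prod>h\<leftarrow>hs. [:- h u, 1:]) j) has_fps_expansion
      - (F h * coeff (\<Prod>h\<leftarrow>hs. [:- F h, 1:]) (Suc j)) + coeff (\<Prod>h\<leftarrow>hs. [:- F h, 1:]) j"
      by (intro has_fps_expansion_minus has_fps_expansion_mult[OF h IH] has_fps_expansion_add IH)
    then show ?thesis using Suc by (simp add: mult_pCons_left)
  qed
qed

text \<open>The coefficients of both sides expand the same functions of u, and expansions are
  unique. The factorisation is kept in both forms: formal series carry the algebra of dicriticals,
  convergent ones the geometry near infinity.\<close>

lemma puiseux_series:
  fixes G :: "complex poly poly"
  assumes lc: "lead_coeff G = [:l:]" "l \<noteq> 0" and N: "fact (degree G) dvd N" "0 < N"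
  obtains \<rho> Hs where "0 < \<rho>" "length Hs = degree G"
    "series_poly N G = smult (fps_const l) (\<Prod>H\<leftarrow>Hs. [:- H, 1:])"
    "\<And>H. H \<in> set Hs \<Longrightarrow> ereal \<rho> \<le> fps_conv_radius H"
    "\<And>u. norm u < \<rho> \<Longrightarrow> eval_inner (u ^ N) G = smult l (\<Prod>H\<leftarrow>Hs. [:- eval_fps H u, 1:])"
proof -
  define G' where "G' = smult [:inverse l:] G"
  have G: "G = smult [:l:] G'" using lc(2) by (simp add: G'_def one_pCons[symmetric])
  have "lead_coeff G' = 1" using lc by (simp add: G'_def one_pCons)
  moreover have "degree G' = degree G" using lc(2) by (simp add: G'_def)
  ultimately obtain \<rho> hs where \<rho>: "0 < \<rho>" and hs: "length hs = degree G"
    "\<And>h. h \<in> set hs \<Longrightarrow> h holomorphic_on ball 0 \<rho>"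
    "\<And>u. u \<in> ball 0 \<rho> \<Longrightarrow> eval_inner (u ^ N) G' = (\<Prod>h\<leftarrow>hs. [:- h u, 1:])"
    using puiseux_monic[of G' "degree G" N] N by metis
  define F where "F h = fps_expansion h 0" for h :: "complex \<Rightarrow> complex"
  have eball: "eball 0 (ereal \<rho>) = ball (0::complex) \<rho>" by (auto simp: eball_def)
  have F: "h has_fps_expansion F h" if "h \<in> set hs" for h
    unfolding F_def using hs(2)[OF that] \<rho> by (intro has_fps_expansion_fps_expansion[of "ball 0 \<rho>"]) auto
  have radius: "ereal \<rho> \<le> fps_conv_radius (F h)" if "h \<in> set hs" for h
    unfolding F_def using hs(2)[OF that] by (intro conv_radius_fps_expansion) (simp add: eball)
  have eval: "eval_fps (F h) u = h u" if "h \<in> set hs" "norm u < \<rho>" for h u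
    using has_fps_expansion_imp_eval_fps_eq[OF F[OF that(1)] that(2) hs(2)[OF that(1)]] .
  have ev: "eval_inner (u ^ N) G = smult l (\<Prod>h\<leftarrow>hs. [:- h u, 1:])" if "norm u < \<rho>" for u
    by (subst G) (use hs(3)[of u] that in \<open>simp add: eval_inner_smult\<close>)
  show ?thesis
  proof (rule that[OF \<rho>, of "map F hs"])
    show "series_poly N G = smult (fps_const l) (\<Prod>H\<leftarrow>map F hs. [:- H, 1:])"
    proof (rule poly_eqI)
      fix k
      have "(\<lambda>u. l * coeff (\<Prod>h\<leftarrow>hs. [:- h u, 1:]) k) has_fps_expansion
          fps_const l * coeff (\<Prod>h\<leftarrow>hs. [:- F h, 1:]) k"
        by (intro has_fps_expansion_cmult_left coeff_prod_linear_expansion F)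
      moreover have "eventually (\<lambda>u. l * coeff (\<Prod>h\<leftarrow>hs. [:- h u, 1:]) k = poly (coeff G k) (u ^ N)) (nhds 0)"
      proof -
        have "eventually (\<lambda>u. u \<in> ball 0 \<rho>) (nhds (0::complex))"
          using \<rho> by (intro eventually_nhds_in_open) auto
        then show ?thesis
        proof eventually_elim
          case (elim u)
          then show ?case using ev[of u] by (simp flip: coeff_eval_inner)
        qed
      qed
      ultimately have "(\<lambda>u. poly (coeff G k) (u ^ N)) has_fps_expansion
          fps_const l * coeff (\<Prod>h\<leftarrow>hs. [:- F h, 1:]) k"
        by (subst (asm) has_fps_expansion_cong[OF _ refl]) auto
      then show "coeff (series_poly N G) k = coeff (smult (fps_const l) (\<Prod>H\<leftarrow>map F hs. [:- H, 1:])) k"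
        using fps_expansion_unique_complex[OF series_of_expansion] by (simp add: coeff_series_poly o_def)
    qed
    fix u :: complex assume u: "norm u < \<rho>"
    have "map (\<lambda>H. [:- eval_fps H u, 1:]) (map F hs) = map (\<lambda>h. [:- h u, 1:]) hs"
      using eval[OF _ u] by simp
    then show "eval_inner (u ^ N) G = smult l (\<Prod>H\<leftarrow>map F hs. [:- eval_fps H u, 1:])"
      using ev[OF u] by (simp only:)
  qed (use hs(1) radius in auto)
qed

locale monic_in_y =
  fixes E :: "complex poly poly" and lc :: complex and d :: nat
  assumes E_degree: "degree E = d" "0 < d" and E_lead: "lead_coeff E = [:lc:]" "lc \<noteq> 0"
begin

abbreviation "N \<equiv> (fact d :: nat)"
abbreviation "W \<equiv> series_poly N E"

lemma shifted_lead:
  "degree (E - [:monom a d:]) = d" "lead_coeff (E - [:monom a d:]) = [:lc:]"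
proof -
  have eq: "E - [:monom a d:] = E + [:- monom a d:]" by simp
  show "degree (E - [:monom a d:]) = d"
    unfolding eq using E_degree by (subst degree_add_eq_left) auto
  moreover have "coeff [:- monom a d:] d = 0" using E_degree(2) by (simp add: coeff_pCons split: nat.split)
  ultimately show "lead_coeff (E - [:monom a d:]) = [:lc:]"
    unfolding eq using E_lead E_degree by simp
qed

lemma series_shifted: "series_poly N (E - [:monom a d:]) = W - [:fps_const a * fps_X ^ (N * d):]"
  by (intro poly_eqI) (simp add: coeff_series_poly series_of_diff coeff_pCons series_of_monom split: nat.split)

sublocale fibre_series W lc d N
proof
  show "0 < d" "lc \<noteq> 0" using E_degree E_lead by auto
  show "0 < N" by simp
  show "map_poly (fps_act z) W = W" if "z ^ N = 1" for z
    using that by (intro poly_eqI) (simp add: coeff_map_poly coeff_series_poly fps_act_series_of)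
  fix a :: complex
  have N: "fact (degree (E - [:monom a d:])) dvd N" "0 < N" by (simp_all add: shifted_lead)
  obtain Hs where
    "length Hs = degree (E - [:monom a d:])"
    "series_poly N (E - [:monom a d:]) = smult (fps_const lc) (\<Prod>H\<leftarrow>Hs. [:- H, 1:])"
    by (rule puiseux_series[OF shifted_lead(2)[of a] E_lead(2) N]) (rule that; assumption)
  then show "\<exists>Hs. length Hs = d \<and> W - [:fps_const a * fps_X ^ (N * d):] = smult (fps_const lc) (\<Prod>H\<leftarrow>Hs. [:- H, 1:])"
    unfolding series_shifted shifted_lead(1) by blast
qed

lemma roots_convergent:
  fixes G :: "complex poly poly"
  assumes lc: "lead_coeff G = [:l:]" "l \<noteq> 0" and N: "fact (degree G) dvd N"
  obtains \<rho> where "0 < \<rho>" "finite {H. poly (series_poly N G) H = 0}"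
    "\<And>H. poly (series_poly N G) H = 0 \<Longrightarrow> ereal \<rho> \<le> fps_conv_radius H"
    "\<And>u y. norm u < \<rho> \<Longrightarrow> poly (eval_inner (u ^ N) G) y = 0 \<longleftrightarrow>
      (\<exists>H. poly (series_poly N G) H = 0 \<and> y = eval_fps H u)"
proof -
  obtain \<rho> Hs where 1: "0 < \<rho>" "series_poly N G = smult (fps_const l) (\<Prod>H\<leftarrow>Hs. [:- H, 1:])"
    "\<And>H. H \<in> set Hs \<Longrightarrow> ereal \<rho> \<le> fps_conv_radius H"
    "\<And>u. norm u < \<rho> \<Longrightarrow> eval_inner (u ^ N) G = smult l (\<Prod>H\<leftarrow>Hs. [:- eval_fps H u, 1:])"
    by (rule puiseux_series[OF lc N fact_gt_zero]) (rule that; assumption)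
  have root: "poly (series_poly N G) H = 0 \<longleftrightarrow> H \<in> set Hs" for H
    using lc(2) by (auto simp: 1(2) poly_prod_list_map prod_list_nonzero_iff)
  have "poly (eval_inner (u ^ N) G) y = 0 \<longleftrightarrow> (\<exists>H\<in>set Hs. y = eval_fps H u)" if "norm u < \<rho>" for u y
    using lc(2) by (auto simp: 1(4)[OF that] poly_prod_list_map prod_list_nonzero_iff)
  then show ?thesis using 1(1,3) by (intro that[of \<rho>]) (auto simp: root)
qed

lemma fibre_convergent:
  obtains \<rho> where "0 < \<rho>" "finite {H. H \<in> fibre a}" "\<And>H. H \<in> fibre a \<Longrightarrow> ereal \<rho> \<le> fps_conv_radius H"
    "\<And>u y. norm u < \<rho> \<Longrightarrow> poly (eval_inner (u ^ N) E) y = a * u ^ (N * d) \<longleftrightarrow> (\<exists>H\<in>fibre a. y = eval_fps H u)"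
proof -
  have root: "poly (series_poly N (E - [:monom a d:])) H = 0 \<longleftrightarrow> H \<in> fibre a" for H
    by (simp add: series_shifted fibre_def)
  have val: "poly (eval_inner (u ^ N) (E - [:monom a d:])) y = 0 \<longleftrightarrow> poly (eval_inner (u ^ N) E) y = a * u ^ (N * d)" for u y
    by (simp add: eval_inner_diff poly_monom power_mult)
  have "fact (degree (E - [:monom a d:])) dvd N" by (simp add: shifted_lead)
  then show ?thesis
    by (rule roots_convergent[OF shifted_lead(2)[of a] E_lead(2), unfolded root val]) (rule that[unfolded Bex_def])
qed

text \<open>The polar has degree d - 1, whose factorial divides N as well, so its roots are series
  in the same u and can be inserted into \<open>W\<close>.\<close>

lemma polar_convergent:
  obtains \<rho> where "0 < \<rho>" "finite {F. poly (pderiv W) F = 0}"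
    "\<And>F. poly (pderiv W) F = 0 \<Longrightarrow> ereal \<rho> \<le> fps_conv_radius F"
    "\<And>u y. norm u < \<rho> \<Longrightarrow> poly (pderiv (eval_inner (u ^ N) E)) y = 0 \<longleftrightarrow>
      (\<exists>F. poly (pderiv W) F = 0 \<and> y = eval_fps F u)"
proof -
  have eq: "series_poly N (pderiv E) = pderiv W"
  proof (rule poly_eqI)
    fix k
    have "series_of N (of_nat m * q) = of_nat m * series_of N q" for m q
      by (induction m) (simp_all add: series_of_add algebra_simps)
    then show "coeff (series_poly N (pderiv E)) k = coeff (pderiv W) k"
      by (simp add: coeff_series_poly coeff_pderiv del: of_nat_Suc)
  qed
  have "lead_coeff (pderiv E) = [:of_nat d * lc:]"
    using E_degree E_lead by (simp add: degree_pderiv coeff_pderiv of_nat_poly)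
  moreover have "of_nat d * lc \<noteq> 0" using E_degree E_lead by simp
  moreover have "fact (degree (pderiv E)) dvd N"
    using E_degree by (auto simp: degree_pderiv intro: fact_dvd)
  ultimately show ?thesis
    by (rule roots_convergent[of "pderiv E", unfolded eq eval_inner_pderiv]) (rule that)
qed

end

subsection \<open>Smooth functions\<close>

definition smooth_on :: "'a::euclidean_space set \<Rightarrow> ('a \<Rightarrow> 'b::euclidean_space) \<Rightarrow> bool" where
  "smooth_on U g \<longleftrightarrow> (\<forall>k. Ck_on k g U)"

lemma Ck_on_cong:
  assumes "open U" "\<And>x. x \<in> U \<Longrightarrow> g x = h x"
  shows "Ck_on k g U \<longleftrightarrow> Ck_on k h U"
  using assms(2)
proof (induction k arbitrary: g h)
  case 0
  then show ?case by (simp cong: continuous_on_cong_simp)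
next
  case (Suc k)
  have der: "(g has_derivative D) (at x) \<longleftrightarrow> (h has_derivative D) (at x)" if "x \<in> U" for x D
    using has_derivative_transform_within_open[of g D x UNIV U h] has_derivative_transform_within_open[of h D x UNIV U g]
      assms(1) that Suc.prems by auto
  have "frechet_derivative g (at x) v = frechet_derivative h (at x) v" if "x \<in> U" for x v
    unfolding frechet_derivative_def using der[OF that] by simp
  then have "Ck_on k (\<lambda>x. frechet_derivative g (at x) v) U \<longleftrightarrow> Ck_on k (\<lambda>x. frechet_derivative h (at x) v) U" for v
    by (rule Suc.IH)
  then show ?case using der by (simp add: differentiable_def)
qed

text \<open>An explicit derivative agrees with the chosen \<open>frechet_derivative\<close> only on
  U, which is why the congruence on open sets comes first.\<close>

lemma Ck_on_SucI:
  assumes U: "open U" and der: "\<And>x. x \<in> U \<Longrightarrow> (g has_derivative D x) (at x)"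
    and C: "\<And>v. Ck_on k (\<lambda>x. D x v) U"
  shows "Ck_on (Suc k) g U"
proof -
  have "D x v = frechet_derivative g (at x) v" if "x \<in> U" for x v
    using frechet_derivative_at[OF der[OF that]] by simp
  then have "Ck_on k (\<lambda>x. frechet_derivative g (at x) v) U" for v
    by (rule iffD1[OF Ck_on_cong[OF U] C])
  then show ?thesis using der by (auto simp: differentiable_def)
qed

lemma Ck_on_SucD:
  assumes "Ck_on (Suc k) g U" "x \<in> U"
  shows "(g has_derivative frechet_derivative g (at x)) (at x)"
  using assms by (simp add: frechet_derivative_works)

lemma Ck_on_lower: "Ck_on (Suc k) g U \<Longrightarrow> Ck_on k g U"
proof (induction k arbitrary: g)
  case 0
  then show ?case
    by (auto intro!: continuous_at_imp_continuous_on differentiable_imp_continuous_within)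
next
  case (Suc k)
  then show ?case by auto
qed

lemma Ck_on_const: "open U \<Longrightarrow> Ck_on k (\<lambda>x. c) U"
  by (induction k arbitrary: c) (auto intro: Ck_on_SucI[where D = "\<lambda>_ _. 0"] simp del: Ck_on.simps(2))

lemma Ck_on_bounded_linear:
  assumes "open U" "bounded_linear L"
  shows "Ck_on k L U"
proof (cases k)
  case 0
  then show ?thesis using assms(2) by (simp add: linear_continuous_on)
next
  case (Suc j)
  have "Ck_on (Suc j) L U"
    by (rule Ck_on_SucI[OF assms(1) bounded_linear_imp_has_derivative[OF assms(2)] Ck_on_const[OF assms(1)]])
  then show ?thesis using Suc by simp
qed

lemma Ck_on_add:
  assumes "open U"
  shows "Ck_on k g U \<Longrightarrow> Ck_on k h U \<Longrightarrow> Ck_on k (\<lambda>x. g x + h x) U"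
proof (induction k arbitrary: g h)
  case 0
  then show ?case by (simp add: continuous_on_add)
next
  case (Suc k)
  show ?case
  proof (rule Ck_on_SucI[OF assms])
    show "((\<lambda>x. g x + h x) has_derivative (\<lambda>v. frechet_derivative g (at x) v + frechet_derivative h (at x) v)) (at x)"
      if "x \<in> U" for x
      by (rule has_derivative_add[OF Ck_on_SucD[OF Suc.prems(1) that] Ck_on_SucD[OF Suc.prems(2) that]])
    show "Ck_on k (\<lambda>x. frechet_derivative g (at x) v + frechet_derivative h (at x) v) U" for v
      using Suc.prems by (intro Suc.IH) auto
  qed
qed

lemma Ck_on_bilinear:
  assumes U: "open U" and B: "bounded_bilinear B"
  shows "Ck_on k g U \<Longrightarrow> Ck_on k h U \<Longrightarrow> Ck_on k (\<lambda>x. B (g x) (h x)) U"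
proof (induction k arbitrary: g h)
  case 0
  then show ?case using bounded_bilinear.continuous_on[OF B] by simp
next
  case (Suc k)
  show ?case
  proof (rule Ck_on_SucI[OF U])
    show "((\<lambda>x. B (g x) (h x)) has_derivative
        (\<lambda>v. B (g x) (frechet_derivative h (at x) v) + B (frechet_derivative g (at x) v) (h x))) (at x)" if "x \<in> U" for x
      by (rule bounded_bilinear.FDERIV[OF B Ck_on_SucD[OF Suc.prems(1) that] Ck_on_SucD[OF Suc.prems(2) that]])
    show "Ck_on k (\<lambda>x. B (g x) (frechet_derivative h (at x) v) + B (frechet_derivative g (at x) v) (h x)) U" for v
      using Suc.prems Ck_on_lower[OF Suc.prems(1)] Ck_on_lower[OF Suc.prems(2)]
      by (intro Ck_on_add[OF U] Suc.IH) auto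
  qed
qed

lemma Ck_on_linear_compose:
  assumes U: "open U" and L: "bounded_linear L"
  shows "Ck_on k g U \<Longrightarrow> Ck_on k (\<lambda>x. L (g x)) U"
proof (induction k arbitrary: g)
  case 0
  then show ?case using bounded_linear.continuous_on[OF L] by simp
next
  case (Suc k)
  show ?case
  proof (rule Ck_on_SucI[OF U])
    show "((\<lambda>x. L (g x)) has_derivative (\<lambda>v. L (frechet_derivative g (at x) v))) (at x)" if "x \<in> U" for x
      by (rule bounded_linear.has_derivative[OF L Ck_on_SucD[OF Suc.prems that]])
    show "Ck_on k (\<lambda>x. L (frechet_derivative g (at x) v)) U" for v
      using Suc.prems by (intro Suc.IH) auto
  qed
qed

lemma Ck_on_mult:
  fixes g h :: "'a::euclidean_space \<Rightarrow> complex"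
  assumes "open U" "Ck_on k g U" "Ck_on k h U"
  shows "Ck_on k (\<lambda>x. g x * h x) U"
  using assms by (intro Ck_on_bilinear[OF _ bounded_bilinear_mult])

text \<open>The derivative of the inverse contains the inverse itself, one order of smoothness
  lower, so induction applies.\<close>

lemma Ck_on_inverse:
  fixes g :: "'a::euclidean_space \<Rightarrow> complex"
  assumes U: "open U" and nz: "\<And>x. x \<in> U \<Longrightarrow> g x \<noteq> 0"
  shows "Ck_on k g U \<Longrightarrow> Ck_on k (\<lambda>x. inverse (g x)) U"
proof (induction k)
  case 0
  then show ?case using nz by (auto intro: continuous_on_inverse)
next
  case (Suc k)
  note IH = Suc.IH[OF Ck_on_lower[OF Suc.prems]]
  show ?case
  proof (rule Ck_on_SucI[OF U])
    show "((\<lambda>x. inverse (g x)) has_derivative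
        (\<lambda>v. - (inverse (g x) * frechet_derivative g (at x) v * inverse (g x)))) (at x)" if "x \<in> U" for x
      by (rule Deriv.has_derivative_inverse[OF nz[OF that] Ck_on_SucD[OF Suc.prems that]])
    have "Ck_on k (\<lambda>x. (-1) * (inverse (g x) * frechet_derivative g (at x) v * inverse (g x))) U" for v
      using Suc.prems by (intro Ck_on_mult U IH Ck_on_const) auto
    then show "Ck_on k (\<lambda>x. - (inverse (g x) * frechet_derivative g (at x) v * inverse (g x))) U" for v by simp
  qed
qed

lemma Ck_on_poly:
  fixes g :: "'a::euclidean_space \<Rightarrow> complex"
  assumes "open U" "Ck_on k g U"
  shows "Ck_on k (\<lambda>x. poly p (g x)) U"
  using assms by (induction p) (auto intro!: Ck_on_add Ck_on_mult Ck_on_const)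

lemma Ck_on_eval_inner:
  fixes X Y :: "'a::euclidean_space \<Rightarrow> complex"
  assumes "open U" "Ck_on k X U" "Ck_on k Y U"
  shows "Ck_on k (\<lambda>z. poly (eval_inner (X z) G) (Y z)) U"
  using assms by (induction G) (auto intro!: Ck_on_add Ck_on_mult Ck_on_const Ck_on_poly)

text \<open>The derivative of an implicit function is a rational expression in the function itself,
  so differentiability can be bootstrapped.\<close>

lemma smooth_on_implicit:
  fixes X Y c :: "'a::euclidean_space \<Rightarrow> complex"
  assumes U: "open U" and cont: "continuous_on U Y" and X: "smooth_on U X" and c: "smooth_on U c"
    and eq: "\<And>z. z \<in> U \<Longrightarrow> poly (eval_inner (X z) G) (Y z) = c z"
    and nz: "\<And>z. z \<in> U \<Longrightarrow> poly (pderiv (eval_inner (X z) G)) (Y z) \<noteq> 0"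
  shows "smooth_on U Y"
proof -
  define a where "a z = poly (eval_inner (X z) (map_poly pderiv G)) (Y z)" for z
  define b where "b z = poly (eval_inner (X z) (pderiv G)) (Y z)" for z
  have CX: "Ck_on k X U" and Cc: "Ck_on k c U" for k using X c by (auto simp: smooth_on_def)
  have b: "b z \<noteq> 0" if "z \<in> U" for z using nz[OF that] by (simp add: b_def eval_inner_pderiv)
  have der: "(Y has_derivative (\<lambda>v. - (a z * frechet_derivative X (at z) v - frechet_derivative c (at z) v) / b z)) (at z)"
    if z: "z \<in> U" for z
  proof -
    let ?X' = "frechet_derivative X (at z)" and ?c' = "frechet_derivative c (at z)"
    have X': "(X has_derivative ?X') (at z)" and c': "(c has_derivative ?c') (at z)"
      using Ck_on_SucD[OF CX[of "Suc 0"] z] Ck_on_SucD[OF Cc[of "Suc 0"] z] by blast+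
    have 1: "((\<lambda>(x, y). poly (eval_inner x G) y) has_derivative (\<lambda>(v, w). a z * v + b z * w)) (at (X z, Y z))"
      unfolding a_def b_def eval_inner_pderiv by (rule eval_inner_has_derivative)
    have 2: "((\<lambda>p. (X (fst p), snd p)) has_derivative (\<lambda>p. (?X' (fst p), snd p))) (at (z, Y z))"
      using X' by (intro has_derivative_Pair has_derivative_snd[OF has_derivative_ident]
          has_derivative_compose[OF has_derivative_fst[OF has_derivative_ident]]) simp
    have 3: "((\<lambda>p. c (fst p)) has_derivative (\<lambda>p. ?c' (fst p))) (at (z, Y z))"
      using c' by (intro has_derivative_compose[OF has_derivative_fst[OF has_derivative_ident]]) simp
    have "((\<lambda>p. poly (eval_inner (X (fst p)) G) (snd p) - c (fst p)) has_derivative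
        (\<lambda>p. (a z * ?X' (fst p) + b z * snd p) - ?c' (fst p))) (at (z, Y z))"
      using has_derivative_diff[OF has_derivative_compose[OF 2, of "\<lambda>(x, y). poly (eval_inner x G) y"
          "\<lambda>(v, w). a z * v + b z * w"] 3] 1 by simp
    moreover have "(\<lambda>p. (a z * ?X' (fst p) + b z * snd p) - ?c' (fst p)) =
        (\<lambda>(h, w). (a z * ?X' h - ?c' h) + b z * w)" by (simp add: fun_eq_iff)
    ultimately have "((\<lambda>p. poly (eval_inner (X (fst p)) G) (snd p) - c (fst p)) has_derivative
        (\<lambda>(h, w). (a z * ?X' h - ?c' h) + b z * w)) (at (z, Y z))" by simp
    moreover have "isCont Y z" using cont U z by (simp add: continuous_on_eq_continuous_at)
    moreover have "eventually (\<lambda>z. z \<in> U) (nhds z)" using U z by (rule eventually_nhds_in_open)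
    then have "eventually (\<lambda>z'. (\<lambda>p. poly (eval_inner (X (fst p)) G) (snd p) - c (fst p)) (z', Y z') = 0) (nhds z)"
      by eventually_elim (simp add: eq)
    ultimately show ?thesis using b[OF z] by (intro implicit_has_derivative)
  qed
  have "Ck_on k Y U" for k
  proof (induction k)
    case 0
    then show ?case using cont by simp
  next
    case (Suc k)
    show ?case
    proof (rule Ck_on_SucI[OF U der])
      fix v
      have "Ck_on k (\<lambda>z. (frechet_derivative c (at z) v + (-1) * (a z * frechet_derivative X (at z) v)) * inverse (b z)) U"
        using CX[of "Suc k"] Cc[of "Suc k"] unfolding a_def b_def
        by (intro Ck_on_mult Ck_on_add Ck_on_inverse Ck_on_eval_inner Ck_on_const U Suc CX b[unfolded b_def]) auto
      then show "Ck_on k (\<lambda>z. - (a z * frechet_derivative X (at z) v - frechet_derivative c (at z) v) / b z) U"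
        by (simp add: divide_inverse)
    qed
  qed
  then show ?thesis by (simp add: smooth_on_def)
qed

lemma smooth_on_vector_2:
  fixes g h :: "'a::euclidean_space \<Rightarrow> complex"
  assumes U: "open U" and "smooth_on U g" "smooth_on U h"
  shows "smooth_on U (\<lambda>x. vector [g x, h x] :: complex^2)"
proof -
  have "linear (\<lambda>x. vector [x, 0] :: complex^2)" "linear (\<lambda>x. vector [0, x] :: complex^2)"
    by (auto intro!: linearI simp: vec_eq_iff forall_2)
  then have L: "bounded_linear (\<lambda>x. vector [x, 0] :: complex^2)" "bounded_linear (\<lambda>x. vector [0, x] :: complex^2)"
    by (simp_all add: linear_conv_bounded_linear)
  have "vector [x, 0] + vector [0, y] = (vector [x, y] :: complex^2)" for x y
    by (simp add: vec_eq_iff forall_2)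
  moreover have "Ck_on k (\<lambda>x. vector [g x, 0] + vector [0, h x] :: complex^2) U" for k
    using assms by (intro Ck_on_add Ck_on_linear_compose[OF U L(1)] Ck_on_linear_compose[OF U L(2)]) (auto simp: smooth_on_def)
  ultimately show ?thesis by (simp add: smooth_on_def)
qed

lemma smooth_on_Pair:
  fixes g :: "'a::euclidean_space \<Rightarrow> 'b::euclidean_space" and h :: "'a \<Rightarrow> 'c::euclidean_space"
  assumes U: "open U" and "smooth_on U g" "smooth_on U h"
  shows "smooth_on U (\<lambda>x. (g x, h x))"
proof -
  have "bounded_linear (\<lambda>x. (x, 0) :: 'b \<times> 'c)" "bounded_linear (\<lambda>x. (0, x) :: 'b \<times> 'c)"
    by (intro bounded_linear_Pair bounded_linear_ident bounded_linear_zero)+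
  then have "Ck_on k (\<lambda>x. (g x, 0) + (0, h x)) U" for k
    using assms Ck_on_linear_compose[OF U, of "\<lambda>x. (x, 0) :: 'b \<times> 'c" k g]
      Ck_on_linear_compose[OF U, of "\<lambda>x. (0, x) :: 'b \<times> 'c" k h]
    by (intro Ck_on_add) (auto simp: smooth_on_def)
  then show ?thesis by (simp add: smooth_on_def)
qed

lemma Ck_on_power:
  fixes g :: "'a::euclidean_space \<Rightarrow> complex"
  assumes "open U" "Ck_on k g U"
  shows "Ck_on k (\<lambda>x. g x ^ n) U"
  using assms by (induction n) (auto intro: Ck_on_mult Ck_on_const)

lemma Ck_on_sum:
  assumes "open U" "\<And>i. i \<in> I \<Longrightarrow> Ck_on k (g i) U"
  shows "Ck_on k (\<lambda>x. \<Sum>i\<in>I. g i x) U"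
  using assms(2) by (induction I rule: infinite_finite_induct) (auto intro: Ck_on_add Ck_on_const assms(1))

lemma smooth_on_imp_continuous_on: "smooth_on U g \<Longrightarrow> continuous_on U g"
  unfolding smooth_on_def by (metis Ck_on.simps(1))

lemma smooth_on_imp_smooth_map_on:
  assumes "open U" "S \<subseteq> U" "smooth_on U g"
  shows "smooth_map_on g S"
  using assms unfolding smooth_map_on_def smooth_on_def by blast

lemma smooth_on_compose_fst:
  fixes g :: "'a::euclidean_space \<Rightarrow> 'b::euclidean_space" and D :: "'c::euclidean_space set"
  assumes U: "open U" and D: "open D" and "smooth_on U g"
  shows "smooth_on (U \<times> D) (\<lambda>z. g (fst z))"
proof -
  have UD: "open (U \<times> D)" using U D by (rule open_Times)
  have "Ck_on k g U \<Longrightarrow> Ck_on k (\<lambda>z. g (fst z)) (U \<times> D)" for k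
  proof (induction k arbitrary: g)
    case 0
    then show ?case by (auto intro!: continuous_on_compose2[of U g] continuous_intros)
  next
    case (Suc k)
    show ?case
    proof (rule Ck_on_SucI[OF UD])
      fix z :: "'a \<times> 'c" assume "z \<in> U \<times> D"
      then have "fst z \<in> U" by auto
      from has_derivative_compose[OF has_derivative_fst[OF has_derivative_ident] Ck_on_SucD[OF Suc.prems this]]
      show "((\<lambda>z. g (fst z)) has_derivative (\<lambda>v. frechet_derivative g (at (fst z)) (fst v))) (at z)" .
    next
      show "Ck_on k (\<lambda>z. frechet_derivative g (at (fst z)) (fst v)) (U \<times> D)" for v
        using Suc.prems by (intro Suc.IH) simp
    qed
  qed
  then show ?thesis using assms(3) by (simp add: smooth_on_def)
qed

subsection \<open>Germs of sets\<close>

lemma eventually_germ: "eventually P (germ p A) \<longleftrightarrow> eventually (\<lambda>q. q \<in> A \<longrightarrow> P q) (nhds p)"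
  by (simp add: germ_def eventually_inf_principal)

lemma germ_le_iff: "germ p A \<le> germ p B \<longleftrightarrow> eventually (\<lambda>q. q \<in> A \<longrightarrow> q \<in> B) (nhds p)"
proof
  assume "germ p A \<le> germ p B"
  moreover have "eventually (\<lambda>q. q \<in> B) (germ p B)" by (simp add: eventually_germ)
  ultimately have "eventually (\<lambda>q. q \<in> B) (germ p A)" by (rule filter_leD)
  then show "eventually (\<lambda>q. q \<in> A \<longrightarrow> q \<in> B) (nhds p)" by (simp add: eventually_germ)
next
  assume *: "eventually (\<lambda>q. q \<in> A \<longrightarrow> q \<in> B) (nhds p)"
  show "germ p A \<le> germ p B"
    unfolding le_filter_def eventually_germ using * by (auto elim: eventually_elim2)
qed

lemma germ_mono: "A \<subseteq> B \<Longrightarrow> germ p A \<le> germ p B"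
  unfolding germ_le_iff by (rule always_eventually) auto

lemma germ_eqI: "eventually (\<lambda>q. q \<in> A \<longleftrightarrow> q \<in> B) (nhds p) \<Longrightarrow> germ p A = germ p B"
  by (intro antisym) (auto simp: germ_le_iff elim: eventually_mono)

lemma germ_Un: "germ p (A \<union> B) = sup (germ p A) (germ p B)"
  by (auto simp: filter_eq_iff eventually_sup eventually_germ eventually_conj_iff[symmetric] elim: eventually_mono)

lemma germ_empty: "germ p {} = bot"
  by (simp add: germ_def)

lemma germ_neq_bot: "p \<in> A \<Longrightarrow> germ p A \<noteq> bot"
  using eventually_nhds_x_imp_x[of "\<lambda>q. q \<notin> A" p] by (auto simp: trivial_limit_def eventually_germ)

subsection \<open>Complex differentiability in several variables\<close>

text \<open>Complex linearity is spelled out by additivity and homogeneity;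
  \<open>holomorphic_on_open_iff\<close> makes the connection with the vector space predicate
  once.\<close>

definition complex_differentiable :: "(complex^'n \<Rightarrow> complex) \<Rightarrow> complex^'n \<Rightarrow> bool" where
  "complex_differentiable g z \<longleftrightarrow>
    (\<exists>L. (\<forall>x y. L (x + y) = L x + L y) \<and> (\<forall>c x. L (c *s x) = c * L x) \<and> (g has_derivative L) (at z))"

lemma holomorphic_on_open_iff:
  fixes g :: "complex^'n \<Rightarrow> complex"
  shows "holomorphic_on_open g U \<longleftrightarrow> open U \<and> (\<forall>z\<in>U. complex_differentiable g z)"
proof -
  have "Vector_Spaces.linear (*s) (*) L \<longleftrightarrow>
      (\<forall>x y. L (x + y) = L x + L y) \<and> (\<forall>c x. L (c *s x) = c * L x)" for L :: "complex^'n \<Rightarrow> complex"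
    unfolding Vector_Spaces.linear_iff
    by (auto simp: vec.vector_space_axioms intro: vector_space.intro) (unfold_locales, auto simp: algebra_simps)
  then show ?thesis by (simp only: holomorphic_on_open_def complex_differentiable_def conj_assoc)
qed

lemma complex_differentiable_const: "complex_differentiable (\<lambda>z. c) z"
  unfolding complex_differentiable_def by (intro exI[of _ "\<lambda>_. 0"]) auto

lemma complex_differentiable_nth: "complex_differentiable (\<lambda>z. z $ i) z"
  unfolding complex_differentiable_def
  by (intro exI[of _ "\<lambda>z. z $ i"]) (auto intro!: bounded_linear_imp_has_derivative bounded_linear_vec_nth)

lemma complex_differentiable_add:
  assumes "complex_differentiable g z" "complex_differentiable h z"
  shows "complex_differentiable (\<lambda>z. g z + h z) z"
proof -
  obtain L M where "\<forall>x y. L (x + y) = L x + L y" "\<forall>c x. L (c *s x) = c * L x" "(g has_derivative L) (at z)"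
    "\<forall>x y. M (x + y) = M x + M y" "\<forall>c x. M (c *s x) = c * M x" "(h has_derivative M) (at z)"
    using assms unfolding complex_differentiable_def by blast
  then show ?thesis unfolding complex_differentiable_def
    by (intro exI[of _ "\<lambda>x. L x + M x"]) (auto intro!: has_derivative_add simp: algebra_simps)
qed

lemma complex_differentiable_mult:
  assumes "complex_differentiable g z" "complex_differentiable h z"
  shows "complex_differentiable (\<lambda>z. g z * h z) z"
proof -
  obtain L M where "\<forall>x y. L (x + y) = L x + L y" "\<forall>c x. L (c *s x) = c * L x" "(g has_derivative L) (at z)"
    "\<forall>x y. M (x + y) = M x + M y" "\<forall>c x. M (c *s x) = c * M x" "(h has_derivative M) (at z)"
    using assms unfolding complex_differentiable_def by blast
  moreover from this have "((\<lambda>z. g z * h z) has_derivative (\<lambda>x. g z * M x + L x * h z)) (at z)"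
    by (intro has_derivative_mult)
  ultimately show ?thesis unfolding complex_differentiable_def
    by (intro exI[of _ "\<lambda>x. g z * M x + L x * h z"]) (simp add: algebra_simps)
qed

lemma complex_differentiable_compose:
  assumes "complex_differentiable g z" "f field_differentiable (at (g z))"
  shows "complex_differentiable (\<lambda>z. f (g z)) z"
proof -
  obtain L where L: "\<forall>x y. L (x + y) = L x + L y" "\<forall>c x. L (c *s x) = c * L x" "(g has_derivative L) (at z)"
    using assms(1) unfolding complex_differentiable_def by blast
  obtain f' where "(f has_derivative (\<lambda>h. f' * h)) (at (g z))"
    using assms(2) unfolding field_differentiable_def has_field_derivative_def by blast
  from has_derivative_compose[OF L(3) this] show ?thesis
    unfolding complex_differentiable_def using L(1,2)
    by (intro exI[of _ "\<lambda>x. f' * L x"]) (simp add: algebra_simps)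
qed

lemma complex_differentiable_divide:
  assumes "complex_differentiable g z" "complex_differentiable h z" "h z \<noteq> 0"
  shows "complex_differentiable (\<lambda>z. g z / h z) z"
proof -
  have "complex_differentiable (\<lambda>z. inverse (h z)) z"
    using assms(2) by (rule complex_differentiable_compose)
      (use assms(3) in \<open>auto intro!: derivative_eq_intros simp: field_differentiable_def\<close>)
  from complex_differentiable_mult[OF assms(1) this] show ?thesis by (simp add: divide_inverse)
qed

lemma complex_differentiable_power: "complex_differentiable g z \<Longrightarrow> complex_differentiable (\<lambda>z. g z ^ k) z"
  by (induction k) (auto intro: complex_differentiable_mult complex_differentiable_const)

lemma complex_differentiable_sum:
  "(\<And>i. i \<in> I \<Longrightarrow> complex_differentiable (g i) z) \<Longrightarrow> complex_differentiable (\<lambda>z. \<Sum>i\<in>I. g i z) z"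
  by (induction I rule: infinite_finite_induct)
    (auto intro: complex_differentiable_add complex_differentiable_const)

lemma complex_differentiable_diff:
  assumes "complex_differentiable g z" "complex_differentiable h z"
  shows "complex_differentiable (\<lambda>z. g z - h z) z"
  using complex_differentiable_add[OF assms(1) complex_differentiable_mult[OF complex_differentiable_const[of "-1"] assms(2)]]
  by simp

lemma has_derivative_vector_2:
  fixes a b :: "'e::real_normed_vector \<Rightarrow> complex"
  assumes "(a has_derivative a') F" "(b has_derivative b') F"
  shows "((\<lambda>x. vector [a x, b x] :: complex^2) has_derivative (\<lambda>h. vector [a' h, b' h])) F"
proof -
  have "linear (\<lambda>x. vector [x, 0] :: complex^2)" "linear (\<lambda>x. vector [0, x] :: complex^2)"
    by (auto intro!: linearI simp: vec_eq_iff forall_2)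
  then have "bounded_linear (\<lambda>x. vector [x, 0] :: complex^2)" "bounded_linear (\<lambda>x. vector [0, x] :: complex^2)"
    by (simp_all add: linear_conv_bounded_linear)
  from has_derivative_add[OF bounded_linear.has_derivative[OF this(1) assms(1)]
      bounded_linear.has_derivative[OF this(2) assms(2)]]
  have "((\<lambda>x. vector [a x, 0] + vector [0, b x] :: complex^2) has_derivative
      (\<lambda>h. vector [a' h, 0] + vector [0, b' h])) F" .
  moreover have "vector [x, 0] + vector [0, y] = (vector [x, y] :: complex^2)" for x y
    by (simp add: vec_eq_iff forall_2)
  ultimately show ?thesis by (simp only:)
qed

lemma complex_differentiable_curve:
  fixes g :: "complex^2 \<Rightarrow> complex"
  assumes g: "complex_differentiable g (vector [a u, b u])"
    and "a field_differentiable (at u)" "b field_differentiable (at u)"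
  shows "(\<lambda>u. g (vector [a u, b u])) field_differentiable (at u)"
proof -
  obtain L where L: "\<forall>x y. L (x + y) = L x + L y" "\<forall>c x. L (c *s x) = c * L x"
    "(g has_derivative L) (at (vector [a u, b u]))"
    using g unfolding complex_differentiable_def by blast
  obtain a' b' where a': "(a has_derivative (\<lambda>h. a' * h)) (at u)" and b': "(b has_derivative (\<lambda>h. b' * h)) (at u)"
    using assms(2,3) unfolding field_differentiable_def has_field_derivative_def by blast
  have "((\<lambda>u. vector [a u, b u] :: complex^2) has_derivative (\<lambda>h. vector [a' * h, b' * h])) (at u)"
    by (rule has_derivative_vector_2[OF a' b'])
  from has_derivative_compose[OF this L(3)]
  have "((\<lambda>u. g (vector [a u, b u])) has_derivative (\<lambda>h. L (vector [a' * h, b' * h]))) (at u)" by simp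
  moreover have "L (vector [a' * h, b' * h]) = L (vector [a', b']) * h" for h
  proof -
    have "vector [a' * h, b' * h] = h *s (vector [a', b'] :: complex^2)"
      by (simp add: vec_eq_iff forall_2 mult.commute)
    then show ?thesis using L(2) by (simp add: mult.commute)
  qed
  ultimately show ?thesis by (auto simp: field_differentiable_def has_field_derivative_def)
qed

subsection \<open>The projective plane\<close>

lemma abs_proj_plane_eq_iff:
  assumes "v \<noteq> 0" "w \<noteq> 0"
  shows "abs_proj_plane v = abs_proj_plane w \<longleftrightarrow> (\<exists>c. w = c *s v)"
proof -
  have "proj_eq v v" "proj_eq w w" using assms by (auto simp: proj_eq_def intro: exI[of _ 1])
  then have "abs_proj_plane v = abs_proj_plane w \<longleftrightarrow> proj_eq v w"
    using Quotient3_rel[OF Quotient3_proj_plane, of v w] by blast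
  then show ?thesis using assms by (simp add: proj_eq_def)
qed

lemma rep_proj_plane_neq_0: "rep_proj_plane q \<noteq> 0"
  using Quotient3_rep_reflp[OF Quotient3_proj_plane, of q] by (simp add: proj_eq_def)

lemma abs_rep_proj_plane [simp]: "abs_proj_plane (rep_proj_plane q) = q"
  by (rule Quotient3_abs_rep[OF Quotient3_proj_plane])

lemma rep_abs_proj_plane:
  assumes "v \<noteq> 0"
  obtains c where "c \<noteq> 0" "rep_proj_plane (abs_proj_plane v) = c *s v"
proof -
  obtain c where c: "rep_proj_plane (abs_proj_plane v) = c *s v"
    using abs_proj_plane_eq_iff[OF assms rep_proj_plane_neq_0[of "abs_proj_plane v"]] by auto
  then have "c \<noteq> 0" using rep_proj_plane_neq_0[of "abs_proj_plane v"] by auto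
  then show ?thesis using c that by blast
qed

lemma open_proj_plane_iff: "open U \<longleftrightarrow> open {v. v \<noteq> 0 \<and> abs_proj_plane v \<in> U}"
  by (rule open_proj_plane_def)

lemma open_vimage_abs_proj_plane:
  fixes g :: "'a::topological_space \<Rightarrow> complex^3"
  assumes "continuous_on UNIV g" "\<And>x. g x \<noteq> 0" "open U"
  shows "open ((\<lambda>x. abs_proj_plane (g x)) -` U)"
proof -
  have "(\<lambda>x. abs_proj_plane (g x)) -` U = g -` {v. v \<noteq> 0 \<and> abs_proj_plane v \<in> U}" using assms(2) by auto
  then show ?thesis using assms(1,3) by (simp only: open_proj_plane_iff open_vimage)
qed

lemma continuous_on_vector_3:
  fixes a b c :: "'a::topological_space \<Rightarrow> complex"
  assumes "continuous_on S a" "continuous_on S b" "continuous_on S c"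
  shows "continuous_on S (\<lambda>x. vector [a x, b x, c x] :: complex^3)"
proof -
  have "(vector [x, y, z] :: complex^3) = (\<chi> i. if i = 1 then x else if i = 2 then y else z)" for x y z :: complex
    by (simp add: vec_eq_iff forall_3)
  moreover have "continuous_on S (\<lambda>t. \<chi> i::3. if i = 1 then a t else if i = 2 then b t else c t)"
  proof (rule continuous_on_vec_lambda)
    show "continuous_on S (\<lambda>t. if i = 1 then a t else if i = 2 then b t else c t)" for i :: 3
      using assms by (cases "i = 1"; cases "i = 2") auto
  qed
  ultimately show ?thesis by (simp only:)
qed

text \<open>Lets the three standard charts be treated alike: each has holomorphic homogeneous
  coordinates without common zero.\<close>

lemma proj_charts_cases:
  assumes "\<psi> \<in> proj_charts"
  obtains a b c where "\<psi> = (\<lambda>z. abs_proj_plane (vector [a z, b z, c z]))"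
    "\<And>z. vector [a z, b z, c z] \<noteq> (0 :: complex^3)"
    "\<And>z. complex_differentiable a z" "\<And>z. complex_differentiable b z" "\<And>z. complex_differentiable c z"
    "continuous_on UNIV a" "continuous_on UNIV b" "continuous_on UNIV c"
proof -
  note * = complex_differentiable_nth complex_differentiable_const
  have nz: "vector [x, y, z] \<noteq> (0 :: complex^3)" if "x = 1 \<or> y = 1 \<or> z = 1" for x y z
    using that by (auto simp: vec_eq_iff forall_3)
  from assms consider "\<psi> = (\<lambda>w. abs_proj_plane (vector [1, w $ 1, w $ 2]))"
    | "\<psi> = (\<lambda>w. abs_proj_plane (vector [w $ 1, 1, w $ 2]))"
    | "\<psi> = (\<lambda>w. abs_proj_plane (vector [w $ 1, w $ 2, 1]))"
    unfolding proj_charts_def by blast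
  then show ?thesis
  proof cases
    case 1
    then show ?thesis by (rule that) (auto simp: nz intro!: * continuous_intros)
  next
    case 2
    then show ?thesis by (rule that) (auto simp: nz intro!: * continuous_intros)
  next
    case 3
    then show ?thesis by (rule that) (auto simp: nz intro!: * continuous_intros)
  qed
qed

lemma open_vimage_chart:
  assumes "\<psi> \<in> proj_charts" "open U"
  shows "open (\<psi> -` U)"
  using assms(1)
proof (rule proj_charts_cases)
  fix a b c assume *: "\<psi> = (\<lambda>z. abs_proj_plane (vector [a z, b z, c z]))"
    "\<And>z. vector [a z, b z, c z] \<noteq> (0 :: complex^3)"
    "continuous_on UNIV a" "continuous_on UNIV b" "continuous_on UNIV c"
  show ?thesis
    unfolding *(1) by (rule open_vimage_abs_proj_plane[OF continuous_on_vector_3[OF *(3-5)] *(2) assms(2)])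
qed

lemma proj_holomorphic_on_subset:
  assumes "proj_holomorphic_on h U" "V \<subseteq> U" "open V"
  shows "proj_holomorphic_on h V"
  using assms open_vimage_chart[OF _ assms(3)]
  unfolding proj_holomorphic_on_def holomorphic_on_open_iff by blast

lemma proj_holomorphic_on_mult:
  assumes "proj_holomorphic_on g U" "proj_holomorphic_on h U"
  shows "proj_holomorphic_on (\<lambda>q. g q * h q) U"
  using assms complex_differentiable_mult
  unfolding proj_holomorphic_on_def holomorphic_on_open_iff o_def by blast

subsection \<open>Irreducible components of germs\<close>

text \<open>The products of an equation of A with an equation of B cut out the union.\<close>

lemma analytic_germ_Un:
  assumes "analytic_germ p (germ p A)" "analytic_germ p (germ p B)"
  shows "analytic_germ p (germ p (A \<union> B))"
proof -
  obtain U1 H1 where 1: "open U1" "p \<in> U1" "finite H1" "\<forall>h\<in>H1. proj_holomorphic_on h U1"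
    "germ p A = germ p {q \<in> U1. \<forall>h\<in>H1. h q = 0}" using assms(1) unfolding analytic_germ_def by blast
  obtain U2 H2 where 2: "open U2" "p \<in> U2" "finite H2" "\<forall>h\<in>H2. proj_holomorphic_on h U2"
    "germ p B = germ p {q \<in> U2. \<forall>h\<in>H2. h q = 0}" using assms(2) unfolding analytic_germ_def by blast
  define H where "H = (\<lambda>(g, h) q. g q * h q) ` (H1 \<times> H2)"
  have "\<forall>h\<in>H. proj_holomorphic_on h (U1 \<inter> U2)"
    using 1(4) 2(4) 1(1) 2(1) unfolding H_def
    by (auto intro!: proj_holomorphic_on_mult intro: proj_holomorphic_on_subset)
  moreover have "germ p (A \<union> B) = germ p {q \<in> U1 \<inter> U2. \<forall>h\<in>H. h q = 0}"
  proof -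
    have "germ p (A \<union> B) = germ p ({q \<in> U1. \<forall>h\<in>H1. h q = 0} \<union> {q \<in> U2. \<forall>h\<in>H2. h q = 0})"
      by (simp add: germ_Un 1(5) 2(5))
    also have "\<dots> = germ p {q \<in> U1 \<inter> U2. \<forall>h\<in>H. h q = 0}"
    proof (rule germ_eqI)
      have "eventually (\<lambda>q. q \<in> U1 \<inter> U2) (nhds p)" using 1 2 by (intro eventually_nhds_in_open) auto
      then show "eventually (\<lambda>q. q \<in> {q \<in> U1. \<forall>h\<in>H1. h q = 0} \<union> {q \<in> U2. \<forall>h\<in>H2. h q = 0} \<longleftrightarrow>
          q \<in> {q \<in> U1 \<inter> U2. \<forall>h\<in>H. h q = 0}) (nhds p)"
        by eventually_elim (auto simp: H_def)
    qed
    finally show ?thesis .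
  qed
  ultimately show ?thesis
    unfolding analytic_germ_def using 1 2 by (intro exI[of _ "U1 \<inter> U2"] exI[of _ H]) (auto simp: H_def)
qed

lemma analytic_germ_Int:
  assumes "analytic_germ p (germ p A)" "analytic_germ p (germ p B)"
  shows "analytic_germ p (germ p (A \<inter> B))"
proof -
  obtain U1 H1 where 1: "open U1" "p \<in> U1" "finite H1" "\<forall>h\<in>H1. proj_holomorphic_on h U1"
    "germ p A = germ p {q \<in> U1. \<forall>h\<in>H1. h q = 0}" using assms(1) unfolding analytic_germ_def by blast
  obtain U2 H2 where 2: "open U2" "p \<in> U2" "finite H2" "\<forall>h\<in>H2. proj_holomorphic_on h U2"
    "germ p B = germ p {q \<in> U2. \<forall>h\<in>H2. h q = 0}" using assms(2) unfolding analytic_germ_def by blast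
  have inf: "germ p (S \<inter> T) = inf (germ p S) (germ p T)" for S T :: "proj_plane set"
    unfolding germ_def by (simp add: inf_assoc inf_left_commute flip: inf_principal)
  have "germ p (A \<inter> B) = germ p ({q \<in> U1. \<forall>h\<in>H1. h q = 0} \<inter> {q \<in> U2. \<forall>h\<in>H2. h q = 0})"
    by (simp only: inf 1(5) 2(5))
  also have "{q \<in> U1. \<forall>h\<in>H1. h q = 0} \<inter> {q \<in> U2. \<forall>h\<in>H2. h q = 0} = {q \<in> U1 \<inter> U2. \<forall>h\<in>H1 \<union> H2. h q = 0}" by auto
  finally show ?thesis
    unfolding analytic_germ_def using 1 2
    by (intro exI[of _ "U1 \<inter> U2"] exI[of _ "H1 \<union> H2"]) (auto intro: proj_holomorphic_on_subset)
qed

text \<open>B is the union of its intersections with the pieces, which are again analytic;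
  irreducibility splits off one piece at a time.\<close>

lemma irreducible_germ_le_Union:
  assumes irr: "irreducible_germ p (germ p B)" and "finite I"
    and "\<And>i. i \<in> I \<Longrightarrow> analytic_germ p (germ p (A i))" and "germ p B \<le> germ p (\<Union>i\<in>I. A i)"
  shows "\<exists>i\<in>I. germ p B \<le> germ p (A i)"
  using assms(2-4)
proof (induction I rule: finite_induct)
  case empty
  then show ?case using irr by (simp add: germ_empty irreducible_germ_def bot_unique)
next
  case (insert i I)
  have B: "analytic_germ p (germ p B)" using irr by (simp add: irreducible_germ_def)
  have U: "analytic_germ p (germ p (\<Union>i\<in>J. A i))" if "finite J" "J \<subseteq> I" for J
    using that
  proof (induction J rule: finite_induct)
    case empty
    \<comment> \<open>The equation 1 = 0 cuts out the empty germ.\<close>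
    have "proj_holomorphic_on (\<lambda>_. 1) UNIV"
      by (simp add: proj_holomorphic_on_def holomorphic_on_open_iff o_def complex_differentiable_const)
    then show ?case unfolding analytic_germ_def by (intro exI[of _ UNIV] exI[of _ "{\<lambda>_. 1}"]) auto
  next
    case (insert j J)
    then show ?case using analytic_germ_Un[of p "A j" "\<Union>i\<in>J. A i"] insert.prems by (simp add: \<open>\<And>i. i \<in> insert _ I \<Longrightarrow> analytic_germ p (germ p (A i))\<close>)
  qed
  have 1: "analytic_germ p (germ p (B \<inter> A i))" using analytic_germ_Int[OF B] insert.prems(1) by simp
  have 2: "analytic_germ p (germ p (B \<inter> (\<Union>i\<in>I. A i)))"
    using analytic_germ_Int[OF B U[OF insert.hyps(1)]] by simp
  have "germ p B = germ p ((B \<inter> A i) \<union> (B \<inter> (\<Union>i\<in>I. A i)))"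
    using insert.prems(2) by (intro germ_eqI) (auto simp: germ_le_iff elim: eventually_mono)
  then have "germ p B = sup (germ p (B \<inter> A i)) (germ p (B \<inter> (\<Union>i\<in>I. A i)))" by (simp add: germ_Un)
  then have "germ p B = germ p (B \<inter> A i) \<or> germ p B = germ p (B \<inter> (\<Union>i\<in>I. A i))"
    using irr 1 2 unfolding irreducible_germ_def by blast
  then show ?case
  proof
    assume "germ p B = germ p (B \<inter> A i)"
    then show ?thesis using germ_mono[of "B \<inter> A i" "A i" p] by auto
  next
    assume "germ p B = germ p (B \<inter> (\<Union>i\<in>I. A i))"
    then have "germ p B \<le> germ p (\<Union>i\<in>I. A i)"
      using germ_mono[of "B \<inter> (\<Union>i\<in>I. A i)" "\<Union>i\<in>I. A i" p] by simp
    then show ?thesis using insert.IH insert.prems(1) by auto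
  qed
qed

text \<open>Every irreducible subgerm lies in one of the pieces, so the maximal ones are pieces;
  conversely a piece is maximal because comparable pieces coincide.\<close>

lemma branches_at_Union:
  assumes fin: "finite I" and irr: "\<And>i. i \<in> I \<Longrightarrow> irreducible_germ p (germ p (A i))"
    and incomparable: "\<And>i j. i \<in> I \<Longrightarrow> j \<in> I \<Longrightarrow> germ p (A i) \<le> germ p (A j) \<Longrightarrow> germ p (A i) = germ p (A j)"
    and X: "germ p X = germ p (\<Union>i\<in>I. A i)"
  shows "branches_at X p = (\<lambda>i. germ p (A i)) ` I"
proof -
  have an: "\<exists>B. G = germ p B" if "irreducible_germ p G" for G
    using that unfolding irreducible_germ_def analytic_germ_def by blast
  have le: "\<exists>i\<in>I. G \<le> germ p (A i)" if G: "irreducible_germ p G" "G \<le> germ p X" for G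
  proof -
    obtain B where "G = germ p B" using an[OF G(1)] by blast
    then show ?thesis
      using irreducible_germ_le_Union[of p B I A] G fin irr X unfolding irreducible_germ_def by simp
  qed
  have sub: "germ p (A i) \<le> germ p X" if "i \<in> I" for i
    unfolding X using that by (intro germ_mono) auto
  show ?thesis
  proof (intro subset_antisym subsetI)
    fix G assume "G \<in> branches_at X p"
    then have G: "irreducible_germ p G" "G \<le> germ p X"
      "\<And>G'. irreducible_germ p G' \<Longrightarrow> G' \<le> germ p X \<Longrightarrow> G \<le> G' \<Longrightarrow> G' = G"
      unfolding branches_at_def by auto
    then obtain i where "i \<in> I" "G \<le> germ p (A i)" using le by blast
    then show "G \<in> (\<lambda>i. germ p (A i)) ` I" using G(3)[OF irr sub] by auto
  next
    fix G assume "G \<in> (\<lambda>i. germ p (A i)) ` I"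
    then obtain i where i: "i \<in> I" "G = germ p (A i)" by blast
    have "G' = G" if G': "irreducible_germ p G'" "G' \<le> germ p X" "G \<le> G'" for G'
    proof -
      obtain j where j: "j \<in> I" "G' \<le> germ p (A j)" using le[OF G'(1,2)] by blast
      then have "G = germ p (A j)" using incomparable[OF i(1) j(1)] G'(3) i(2) by auto
      then show ?thesis using G'(3) j(2) by auto
    qed
    then show "G \<in> branches_at X p" unfolding branches_at_def using i irr sub by auto
  qed
qed

subsection \<open>Parametrised arcs at infinity\<close>

lemma coeff_prod_linear_holomorphic:
  assumes "finite I" "\<And>i. i \<in> I \<Longrightarrow> h i holomorphic_on S"
  shows "(\<lambda>u. coeff (\<Prod>i\<in>I. [:- h i u, 1:]) k) holomorphic_on S"
  using assms
proof (induction I arbitrary: k rule: finite_induct)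
  case empty
  then show ?case by simp
next
  case (insert i I)
  have IH: "(\<lambda>u. coeff (\<Prod>i\<in>I. [:- h i u, 1:]) k) holomorphic_on S" for k using insert by simp
  have "h i holomorphic_on S" using insert.prems by simp
  then show ?case
    using insert.hyps by (cases k) (auto simp: mult_pCons_left intro!: holomorphic_intros IH)
qed

lemma norm_root_of_unity:
  fixes z :: complex
  assumes "z ^ N = 1" "0 < N"
  shows "norm z = 1"
proof -
  have "norm z ^ N = 1 ^ N" using assms(1) by (metis norm_one norm_power power_one)
  then show ?thesis using assms(2) by (metis norm_ge_zero power_eq_imp_eq_base zero_le_one)
qed

lemma fps_conv_radius_act:
  assumes "z ^ N = 1" "0 < N"
  shows "fps_conv_radius (fps_act z F) = fps_conv_radius F"
proof -
  have "norm z = 1" using assms by (rule norm_root_of_unity)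
  then have "norm (z ^ n * fps_nth F n) = norm (fps_nth F n)" for n by (simp add: norm_mult norm_power)
  then show ?thesis
    unfolding fps_conv_radius_def fps_act_nth
    using conv_radius_norm[of "\<lambda>n. z ^ n * fps_nth F n"] conv_radius_norm[of "fps_nth F"] by simp
qed

lemma root_of_unity_invariant_imp_zero:
  assumes N: "0 < N" and inv: "\<And>z :: complex. z ^ N = 1 \<Longrightarrow> z ^ n * x = x" and n: "\<not> N dvd n"
  shows "x = 0"
proof -
  define z where "z = exp (2 * of_real pi * \<i> / of_nat N)"
  have "z ^ N = 1" using N by (simp add: z_def flip: exp_of_nat_mult)
  moreover have "z ^ n \<noteq> 1"
    using complex_root_unity_eq_1[of N n] N n by (simp add: z_def mult_ac flip: exp_of_nat_mult)
  ultimately show ?thesis using inv[of z] by simp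
qed

lemma nth_root_in_disc:
  fixes w :: complex
  assumes "norm w < \<rho> ^ N" "0 < N" "0 < \<rho>"
  shows "\<exists>u. u ^ N = w \<and> norm u < \<rho>"
proof -
  obtain u where u: "u ^ N = w"
  proof (cases "w = 0")
    case True
    then show ?thesis using that[of 0] assms(2) by simp
  next
    case False
    then have "exp (Ln w / of_nat N) ^ N = w" using assms(2) by (simp flip: exp_of_nat_mult)
    then show ?thesis by (rule that)
  qed
  then have "norm u ^ N < \<rho> ^ N" using assms(1) by (metis norm_power)
  then have "norm u < \<rho>" using assms(3) by (simp add: power_less_imp_less_base)
  then show ?thesis using u by blast
qed

text \<open>Invariance kills the coefficient of u^n unless N divides n, so the expansion is a power
  series in u^N. It converges for |w| < \<open>\<rho> ^ N\<close>, where every w is the N-th power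
  of some u in the disc.\<close>

lemma invariant_holomorphic_factors:
  fixes g :: "complex \<Rightarrow> complex"
  assumes g: "g holomorphic_on ball 0 \<rho>" and \<rho>: "0 < \<rho>" and N: "0 < N"
    and inv: "\<And>z u. z ^ N = 1 \<Longrightarrow> norm u < \<rho> \<Longrightarrow> g (z * u) = g u"
  shows "\<exists>e. e holomorphic_on ball 0 (\<rho> ^ N) \<and> (\<forall>u. norm u < \<rho> \<longrightarrow> g u = e (u ^ N))"
proof -
  define F where "F = fps_expansion g 0"
  have gF: "g has_fps_expansion F"
    unfolding F_def using g \<rho> by (intro has_fps_expansion_fps_expansion[of "ball 0 \<rho>"]) auto
  have eball: "eball 0 (ereal \<rho>) = ball (0::complex) \<rho>" by (auto simp: eball_def)
  have rad: "ereal \<rho> \<le> fps_conv_radius F"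
    unfolding F_def using g by (intro conv_radius_fps_expansion) (simp add: eball)
  have ev: "eval_fps F u = g u" if "norm u < \<rho>" for u
    using has_fps_expansion_imp_eval_fps_eq[OF gF that g] .
  have "fps_act z F = F" if z: "z ^ N = 1" for z
  proof (rule fps_expansion_unique_complex)
    have "0 < ereal \<rho>" using \<rho> by simp
    then have "0 < fps_conv_radius (fps_act z F)"
      using rad unfolding fps_conv_radius_act[OF z N] by (rule less_le_trans)
    moreover have "norm z = 1" using z N by (rule norm_root_of_unity)
    have "eventually (\<lambda>u. u \<in> ball 0 \<rho>) (nhds (0::complex))" using \<rho> by (intro eventually_nhds_in_open) auto
    then have "eventually (\<lambda>u. eval_fps (fps_act z F) u = g u) (nhds 0)"
    proof eventually_elim
      case (elim u)
      then have "norm (z * u) < \<rho>" using \<open>norm z = 1\<close> by (simp add: norm_mult)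
      then show ?case using ev[of "z * u"] inv[OF z] elim by (simp add: eval_fps_act)
    qed
    ultimately show "g has_fps_expansion fps_act z F" unfolding has_fps_expansion_def by blast
  qed (rule gF)
  then have "z ^ n * fps_nth F n = fps_nth F n" if "z ^ N = 1" for z n
    using that by (metis fps_act_nth)
  then have zero: "fps_nth F n = 0" if "\<not> N dvd n" for n
    using root_of_unity_invariant_imp_zero[OF N _ that] by blast
  have sums: "(\<lambda>k. fps_nth F (N * k) * (u ^ N) ^ k) sums g u" if u: "norm u < \<rho>" for u
  proof -
    have "(\<lambda>n. fps_nth F n * u ^ n) sums g u"
      using has_fps_expansion_imp_sums_complex[OF gF, of "ereal \<rho>" u] g u by (simp add: eball)
    moreover have "strict_mono (\<lambda>k. N * k)" using N by (simp add: strict_mono_def)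
    moreover have "fps_nth F n * u ^ n = 0" if "n \<notin> range (\<lambda>k. N * k)" for n
    proof -
      have "\<not> N dvd n" using that by (auto elim!: dvdE)
      then show ?thesis using zero by simp
    qed
    ultimately show ?thesis
      using sums_mono_reindex[of "\<lambda>k. N * k" "\<lambda>n. fps_nth F n * u ^ n" "g u"] by (simp add: power_mult)
  qed
  define e where "e w = (\<Sum>k. fps_nth F (N * k) * w ^ k)" for w
  have "e holomorphic_on ball 0 (\<rho> ^ N)"
  proof (rule power_series_holomorphic)
    fix w :: complex assume "w \<in> ball 0 (\<rho> ^ N)"
    then obtain u where "u ^ N = w" "norm u < \<rho>" using nth_root_in_disc[of w \<rho> N] N \<rho> by auto
    then show "(\<lambda>k. fps_nth F (N * k) * (w - 0) ^ k) sums e w"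
      using sums[of u] by (auto simp: e_def sums_iff)
  qed
  moreover have "g u = e (u ^ N)" if "norm u < \<rho>" for u using sums[OF that] by (simp add: e_def sums_iff)
  ultimately show ?thesis by blast
qed

text \<open>The chart \<open>(w, y) \<mapsto> [1 + s y : y : w]\<close> covers the line at infinity \<open>w = 0\<close> up to the point \<open>[s : 1 : 0]\<close>.\<close>

locale proj_chart_at_infinity =
  fixes s :: complex
begin

definition den :: "complex^3 \<Rightarrow> complex" where "den v = v $ 1 - s * v $ 2"

definition chart_vec :: "complex \<times> complex \<Rightarrow> complex^3" where
  "chart_vec z = vector [1 + s * snd z, snd z, fst z]"

definition chart :: "complex \<times> complex \<Rightarrow> proj_plane" where
  "chart z = abs_proj_plane (chart_vec z)"

definition coord :: "proj_plane \<Rightarrow> complex \<times> complex" where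
  "coord q = (rep_proj_plane q $ 3 / den (rep_proj_plane q), rep_proj_plane q $ 2 / den (rep_proj_plane q))"

definition domain :: "proj_plane set" where
  "domain = {q. den (rep_proj_plane q) \<noteq> 0}"

lemma den_scale [simp]: "den (k *s v) = k * den v"
  by (simp add: den_def algebra_simps)

lemma den_chart_vec [simp]: "den (chart_vec z) = 1"
  by (simp add: den_def chart_vec_def)

lemma den_0 [simp]: "den 0 = 0"
  by (simp add: den_def)

lemma chart_vec_neq_0: "chart_vec z \<noteq> 0"
  using den_chart_vec[of z] den_0 by (metis zero_neq_one)

lemma abs_in_domain: "v \<noteq> 0 \<Longrightarrow> abs_proj_plane v \<in> domain \<longleftrightarrow> den v \<noteq> 0"
  by (erule rep_abs_proj_plane) (simp add: domain_def)

lemma coord_abs: "v \<noteq> 0 \<Longrightarrow> coord (abs_proj_plane v) = (v $ 3 / den v, v $ 2 / den v)"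
  by (erule rep_abs_proj_plane) (simp add: coord_def)

lemma coord_chart [simp]: "coord (chart z) = z"
  by (simp add: chart_def coord_abs chart_vec_neq_0) (simp add: chart_vec_def)

lemma chart_in_domain [simp]: "chart z \<in> domain"
  by (simp add: chart_def abs_in_domain chart_vec_neq_0)

lemma chart_coord:
  assumes "q \<in> domain"
  shows "chart (coord q) = q"
proof -
  define v where "v = rep_proj_plane q"
  have nz: "den v \<noteq> 0" "v \<noteq> 0" using assms rep_proj_plane_neq_0[of q] by (auto simp: domain_def v_def)
  have "v $ 1 = den v + s * v $ 2" by (simp add: den_def)
  then have "v = den v *s chart_vec (coord q)"
    using nz(1) by (simp add: vec_eq_iff forall_3 chart_vec_def coord_def flip: v_def) (simp add: field_simps)
  then have "abs_proj_plane (chart_vec (coord q)) = abs_proj_plane v"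
    using abs_proj_plane_eq_iff[OF chart_vec_neq_0 nz(2)] by blast
  then show ?thesis by (simp add: chart_def v_def)
qed

lemma continuous_chart_vec: "continuous_on UNIV chart_vec"
  unfolding chart_vec_def by (intro continuous_on_vector_3 continuous_intros)

lemma open_vimage_chart_at_infinity: "open U \<Longrightarrow> open (chart -` U)"
  using open_vimage_abs_proj_plane[OF continuous_chart_vec chart_vec_neq_0] unfolding chart_def .

text \<open>Openness in the quotient is tested on vectors, where the coordinates are quotients with
  denominator \<open>den\<close>.\<close>

lemma open_chart_image:
  assumes "open O'"
  shows "open (chart ` O')"
proof -
  have q: "q \<in> chart ` O' \<longleftrightarrow> q \<in> domain \<and> coord q \<in> O'" for q
    using chart_coord[of q] by (auto intro: image_eqI[OF sym])
  have c: "continuous_on {v. den v \<noteq> 0} (\<lambda>v. (v $ 3 / den v, v $ 2 / den v))"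
    unfolding den_def by (intro continuous_intros) auto
  have o: "open {v. den v \<noteq> 0}"
    unfolding den_def by (intro open_Collect_neq continuous_intros)
  have "open ({v. den v \<noteq> 0} \<inter> (\<lambda>v. (v $ 3 / den v, v $ 2 / den v)) -` O')"
    using c o assms by (simp add: continuous_on_open_vimage Int_commute)
  also have "{v. den v \<noteq> 0} \<inter> (\<lambda>v. (v $ 3 / den v, v $ 2 / den v)) -` O' =
      {v. v \<noteq> 0 \<and> abs_proj_plane v \<in> chart ` O'}"
  proof -
    have "v \<noteq> 0" if "den v \<noteq> 0" for v using that den_0 by metis
    then show ?thesis by (auto simp: q abs_in_domain coord_abs)
  qed
  finally show ?thesis by (simp add: open_proj_plane_iff)
qed

lemma eventually_nhds_chart: "eventually P (nhds (chart z)) \<longleftrightarrow> eventually (\<lambda>z. P (chart z)) (nhds z)"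
proof
  assume "eventually P (nhds (chart z))"
  then obtain U where "open U" "chart z \<in> U" "\<forall>q\<in>U. P q" by (auto simp: eventually_nhds)
  then show "eventually (\<lambda>z. P (chart z)) (nhds z)"
    using open_vimage_chart_at_infinity[of U] unfolding eventually_nhds by (intro exI[of _ "chart -` U"]) auto
next
  assume "eventually (\<lambda>z. P (chart z)) (nhds z)"
  then obtain U where "open U" "z \<in> U" "\<forall>z\<in>U. P (chart z)" by (auto simp: eventually_nhds)
  then show "eventually P (nhds (chart z))"
    using open_chart_image[of U] unfolding eventually_nhds by (intro exI[of _ "chart ` U"]) auto
qed

lemma eventually_along_curve:
  assumes ev: "eventually P (nhds (chart (a u0, b u0)))" and "isCont a u0" "isCont b u0"
  shows "eventually (\<lambda>u. P (chart (a u, b u))) (nhds u0)"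
proof -
  have "isCont (\<lambda>u. (a u, b u)) u0" using assms(2,3) by (intro continuous_intros)
  then have "filterlim (\<lambda>u. (a u, b u)) (nhds (a u0, b u0)) (nhds u0)"
    unfolding isCont_def tendsto_at_iff_tendsto_nhds[of "\<lambda>u. (a u, b u)"] .
  moreover have "eventually (\<lambda>z. P (chart z)) (nhds (a u0, b u0))" using ev by (simp add: eventually_nhds_chart)
  ultimately show ?thesis by (rule eventually_compose_filterlim[rotated])
qed

text \<open>The branch at infinity parametrised by \<open>w = u\<^sup>N, y = H u\<close>.\<close>

definition arc :: "nat \<Rightarrow> real \<Rightarrow> complex fps \<Rightarrow> proj_plane set" where
  "arc N \<rho> H = (\<lambda>u. chart (u ^ N, eval_fps H u)) ` {u. norm u < \<rho>}"

lemma eventually_norm_fst_less: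
  fixes y :: complex
  shows "0 < \<epsilon> \<Longrightarrow> eventually (\<lambda>q. norm (fst (coord q)) < \<epsilon>) (nhds (chart (0, y)))"
proof -
  assume "0 < \<epsilon>"
  have "open {z :: complex \<times> complex. norm (fst z) < \<epsilon>}" by (intro open_Collect_less continuous_intros)
  from eventually_nhds_in_open[OF this, of "(0, y)"] \<open>0 < \<epsilon>\<close> show ?thesis
    by (simp add: eventually_nhds_chart)
qed

lemma arc_act_subset:
  assumes "0 < N" "z ^ N = 1"
  shows "arc N \<rho> (fps_act z H) \<subseteq> arc N \<rho> H"
proof
  fix q assume "q \<in> arc N \<rho> (fps_act z H)"
  then obtain u where u: "norm u < \<rho>" "q = chart (u ^ N, eval_fps (fps_act z H) u)" unfolding arc_def by blast
  then have "q = chart ((z * u) ^ N, eval_fps H (z * u))"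
    by (simp add: power_mult_distrib assms(2) eval_fps_act)
  moreover have "norm (z * u) < \<rho>" using u(1) norm_root_of_unity[OF assms(2,1)] by (simp add: norm_mult)
  ultimately show "q \<in> arc N \<rho> H" unfolding arc_def by blast
qed

lemma arc_act:
  assumes "0 < N" "z ^ N = 1"
  shows "arc N \<rho> (fps_act z H) = arc N \<rho> H"
proof
  have "inverse z ^ N = 1" using assms(2) by (simp add: power_inverse)
  from arc_act_subset[OF assms(1) this, of \<rho> "fps_act z H"]
  have "arc N \<rho> (fps_act (inverse z * z) H) \<subseteq> arc N \<rho> (fps_act z H)" by (simp only: fps_act_act)
  moreover have "inverse z * z = 1" using norm_root_of_unity[OF assms(2,1)] by (intro left_inverse) auto
  ultimately show "arc N \<rho> H \<subseteq> arc N \<rho> (fps_act z H)" by simp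
qed (rule arc_act_subset[OF assms])

lemma eval_fps_holomorphic_ball: "ereal \<rho> \<le> fps_conv_radius H \<Longrightarrow> eval_fps H holomorphic_on ball 0 \<rho>"
proof (rule holomorphic_on_eval_fps, rule subsetI)
  fix u :: complex assume rad: "ereal \<rho> \<le> fps_conv_radius H" and "u \<in> ball 0 \<rho>"
  then have "ereal (norm u) < ereal \<rho>" by simp
  then have "ereal (norm u) < fps_conv_radius H" using rad by (rule less_le_trans)
  then show "u \<in> eball 0 (fps_conv_radius H)" by (simp add: in_eball_iff)
qed

text \<open>The arc is the zero set of \<open>\<Prod>\<^bsub>z\<^sup>N = 1\<^esub> (y - H(z u))\<close>, whose coefficients depend only on \<open>u\<^sup>N = w\<close>.\<close>

lemma arc_analytic:
  assumes N: "0 < N" and \<rho>: "0 < \<rho>" and rad: "ereal \<rho> \<le> fps_conv_radius H"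
  shows "analytic_germ (chart (0, y)) (germ (chart (0, y)) (arc N \<rho> H))"
proof -
  define h where "h = eval_fps H"
  define \<mu> where "\<mu> = {z :: complex. z ^ N = 1}"
  have \<mu>: "finite \<mu>" "1 \<in> \<mu>" using finite_roots_unity[of N] N by (auto simp: \<mu>_def)
  have norm1: "norm z = 1" if "z \<in> \<mu>" for z
    using that norm_root_of_unity[OF _ N, of z] unfolding \<mu>_def by blast
  have hol: "h holomorphic_on ball 0 \<rho>" unfolding h_def by (rule eval_fps_holomorphic_ball[OF rad])
  define P where "P u = (\<Prod>z\<in>\<mu>. [:- h (z * u), 1:])" for u
  have "\<exists>e. e holomorphic_on ball 0 (\<rho> ^ N) \<and> (\<forall>u. norm u < \<rho> \<longrightarrow> coeff (P u) k = e (u ^ N))" for k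
  proof (rule invariant_holomorphic_factors[OF _ \<rho> N])
    show "(\<lambda>u. coeff (P u) k) holomorphic_on ball 0 \<rho>"
      unfolding P_def
    proof (rule coeff_prod_linear_holomorphic[OF \<mu>(1)])
      fix z assume z: "z \<in> \<mu>"
      show "(\<lambda>u. h (z * u)) holomorphic_on ball 0 \<rho>"
      proof (rule holomorphic_on_compose_gen[OF _ hol, unfolded o_def])
        show "(*) z holomorphic_on ball 0 \<rho>" by (intro holomorphic_intros)
        show "(*) z ` ball 0 \<rho> \<subseteq> ball 0 \<rho>" using norm1[OF z] by (auto simp: norm_mult)
      qed
    qed
    fix z u :: complex assume z: "z ^ N = 1"
    have "norm z = 1" using norm_root_of_unity[OF z N] .
    then have "z \<noteq> 0" by auto
    then have "bij_betw (\<lambda>x. x * z) \<mu> \<mu>"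
    proof (intro bij_betwI[of _ _ _ "\<lambda>x. x / z"] Pi_I)
      show "x * z \<in> \<mu>" "x / z \<in> \<mu>" if "x \<in> \<mu>" for x
        using that z by (simp_all add: \<mu>_def power_mult_distrib power_divide)
    qed simp_all
    from prod.reindex_bij_betw[OF this, of "\<lambda>x. [:- h (x * u), 1:]"]
    show "coeff (P (z * u)) k = coeff (P u) k" by (simp add: P_def mult.assoc)
  qed
  then have "\<exists>e. \<forall>k. e k holomorphic_on ball 0 (\<rho> ^ N) \<and> (\<forall>u. norm u < \<rho> \<longrightarrow> coeff (P u) k = e k (u ^ N))"
    by (intro choice allI)
  then obtain e where e: "\<And>k. e k holomorphic_on ball 0 (\<rho> ^ N)"
    "\<And>k u. norm u < \<rho> \<Longrightarrow> coeff (P u) k = e k (u ^ N)" by blast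
  define g where "g q = (\<Sum>k\<le>card \<mu>. e k (fst (coord q)) * snd (coord q) ^ k)" for q
  have deg: "degree (P u) = card \<mu>" for u
    unfolding P_def by (subst degree_prod_sum_eq) auto
  have gP: "g q = poly (P u) (snd (coord q))" if "norm u < \<rho>" "fst (coord q) = u ^ N" for q u
    using that e(2)[OF that(1)] by (simp add: g_def poly_altdef deg)
  define U where "U = chart ` {z. norm (fst z) < \<rho> ^ N}"
  have U: "open U" unfolding U_def
    by (intro open_chart_image open_Collect_less continuous_intros)
  have pU: "chart (0, y) \<in> U" using \<rho> by (auto simp: U_def)
  have Ucoord: "q \<in> domain" "norm (fst (coord q)) < \<rho> ^ N" if "q \<in> U" for q using that by (auto simp: U_def)
  have zero: "arc N \<rho> H = {q \<in> U. g q = 0}"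
  proof (intro subset_antisym subsetI)
    fix q assume "q \<in> arc N \<rho> H"
    then obtain u where u: "norm u < \<rho>" "q = chart (u ^ N, h u)" by (auto simp: arc_def h_def)
    have "norm (u ^ N) < \<rho> ^ N" using u(1) N by (simp add: norm_power power_strict_mono)
    then have "q \<in> U" using u(2) by (auto simp: U_def)
    moreover have "g q = poly (P u) (h u)" using gP[OF u(1), of q] u(2) by simp
    moreover have "poly (P u) (h u) = 0"
      unfolding P_def poly_prod using \<mu> by (intro prod_zero) (auto intro!: bexI[of _ 1])
    ultimately show "q \<in> {q \<in> U. g q = 0}" by simp
  next
    fix q assume "q \<in> {q \<in> U. g q = 0}"
    then have q: "q \<in> U" "g q = 0" by auto
    \<comment> \<open>Any N-th root u of w will do: the factor of \<open>P u\<close> that vanishes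
      at y names the z for which \<open>z * u\<close> is the parameter of q.\<close>
    obtain u where u: "u ^ N = fst (coord q)" "norm u < \<rho>"
      using nth_root_in_disc[OF Ucoord(2)[OF q(1)] N \<rho>] by blast
    have "poly (P u) (snd (coord q)) = 0" using gP[OF u(2)] u(1) q(2) by simp
    then obtain z where z: "z \<in> \<mu>" "snd (coord q) = h (z * u)"
      unfolding P_def poly_prod using \<mu>(1) by auto
    have "q = chart (coord q)" using chart_coord[OF Ucoord(1)[OF q(1)]] by simp
    also have "coord q = ((z * u) ^ N, h (z * u))"
      using z u(1) by (simp add: prod_eq_iff power_mult_distrib \<mu>_def)
    finally show "q \<in> arc N \<rho> H"
      unfolding arc_def using u(2) norm1[OF z(1)] by (intro image_eqI[of _ _ "z * u"]) (auto simp: norm_mult h_def)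
  qed
  have "proj_holomorphic_on g U"
    unfolding proj_holomorphic_on_def holomorphic_on_open_iff
  proof (intro ballI conjI open_vimage_chart U)
    fix \<psi> z assume \<psi>: "\<psi> \<in> proj_charts" and z: "z \<in> \<psi> -` U"
    from \<psi> obtain a b c where *: "\<psi> = (\<lambda>z. abs_proj_plane (vector [a z, b z, c z]))"
      "\<And>z. vector [a z, b z, c z] \<noteq> (0 :: complex^3)"
      "\<And>z. complex_differentiable a z" "\<And>z. complex_differentiable b z" "\<And>z. complex_differentiable c z"
      by (rule proj_charts_cases) (rule that; assumption)
    \<comment> \<open>\<open>D\<close> is \<open>den\<close> in the chart; it has no zero over U
      because U lies in \<open>domain\<close>.\<close>
    define D where "D z = a z - s * b z" for z
    have coord: "coord (\<psi> z) = (c z / D z, b z / D z)" for z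
      using coord_abs[OF *(2)[of z]] by (simp add: *(1) den_def D_def)
    have Dz: "D z \<noteq> 0"
      using Ucoord(1)[of "\<psi> z"] z abs_in_domain[OF *(2)[of z]] by (simp add: *(1) den_def D_def)
    have D: "complex_differentiable D z" unfolding D_def
      by (intro complex_differentiable_diff complex_differentiable_mult complex_differentiable_const *)
    have "norm (c z / D z) < \<rho> ^ N" using Ucoord(2)[of "\<psi> z"] z by (simp add: coord)
    then have ek: "e k field_differentiable (at (c z / D z))" for k
      using e(1)[of k] by (auto intro: holomorphic_on_imp_differentiable_at)
    have ec: "complex_differentiable (\<lambda>z. e k (c z / D z)) z" for k
      by (rule complex_differentiable_compose[of "\<lambda>z. c z / D z" z "e k"])
        (intro complex_differentiable_divide * D Dz ek)+
    have "complex_differentiable (\<lambda>z. \<Sum>k\<le>card \<mu>. e k (c z / D z) * (b z / D z) ^ k) z"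
      by (intro complex_differentiable_sum complex_differentiable_mult complex_differentiable_power
          ec complex_differentiable_divide * D Dz)
    then show "complex_differentiable (g \<circ> \<psi>) z" by (simp add: o_def g_def coord)
  qed auto
  then show ?thesis
    unfolding analytic_germ_def using U pU zero by (intro exI[of _ U] exI[of _ "{g}"]) auto
qed

lemma chart_vec_1: "k \<noteq> 0 \<Longrightarrow> 1 + s * y = k \<Longrightarrow> chart_vec (w, y) = k *s vector [1, y / k, w / k]"
  and chart_vec_2: "y \<noteq> 0 \<Longrightarrow> 1 + s * y = k \<Longrightarrow> chart_vec (w, y) = y *s vector [k / y, 1, w / y]"
  by (simp_all add: vec_eq_iff forall_3 chart_vec_def)

text \<open>\<open>proj_holomorphic_on\<close> refers to the standard charts, so the curve has to be
  rewritten in one of them. The first homogeneous coordinate 1 + s b(0) serves unless it vanishes;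
  then b(0) is nonzero and the second one serves.\<close>

lemma holomorphic_along_curve:
  assumes f: "proj_holomorphic_on f U" "open U" "chart (0, b 0) \<in> U" and ab: "a holomorphic_on ball 0 \<rho>" "b holomorphic_on ball 0 \<rho>"
    and a0: "a 0 = 0" and \<rho>: "0 < \<rho>"
  shows "\<exists>\<epsilon>>0. (\<lambda>u. f (chart (a u, b u))) holomorphic_on ball 0 \<epsilon>"
proof -
  have cont: "isCont a 0" "isCont b 0"
    using ab \<rho> by (auto intro!: holomorphic_on_imp_continuous_on continuous_on_interior[of "ball 0 \<rho>"])
  have "eventually (\<lambda>q. q \<in> U) (nhds (chart (a 0, b 0)))" using f by (intro eventually_nhds_in_open) (auto simp: a0)
  then have inU: "eventually (\<lambda>u. chart (a u, b u) \<in> U) (nhds 0)" using cont by (rule eventually_along_curve)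
  have main: "\<exists>\<epsilon>>0. (\<lambda>u. f (chart (a u, b u))) holomorphic_on ball 0 \<epsilon>"
    if \<psi>: "\<psi> \<in> proj_charts" and C: "isCont C 0" "C 0 \<noteq> 0"
      and eq: "\<And>u. C u \<noteq> 0 \<Longrightarrow> chart (a u, b u) = \<psi> (vector [\<alpha> u, \<beta> u])"
      and diff: "\<And>u. u \<in> ball 0 \<rho> \<Longrightarrow> C u \<noteq> 0 \<Longrightarrow> \<alpha> field_differentiable (at u) \<and> \<beta> field_differentiable (at u)"
    for \<psi> and C \<alpha> \<beta> :: "complex \<Rightarrow> complex"
  proof -
    have "filterlim C (nhds (C 0)) (nhds 0)"
      using C(1) unfolding isCont_def tendsto_at_iff_tendsto_nhds[of C] .
    then have "eventually (\<lambda>u. C u \<noteq> 0) (nhds 0)" using C(2) by (rule tendsto_imp_eventually_ne)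
    moreover have "eventually (\<lambda>u. u \<in> ball 0 \<rho>) (nhds (0::complex))" using \<rho> by (intro eventually_nhds_in_open) auto
    ultimately have "eventually (\<lambda>u. chart (a u, b u) \<in> U \<and> C u \<noteq> 0 \<and> u \<in> ball 0 \<rho>) (nhds 0)"
      using inU by eventually_elim auto
    then obtain \<epsilon> where \<epsilon>: "0 < \<epsilon>" "\<And>u. dist u 0 < \<epsilon> \<Longrightarrow> chart (a u, b u) \<in> U \<and> C u \<noteq> 0 \<and> u \<in> ball 0 \<rho>"
      unfolding eventually_nhds_metric by blast
    have fd: "(\<lambda>u. (f \<circ> \<psi>) (vector [\<alpha> u, \<beta> u])) field_differentiable (at u)" if "u \<in> ball 0 \<epsilon>" for u
    proof -
      have u: "chart (a u, b u) \<in> U" "C u \<noteq> 0" "u \<in> ball 0 \<rho>" using \<epsilon>(2)[of u] that by (auto simp: dist_commute)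
      then have "vector [\<alpha> u, \<beta> u] \<in> \<psi> -` U" using eq by simp
      then have "complex_differentiable (f \<circ> \<psi>) (vector [\<alpha> u, \<beta> u])"
        using f(1) \<psi> unfolding proj_holomorphic_on_def holomorphic_on_open_iff by blast
      then show ?thesis using diff[OF u(3,2)] complex_differentiable_curve by blast
    qed
    have "(\<lambda>u. (f \<circ> \<psi>) (vector [\<alpha> u, \<beta> u])) holomorphic_on ball 0 \<epsilon>"
      using fd unfolding holomorphic_on_def by (auto intro: field_differentiable_at_within)
    moreover have "(f \<circ> \<psi>) (vector [\<alpha> u, \<beta> u]) = f (chart (a u, b u))" if "u \<in> ball 0 \<epsilon>" for u
      using eq[of u] \<epsilon>(2)[of u] that by (simp add: dist_commute)
    ultimately have "(\<lambda>u. f (chart (a u, b u))) holomorphic_on ball 0 \<epsilon>"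
      by (rule holomorphic_transform)
    then show ?thesis using \<epsilon>(1) by blast
  qed
  have fab: "a field_differentiable (at u)" "b field_differentiable (at u)" if "u \<in> ball 0 \<rho>" for u
    using ab that by (auto intro: holomorphic_on_imp_differentiable_at)
  have scale: "abs_proj_plane (chart_vec z) = abs_proj_plane v" if "v \<noteq> 0" "chart_vec z = k *s v" for z v k
    using abs_proj_plane_eq_iff[OF that(1) chart_vec_neq_0, of z] that(2) by metis
  show ?thesis
  proof (cases "1 + s * b 0 = 0")
    case False
    show ?thesis
    proof (rule main[of "\<lambda>w :: complex^2. abs_proj_plane (vector [1, w $ 1, w $ 2])" "\<lambda>u. 1 + s * b u"
          "\<lambda>u. b u / (1 + s * b u)" "\<lambda>u. a u / (1 + s * b u)"])
      fix u assume nz: "1 + s * b u \<noteq> 0"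
      show "chart (a u, b u) = (\<lambda>w :: complex^2. abs_proj_plane (vector [1, w $ 1, w $ 2]))
          (vector [b u / (1 + s * b u), a u / (1 + s * b u)])"
        unfolding chart_def vector_2
        by (rule scale[OF _ chart_vec_1[OF nz refl]]) (simp add: vec_eq_iff forall_3)
    qed (use False cont fab in \<open>auto simp: proj_charts_def intro!: continuous_intros derivative_intros\<close>)
  next
    case True
    then have "b 0 \<noteq> 0" by auto
    show ?thesis
    proof (rule main[of "\<lambda>w :: complex^2. abs_proj_plane (vector [w $ 1, 1, w $ 2])" b
          "\<lambda>u. (1 + s * b u) / b u" "\<lambda>u. a u / b u"])
      fix u assume nz: "b u \<noteq> 0"
      show "chart (a u, b u) = (\<lambda>w :: complex^2. abs_proj_plane (vector [w $ 1, 1, w $ 2]))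
          (vector [(1 + s * b u) / b u, a u / b u])"
        unfolding chart_def vector_2
        by (rule scale[OF _ chart_vec_2[OF nz refl]]) (simp add: vec_eq_iff forall_3)
    qed (use \<open>b 0 \<noteq> 0\<close> cont fab in \<open>auto simp: proj_charts_def intro!: derivative_intros\<close>)
  qed
qed

end

lemma norm_vec_le_sum: "norm (v :: 'a::real_normed_vector ^ 'n) \<le> (\<Sum>i\<in>UNIV. norm (v $ i))"
  unfolding norm_vec_def by (rule L2_set_le_sum) simp

lemma card_image_cong_kernel:
  assumes "\<And>x y. x \<in> A \<Longrightarrow> y \<in> A \<Longrightarrow> f x = f y \<longleftrightarrow> g x = g y"
  shows "card (f ` A) = card (g ` A)"
proof (rule bij_betw_same_card[of "\<lambda>z. g (inv_into A f z)"])
  have h: "g (inv_into A f (f x)) = g x" if "x \<in> A" for x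
    using assms[OF inv_into_into[of "f x" f A] that] f_inv_into_f[of "f x" f A] that by simp
  show "bij_betw (\<lambda>z. g (inv_into A f z)) (f ` A) (g ` A)"
    unfolding bij_betw_def image_image
  proof
    show "inj_on (\<lambda>z. g (inv_into A f z)) (f ` A)"
      by (rule inj_onI) (elim imageE, simp add: h assms)
    show "(\<lambda>x. g (inv_into A f (f x))) ` A = g ` A" using h by (rule image_cong[OF refl])
  qed
qed

context proj_chart_at_infinity begin

lemma isCont_eval_fps_0:
  fixes H :: "complex fps"
  assumes "0 < \<rho>" "ereal \<rho> \<le> fps_conv_radius H"
  shows "isCont (eval_fps H) 0"
  by (rule continuous_on_interior[OF holomorphic_on_imp_continuous_on[OF eval_fps_holomorphic_ball[OF assms(2)]]])
    (use assms(1) in \<open>simp add: interior_open\<close>)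

lemma isCont_power_0: "isCont (\<lambda>u::complex. u ^ N) 0"
  by (intro isCont_power continuous_ident)

text \<open>A holomorphic germ pulled back to the parameter \<open>u\<close> vanishes identically or has an isolated zero at \<open>0\<close>.\<close>

lemma arc_irreducible:
  assumes N: "0 < N" and \<rho>: "0 < \<rho>" and rad: "ereal \<rho> \<le> fps_conv_radius H"
  defines "p \<equiv> chart (0, fps_nth H 0)"
  shows "irreducible_germ p (germ p (arc N \<rho> H))"
proof -
  define h where "h = eval_fps H"
  define \<gamma> where "\<gamma> u = chart (u ^ N, h u)" for u
  have hol: "h holomorphic_on ball 0 \<rho>" unfolding h_def by (rule eval_fps_holomorphic_ball[OF rad])
  have h0: "h 0 = fps_nth H 0" by (simp add: h_def eval_fps_at_0)
  have p: "p = chart (0 ^ N, h 0)" using N by (simp add: p_def h0 zero_power)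
  have cont: "isCont (\<lambda>u::complex. u ^ N) 0" "isCont h 0"
    using isCont_power_0 isCont_eval_fps_0[OF \<rho> rad] by (simp_all add: h_def)
  have near: "eventually (\<lambda>u. P (\<gamma> u)) (nhds 0)" if "eventually P (nhds p)" for P
    using eventually_along_curve[of P "\<lambda>u. u ^ N" 0 h] cont that by (simp add: \<gamma>_def p)
  have in_arc: "eventually (\<lambda>u. \<gamma> u \<in> arc N \<rho> H) (nhds 0)"
  proof -
    have "eventually (\<lambda>u. u \<in> ball 0 \<rho>) (nhds (0::complex))" using \<rho> by (intro eventually_nhds_in_open) auto
    then show ?thesis by eventually_elim (auto simp: arc_def \<gamma>_def h_def)
  qed
  \<comment> \<open>A point of the arc close to p has small u^N, hence small u; so the germ of the
    arc at p is governed by small parameters alone.\<close>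
  have arc_near: "eventually (\<lambda>q. q \<in> arc N \<rho> H \<longrightarrow> Q q) (nhds p)" if "eventually (\<lambda>u. Q (\<gamma> u)) (nhds 0)" for Q
  proof -
    obtain \<epsilon> where \<epsilon>: "0 < \<epsilon>" "\<And>u. dist u 0 < \<epsilon> \<Longrightarrow> Q (\<gamma> u)"
      using \<open>eventually (\<lambda>u. Q (\<gamma> u)) (nhds 0)\<close> unfolding eventually_nhds_metric by blast
    have "0 < \<epsilon> ^ N" using \<epsilon>(1) by simp
    then have "eventually (\<lambda>q. norm (fst (coord q)) < \<epsilon> ^ N) (nhds p)"
      unfolding p_def by (rule eventually_norm_fst_less)
    then show ?thesis
    proof eventually_elim
      case (elim q)
      show ?case
      proof
        assume "q \<in> arc N \<rho> H"
        then obtain u where u: "q = \<gamma> u" unfolding arc_def \<gamma>_def h_def by blast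
        then have "norm u ^ N < \<epsilon> ^ N" using elim by (simp add: \<gamma>_def norm_power)
        then have "norm u < \<epsilon>" using \<epsilon>(1) by (simp add: power_less_imp_less_base)
        then show "Q q" using \<epsilon>(2)[of u] u by simp
      qed
    qed
  qed
  have dichotomy: "germ p (arc N \<rho> H) \<le> A \<or>
      (\<exists>A'. A = germ p A' \<and> eventually (\<lambda>u. \<gamma> u \<notin> A') (at 0))" if A: "analytic_germ p A" for A
  proof -
    obtain U F where UF: "open U" "p \<in> U" "finite F" "\<forall>f\<in>F. proj_holomorphic_on f U"
      "A = germ p {q \<in> U. \<forall>f\<in>F. f q = 0}" using A unfolding analytic_germ_def by blast
    show ?thesis
    proof (cases "\<forall>f\<in>F. eventually (\<lambda>u. f (\<gamma> u) = 0) (nhds 0)")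
      case True
      have "eventually (\<lambda>u. \<gamma> u \<in> U) (nhds 0)" using UF(1,2) by (intro near eventually_nhds_in_open)
      moreover have "eventually (\<lambda>u. \<forall>f\<in>F. f (\<gamma> u) = 0) (nhds 0)"
        using True UF(3) by (simp add: eventually_ball_finite)
      ultimately have "eventually (\<lambda>u. \<gamma> u \<in> {q \<in> U. \<forall>f\<in>F. f q = 0}) (nhds 0)"
        by eventually_elim simp
      then have "germ p (arc N \<rho> H) \<le> A" unfolding UF(5) germ_le_iff by (rule arc_near)
      then show ?thesis ..
    next
      case False
      then obtain f where f: "f \<in> F" "\<not> eventually (\<lambda>u. f (\<gamma> u) = 0) (nhds 0)" by blast
      obtain \<epsilon> where \<epsilon>: "0 < \<epsilon>" "(\<lambda>u. f (\<gamma> u)) holomorphic_on ball 0 \<epsilon>"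
      proof -
        have "proj_holomorphic_on f U" using UF(4) f(1) by blast
        moreover have "chart (0, h 0) \<in> U" using UF(2) N by (simp add: p zero_power)
        moreover have "(\<lambda>u::complex. u ^ N) holomorphic_on ball 0 \<rho>" by (intro holomorphic_intros)
        moreover have "(0::complex) ^ N = 0" using N by (simp add: zero_power)
        ultimately show thesis
          using holomorphic_along_curve[OF _ UF(1) _ _ hol _ \<rho>, of f "\<lambda>u. u ^ N"] that unfolding \<gamma>_def by blast
      qed
      have "eventually (\<lambda>u. f (\<gamma> u) \<noteq> 0) (at 0)"
      proof (rule ccontr)
        assume "\<not> eventually (\<lambda>u. f (\<gamma> u) \<noteq> 0) (at 0)"
        then have "frequently (\<lambda>u. f (\<gamma> u) = 0) (at 0)" by (simp add: frequently_def)
        moreover have "eventually (\<lambda>u::complex. u \<in> ball 0 \<epsilon>) (at 0)"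
          using \<epsilon>(1) by (intro eventually_at_in_open') auto
        ultimately have "frequently (\<lambda>u. f (\<gamma> u) = 0 \<and> u \<in> ball 0 \<epsilon>) (at 0)"
          by (rule frequently_eventually_frequently)
        then have lim: "0 islimpt ({u. f (\<gamma> u) = 0} \<inter> ball 0 \<epsilon>)"
          by (simp add: islimpt_conv_frequently_at)
        have "f (\<gamma> u) = 0" if "u \<in> ball 0 \<epsilon>" for u
          by (rule analytic_continuation[OF \<epsilon>(2) _ _ _ _ lim])
             (use \<epsilon>(1) that in auto)
        then have "eventually (\<lambda>u. f (\<gamma> u) = 0) (nhds 0)"
          using \<epsilon>(1) eventually_nhds_in_open[of "ball 0 \<epsilon>" "0::complex"] by (auto elim: eventually_mono)
        then show False using f(2) by simp
      qed
      then have "eventually (\<lambda>u. \<gamma> u \<notin> {q \<in> U. \<forall>f\<in>F. f q = 0}) (at 0)"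
        by eventually_elim (use f(1) in auto)
      then show ?thesis using UF(5) by blast
    qed
  qed
  show ?thesis
    unfolding irreducible_germ_def
  proof (intro conjI allI impI)
    show "analytic_germ p (germ p (arc N \<rho> H))" unfolding p_def by (rule arc_analytic[OF N \<rho> rad])
    show "germ p (arc N \<rho> H) \<noteq> bot"
      using eventually_nhds_x_imp_x[OF in_arc] by (intro germ_neq_bot) (use N in \<open>simp add: p \<gamma>_def\<close>)
    fix A B assume AB: "analytic_germ p A" "analytic_germ p B" "germ p (arc N \<rho> H) = sup A B"
    have "germ p (arc N \<rho> H) \<le> A \<or> germ p (arc N \<rho> H) \<le> B"
    proof (rule ccontr)
      assume "\<not> (germ p (arc N \<rho> H) \<le> A \<or> germ p (arc N \<rho> H) \<le> B)"
      then obtain A' B' where A': "A = germ p A'" "eventually (\<lambda>u. \<gamma> u \<notin> A') (at 0)"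
        and B': "B = germ p B'" "eventually (\<lambda>u. \<gamma> u \<notin> B') (at 0)"
        using dichotomy[OF AB(1)] dichotomy[OF AB(2)] by blast
      have "germ p (arc N \<rho> H) \<le> germ p (A' \<union> B')" using AB(3) A'(1) B'(1) by (simp add: germ_Un)
      then have "eventually (\<lambda>u. \<gamma> u \<in> arc N \<rho> H \<longrightarrow> \<gamma> u \<in> A' \<union> B') (nhds 0)"
        unfolding germ_le_iff by (rule near)
      with in_arc have "eventually (\<lambda>u. \<gamma> u \<in> A' \<union> B') (nhds 0)" by eventually_elim blast
      then have "eventually (\<lambda>u. \<gamma> u \<in> A' \<union> B') (at 0)" unfolding eventually_at_filter by eventually_elim blast
      \<comment> \<open>The arc would meet both pieces only at isolated parameters and yet be
        covered by them.\<close>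
      with A'(2) B'(2) have "eventually (\<lambda>u::complex. False) (at 0)" by eventually_elim blast
      then show False by simp
    qed
    then show "germ p (arc N \<rho> H) = A \<or> germ p (arc N \<rho> H) = B"
      using AB(3) by (auto intro: antisym)
  qed
qed

text \<open>For each small u there is a z, which may depend on u, with H(u) = K(z u). So the product
  over all N-th roots of unity of the differences vanishes identically, and as power series form a
  domain, one factor is zero.\<close>

lemma arc_le_imp_act:
  assumes N: "0 < N" and \<rho>: "0 < \<rho>" and rad: "ereal \<rho> \<le> fps_conv_radius H" "ereal \<rho> \<le> fps_conv_radius K"
  defines "p \<equiv> chart (0, fps_nth H 0)"
  assumes le: "germ p (arc N \<rho> H) \<le> germ p (arc N \<rho> K)"
  shows "\<exists>z. z ^ N = 1 \<and> H = fps_act z K"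
proof -
  define \<mu> where "\<mu> = {z :: complex. z ^ N = 1}"
  have \<mu>: "finite \<mu>" using finite_roots_unity[of N] N by (simp add: \<mu>_def)
  note cont = isCont_power_0[of N] isCont_eval_fps_0[OF \<rho> rad(1)]
  have "eventually (\<lambda>q. q \<in> arc N \<rho> H \<longrightarrow> q \<in> arc N \<rho> K) (nhds (chart (0 ^ N, eval_fps H 0)))"
    using le N by (simp add: germ_le_iff p_def eval_fps_at_0 zero_power)
  from eventually_along_curve[OF this cont]
  have "eventually (\<lambda>u. chart (u ^ N, eval_fps H u) \<in> arc N \<rho> H \<longrightarrow> chart (u ^ N, eval_fps H u) \<in> arc N \<rho> K) (nhds 0)" .
  moreover have "eventually (\<lambda>u. u \<in> ball 0 \<rho>) (nhds (0::complex))" using \<rho> by (intro eventually_nhds_in_open) auto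
  ultimately have ev: "eventually (\<lambda>u. (\<Prod>z\<in>\<mu>. eval_fps H u - eval_fps (fps_act z K) u) = 0) (nhds 0)"
  proof eventually_elim
    case (elim u)
    then have "chart (u ^ N, eval_fps H u) \<in> arc N \<rho> K" unfolding arc_def by auto
    then obtain x where "chart (u ^ N, eval_fps H u) = chart (x ^ N, eval_fps K x)" unfolding arc_def by blast
    then have x: "u ^ N = x ^ N" "eval_fps H u = eval_fps K x" by (metis coord_chart prod.inject)+
    have "\<exists>z\<in>\<mu>. x = z * u"
    proof (cases "u = 0")
      case True
      then have "x = 0" using x(1) N by (metis power_eq_0_iff)
      then show ?thesis using True by (auto simp: \<mu>_def intro!: exI[of _ 1])
    next
      case False
      then show ?thesis using x(1) by (intro bexI[of _ "x / u"]) (simp_all add: \<mu>_def power_divide flip: x(1))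
    qed
    then obtain z where "z \<in> \<mu>" "x = z * u" by blast
    then show ?case using x(2) \<mu> by (auto simp: eval_fps_act intro!: prod_zero bexI[of _ z])
  qed
  have pos: "0 < ereal \<rho>" using \<rho> by simp
  have "(\<lambda>u. \<Prod>z\<in>\<mu>. eval_fps H u - eval_fps (fps_act z K) u) has_fps_expansion (\<Prod>z\<in>\<mu>. H - fps_act z K)"
  proof (intro has_fps_expansion_prod has_fps_expansion_diff eval_fps_has_fps_expansion)
    show "0 < fps_conv_radius H" using pos rad(1) by (rule less_le_trans)
    fix z assume "z \<in> \<mu>"
    then show "0 < fps_conv_radius (fps_act z K)"
      using less_le_trans[OF pos rad(2)] fps_conv_radius_act[of z N K] N by (simp add: \<mu>_def)
  qed
  moreover have "(\<lambda>u. \<Prod>z\<in>\<mu>. eval_fps H u - eval_fps (fps_act z K) u) has_fps_expansion 0"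
    using ev by (simp add: has_fps_expansion_0_iff)
  ultimately have "(\<Prod>z\<in>\<mu>. H - fps_act z K) = 0" by (rule fps_expansion_unique_complex)
  then show ?thesis using \<mu> by (auto simp: \<mu>_def)
qed

end

text \<open>A root of \<open>R - a\<close> of order \<open>k\<close> is a root of \<open>R'\<close> of order \<open>k - 1\<close>; all roots are counted with these orders.\<close>

lemma card_critical_values_le:
  fixes R :: "complex poly"
  assumes R: "0 < degree R"
  shows "card (poly R ` {s. poly (pderiv R) s = 0} - {a}) + 1 \<le> card {s. poly R s = a}"
    and "a \<notin> poly R ` {s. poly (pderiv R) s = 0} \<Longrightarrow> card {s. poly R s = a} = degree R"
    and "finite {s. poly (pderiv R) s = 0}" "card (poly R ` {s. poly (pderiv R) s = 0}) + 1 \<le> degree R"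
proof -
  define C where "C = {s. poly (pderiv R) s = 0}"
  define Z where "Z = {s. poly R s = a}"
  have nz: "pderiv R \<noteq> 0" using R by (simp add: pderiv_eq_0_iff)
  show fin: "finite {s. poly (pderiv R) s = 0}" by (rule poly_roots_finite[OF nz])
  then have finC: "finite C" by (simp add: C_def)
  have q: "R - [:a:] \<noteq> 0" using R by auto
  have Z: "Z = {s. poly (R - [:a:]) s = 0}" by (simp add: Z_def)
  have finZ: "finite Z" unfolding Z by (rule poly_roots_finite[OF q])
  have dq: "degree (R - [:a:]) = degree R" using R degree_add_eq_left[of "- [:a:]" R] unfolding diff_conv_add_uminus by simp
  have pq: "pderiv (R - [:a:]) = pderiv R" by (simp add: pderiv_diff pderiv_pCons)
  have "degree R = (\<Sum>s\<in>Z. order s (R - [:a:]))"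
    using size_proots_complex[of "R - [:a:]"] q by (simp add: size_multiset_overloaded_eq dq Z)
  also have "\<dots> = (\<Sum>s\<in>Z. 1 + order s (pderiv R))"
    using order_pderiv[OF q] by (intro sum.cong) (auto simp: Z pq)
  also have "\<dots> = card Z + (\<Sum>s\<in>Z. order s (pderiv R))" by (simp only: sum.distrib card_eq_sum)
  finally have dR: "degree R = card Z + (\<Sum>s\<in>Z. order s (pderiv R))" .
  have ord: "1 \<le> order s (pderiv R)" if "s \<in> C" for s
    using that nz order_root[of "pderiv R" s] by (simp add: C_def Suc_leI)
  have "(\<Sum>s\<in>Z. order s (pderiv R)) = (\<Sum>s\<in>Z \<inter> C. order s (pderiv R))"
    using finZ order_root[of "pderiv R"] by (intro sum.mono_neutral_right) (auto simp: C_def)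
  moreover have "card (C - Z) \<le> (\<Sum>s\<in>C - Z. order s (pderiv R))"
    using ord unfolding card_eq_sum by (intro sum_mono) auto
  moreover have "(\<Sum>s\<in>Z \<inter> C. order s (pderiv R)) + (\<Sum>s\<in>C - Z. order s (pderiv R)) = (\<Sum>s\<in>C. order s (pderiv R))"
    using sum.Int_Diff[OF finC, of "\<lambda>s. order s (pderiv R)" Z] by (simp add: Int_commute)
  moreover have "(\<Sum>s\<in>C. order s (pderiv R)) \<le> degree R - 1"
    using sum_order_le_degree[OF nz] by (simp add: C_def degree_pderiv)
  \<comment> \<open>R' has degree deg R - 1, and its roots on \<open>Z\<close> already account for
    deg R - card Z of this; the critical points off \<open>Z\<close> share what is left.\<close>
  ultimately have le: "card (C - Z) + degree R \<le> card Z + (degree R - 1)" using dR by linarith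
  have "card (poly R ` C - {a}) \<le> card (poly R ` (C - Z))"
    using finC by (intro card_mono) (auto simp: Z_def)
  also have "\<dots> \<le> card (C - Z)" using finC by (intro card_image_le) auto
  finally show "card (poly R ` {s. poly (pderiv R) s = 0} - {a}) + 1 \<le> card {s. poly R s = a}"
    using le R by (simp add: C_def Z_def)
  show "card {s. poly R s = a} = degree R" if "a \<notin> poly R ` {s. poly (pderiv R) s = 0}"
  proof -
    have "order s (pderiv R) = 0" if "s \<in> Z" for s
      using that \<open>a \<notin> _\<close> order_0I[of "pderiv R" s] by (auto simp: Z_def)
    then show ?thesis using dR by (simp add: Z_def)
  qed
  have "card (poly R ` C) \<le> card C" by (rule card_image_le[OF finC])
  also have "\<dots> \<le> degree (pderiv R)" using card_poly_roots_bound[OF nz] by (simp add: C_def)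
  finally show "card (poly R ` {s. poly (pderiv R) s = 0}) + 1 \<le> degree R"
    using R by (simp add: C_def degree_pderiv)
qed

subsection \<open>Branches of the fibres at infinity\<close>

text \<open>\<open>E(w, y) = w\<^sup>d f((1 + s y)/w, y/w)\<close>, where \<open>s\<close> is such that \<open>[s : 1 : 0]\<close> is not a zero of the top-degree
  part of \<open>f\<close>; the value of this part there is \<open>lc\<close>. Recall that \<open>0 ^ 0 = 1\<close>.\<close>

locale sheared_polynomial = monic_in_y E lc d + proj_chart_at_infinity s
  for E :: "complex poly poly" and lc :: complex and d :: nat and s :: complex +
  fixes f :: "complex^2 \<Rightarrow> complex" and c :: "nat \<Rightarrow> nat \<Rightarrow> complex"
  assumes f_eq: "\<And>p. f p = (\<Sum>(i, j) \<in> {(i, j). i + j \<le> d}. c i j * (p $ 1) ^ i * (p $ 2) ^ j)"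
    and E_eq: "\<And>w y. poly (eval_inner w E) y =
      (\<Sum>(i, j) \<in> {(i, j). i + j \<le> d}. c i j * (1 + s * y) ^ i * y ^ j * w ^ (d - i - j))"
    and lc_eq: "lc = (\<Sum>(i, j) \<in> {(i, j). i + j \<le> d}. c i j * s ^ i * 0 ^ (d - i - j))"
begin

text \<open>The homogenisation of f, of degree d.\<close>

definition hom :: "complex^3 \<Rightarrow> complex" where
  "hom v = (\<Sum>(i, j) \<in> {(i, j). i + j \<le> d}. c i j * (v $ 1) ^ i * (v $ 2) ^ j * (v $ 3) ^ (d - i - j))"

definition curve :: "complex \<Rightarrow> proj_plane set" where
  "curve a = {q. hom (rep_proj_plane q) = a * (rep_proj_plane q $ 3) ^ d}"

lemma hom_scale: "hom (k *s v) = k ^ d * hom v"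
proof -
  have "(k *s v) $ 1 ^ i * (k *s v) $ 2 ^ j * (k *s v) $ 3 ^ (d - i - j) =
      k ^ d * (v $ 1 ^ i * v $ 2 ^ j * v $ 3 ^ (d - i - j))" if "i + j \<le> d" for i j
  proof -
    have "k ^ d = k ^ i * k ^ j * k ^ (d - i - j)" using that by (simp flip: power_add)
    then show ?thesis by (simp add: power_mult_distrib mult_ac)
  qed
  then show ?thesis
    unfolding hom_def sum_distrib_left by (intro sum.cong) (auto simp: mult.assoc mult.left_commute)
qed

lemma abs_in_curve:
  assumes "v \<noteq> 0"
  shows "abs_proj_plane v \<in> curve a \<longleftrightarrow> hom v = a * (v $ 3) ^ d"
  using assms by (rule rep_abs_proj_plane) (simp add: curve_def hom_scale power_mult_distrib)

lemma chart_in_curve: "chart z \<in> curve a \<longleftrightarrow> poly (eval_inner (fst z) E) (snd z) = a * fst z ^ d"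
  unfolding chart_def abs_in_curve[OF chart_vec_neq_0] by (simp add: hom_def chart_vec_def E_eq)

lemma affine_vec_neq_0: "vector [x, y, 1] \<noteq> (0 :: complex^3)"
  by (simp add: vec_eq_iff forall_3)

lemma affine_in_curve: "affine_embedding p \<in> curve a \<longleftrightarrow> f p = a"
  unfolding affine_embedding_def abs_in_curve[OF affine_vec_neq_0] by (simp add: hom_def f_eq)

lemma closed_curve: "closed (curve a)"
proof -
  have "{v. v \<noteq> 0 \<and> abs_proj_plane v \<in> - curve a} = {v. v \<noteq> 0 \<and> hom v \<noteq> a * (v $ 3) ^ d}"
    by (auto simp: abs_in_curve)
  also have "\<dots> = {v. v \<noteq> 0} \<inter> {v. hom v \<noteq> a * (v $ 3) ^ d}" by auto
  also have "open \<dots>"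
    unfolding hom_def by (intro open_Int open_Collect_neq continuous_intros) (auto intro!: continuous_intros simp: case_prod_unfold)
  finally show ?thesis by (simp add: closed_def open_proj_plane_iff)
qed

lemma proj_closure_subset: "proj_closure (f -` {a}) \<subseteq> curve a"
  unfolding proj_closure_def by (rule closure_minimal[OF _ closed_curve]) (auto simp: affine_in_curve)

lemma line_at_infinity_iff: "q \<in> line_at_infinity \<longleftrightarrow> rep_proj_plane q $ 3 = 0"
proof -
  have "rep_proj_plane (affine_embedding p) $ 3 \<noteq> 0" for p
    unfolding affine_embedding_def by (rule rep_abs_proj_plane[OF affine_vec_neq_0[of "p $ 1" "p $ 2"]]) simp
  moreover have "q \<in> range affine_embedding" if nz: "rep_proj_plane q $ 3 \<noteq> 0"
  proof -
    define v where "v = rep_proj_plane q"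
    define p :: "complex^2" where "p = vector [v $ 1 / v $ 3, v $ 2 / v $ 3]"
    have "v = v $ 3 *s vector [p $ 1, p $ 2, 1]"
      using nz by (simp add: vec_eq_iff forall_3 p_def flip: v_def)
    then have "abs_proj_plane (vector [p $ 1, p $ 2, 1]) = abs_proj_plane v"
      using iffD2[OF abs_proj_plane_eq_iff[OF affine_vec_neq_0], OF _ exI] rep_proj_plane_neq_0[of q]
      unfolding v_def by blast
    then have "q = affine_embedding p" by (simp add: affine_embedding_def v_def)
    then show ?thesis by simp
  qed
  ultimately show ?thesis unfolding line_at_infinity_def by auto
qed

lemma chart_at_infinity: "chart z \<in> line_at_infinity \<longleftrightarrow> fst z = 0"
  unfolding line_at_infinity_iff chart_def
  by (rule rep_abs_proj_plane[OF chart_vec_neq_0[of z]]) (simp add: chart_vec_def)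

text \<open>The only point at infinity outside the chart is [s : 1 : 0], where \<open>hom\<close>
  takes the nonzero value \<open>lc\<close>.\<close>

lemma curve_at_infinity_in_domain:
  assumes "q \<in> curve a" "q \<in> line_at_infinity"
  shows "q \<in> domain"
proof (rule ccontr)
  define v where "v = rep_proj_plane q"
  assume "q \<notin> domain"
  then have v1: "v $ 1 = s * v $ 2" by (simp add: domain_def den_def v_def)
  have v3: "v $ 3 = 0" using assms(2) by (simp add: line_at_infinity_iff v_def)
  have "v = v $ 2 *s vector [s, 1, 0]" using v1 v3 by (simp add: vec_eq_iff forall_3)
  then have "hom v = (v $ 2) ^ d * hom (vector [s, 1, 0])" by (metis hom_scale)
  also have "hom (vector [s, 1, 0]) = lc" by (simp add: hom_def lc_eq)
  finally have "(v $ 2) ^ d * lc = 0" using assms(1) v3 E_degree(2) by (simp add: curve_def v_def)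
  then have "v $ 2 = 0" using lc_nonzero by simp
  then have "v = 0" using v1 v3 by (simp add: vec_eq_iff forall_3)
  then show False using rep_proj_plane_neq_0 by (simp add: v_def)
qed

lemma chart_affine:
  assumes "w \<noteq> 0"
  shows "chart (w, y) = affine_embedding (vector [(1 + s * y) / w, y / w])"
proof -
  have "chart_vec (w, y) = w *s vector [(1 + s * y) / w, y / w, 1]"
    using assms by (simp add: vec_eq_iff forall_3 chart_vec_def)
  then have "abs_proj_plane (vector [(1 + s * y) / w, y / w, 1]) = abs_proj_plane (chart_vec (w, y))"
    using abs_proj_plane_eq_iff[OF affine_vec_neq_0 chart_vec_neq_0] by blast
  then show ?thesis by (simp add: chart_def affine_embedding_def)
qed

text \<open>A point of the curve at infinity starts a series H of the fibre, and the points of this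
  arc with u different from 0 are affine points of the fibre that converge to it.\<close>

lemma curve_in_proj_closure:
  assumes "chart (w, y) \<in> curve a"
  shows "chart (w, y) \<in> proj_closure (f -` {a})"
proof (cases "w = 0")
  case False
  then have "f (vector [(1 + s * y) / w, y / w]) = a" using assms by (simp add: chart_affine affine_in_curve)
  then show ?thesis
    unfolding proj_closure_def chart_affine[OF False] by (intro subsetD[OF closure_subset] imageI) simp
next
  case True
  obtain \<rho> where \<rho>: "0 < \<rho>" "\<And>H. H \<in> fibre a \<Longrightarrow> ereal \<rho> \<le> fps_conv_radius H"
    "\<And>u y. norm u < \<rho> \<Longrightarrow> poly (eval_inner (u ^ N) E) y = a * u ^ (N * d) \<longleftrightarrow> (\<exists>H\<in>fibre a. y = eval_fps H u)"
    by (rule fibre_convergent[of a]) (rule that; assumption)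
  have "poly (eval_inner (0 ^ N) E) y = a * 0 ^ (N * d)"
    using assms True E_degree(2) by (simp add: chart_in_curve zero_power)
  then obtain H where H: "H \<in> fibre a" "y = eval_fps H 0" using \<rho>(3)[of 0 y] \<rho>(1) by auto
  note cont = isCont_power_0[of N] isCont_eval_fps_0[OF \<rho>(1) \<rho>(2)[OF H(1)]]
  have affine: "chart (u ^ N, eval_fps H u) \<in> affine_embedding ` (f -` {a})" if u: "norm u < \<rho>" "u \<noteq> 0" for u
  proof -
    have "chart (u ^ N, eval_fps H u) \<in> curve a"
      using \<rho>(3)[OF u(1), of "eval_fps H u"] H(1) by (auto simp: chart_in_curve power_mult)
    then show ?thesis using u(2) by (auto simp: chart_affine affine_in_curve)
  qed
  show ?thesis
  proof (rule ccontr)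
    define Z where "Z = proj_closure (f -` {a})"
    assume "chart (w, y) \<notin> proj_closure (f -` {a})"
    then have "chart (0 ^ N, eval_fps H 0) \<in> - Z" using True H(2) by (simp add: Z_def zero_power)
    moreover have "open (- Z)" unfolding Z_def proj_closure_def by (intro open_Compl closed_closure)
    ultimately have "eventually (\<lambda>q. q \<in> - Z) (nhds (chart (0 ^ N, eval_fps H 0)))"
      by (intro eventually_nhds_in_open)
    from eventually_along_curve[OF this cont]
    have "eventually (\<lambda>u. chart (u ^ N, eval_fps H u) \<in> - Z) (at 0)"
      unfolding eventually_at_filter by eventually_elim blast
    moreover have "eventually (\<lambda>u::complex. u \<in> ball 0 \<rho> - {0}) (at 0)"
      using \<rho>(1) by (intro eventually_at_in_open) auto
    ultimately have "eventually (\<lambda>u::complex. False) (at 0)"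
    proof eventually_elim
      case (elim u)
      have "affine_embedding ` (f -` {a}) \<subseteq> Z" unfolding Z_def proj_closure_def by (rule closure_subset)
      then have "chart (u ^ N, eval_fps H u) \<in> Z" using affine[of u] elim(2) by auto
      then show ?case using elim(1) by blast
    qed
    then show False by simp
  qed
qed

lemma chart_in_proj_closure: "chart z \<in> proj_closure (f -` {a}) \<longleftrightarrow> chart z \<in> curve a"
  using proj_closure_subset curve_in_proj_closure by (metis prod.collapse subsetD)

lemma fibre_at_infinity_eq: "fibre_at_infinity f a = (\<lambda>H. chart (0, fps_nth H 0)) ` fibre a"
proof -
  obtain \<rho> where \<rho>: "0 < \<rho>"
    "\<And>u y. norm u < \<rho> \<Longrightarrow> poly (eval_inner (u ^ N) E) y = a * u ^ (N * d) \<longleftrightarrow> (\<exists>H\<in>fibre a. y = eval_fps H u)"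
    by (rule fibre_convergent[of a]) (rule that; assumption)
  have root: "chart (0, y) \<in> curve a \<longleftrightarrow> (\<exists>H\<in>fibre a. y = fps_nth H 0)" for y
    using \<rho>(2)[of 0 y] \<rho>(1) E_degree(2) by (simp add: chart_in_curve zero_power eval_fps_at_0)
  show ?thesis
  proof (intro subset_antisym subsetI)
    fix q assume "q \<in> fibre_at_infinity f a"
    then have q: "q \<in> curve a" "q \<in> line_at_infinity" unfolding fibre_at_infinity_def using proj_closure_subset by auto
    then have eq: "q = chart (coord q)" using chart_coord curve_at_infinity_in_domain by metis
    then have "fst (coord q) = 0" using q(2) chart_at_infinity by metis
    then have eq': "q = chart (0, snd (coord q))" using eq by (metis prod.collapse)
    then obtain H where H: "H \<in> fibre a" "snd (coord q) = fps_nth H 0" using root q(1) by metis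
    show "q \<in> (\<lambda>H. chart (0, fps_nth H 0)) ` fibre a"
      using eq' unfolding H(2) using H(1) by (rule image_eqI)
  next
    fix q assume "q \<in> (\<lambda>H. chart (0, fps_nth H 0)) ` fibre a"
    then show "q \<in> fibre_at_infinity f a"
      unfolding fibre_at_infinity_def using root by (auto simp: chart_in_proj_closure chart_at_infinity)
  qed
qed

text \<open>Near a point p at infinity the closure of the fibre is the union of the arcs of those
  series that start at p. Each arc is irreducible, and by \<open>arc_le_imp_act\<close> comparable
  arcs are conjugate, so the branches at p are the orbits of these series.\<close>

lemma nu_eq_orbit_count: "nu f a = orbit_count a"
proof -
  obtain \<rho> where \<rho>: "0 < \<rho>" "\<And>H. H \<in> fibre a \<Longrightarrow> ereal \<rho> \<le> fps_conv_radius H"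
    "\<And>u y. norm u < \<rho> \<Longrightarrow> poly (eval_inner (u ^ N) E) y = a * u ^ (N * d) \<longleftrightarrow> (\<exists>H\<in>fibre a. y = eval_fps H u)"
    by (rule fibre_convergent[of a]) (rule that; assumption)
  define X where "X = proj_closure (f -` {a})"
  define pt where "pt H = chart (0, fps_nth H 0)" for H :: "complex fps"
  define G where "G H = germ (pt H) (arc N \<rho> H)" for H
  have pt_eq: "pt H = pt K \<longleftrightarrow> fps_nth H 0 = fps_nth K 0" for H K
    unfolding pt_def by (metis coord_chart prod.inject)
  have act: "pt (fps_act z H) = pt H" "G (fps_act z H) = G H" if "z ^ N = 1" for z H
  proof -
    show 1: "pt (fps_act z H) = pt H" by (simp add: pt_def)
    show "G (fps_act z H) = G H" unfolding G_def 1 using arc_act[OF N_pos that, of \<rho> H] by simp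
  qed
  have eqI: "orbit H = orbit K" if HK: "H \<in> fibre a" "K \<in> fibre a" "pt H = pt K" "G H \<le> G K" for H K
  proof -
    have "germ (chart (0, fps_nth H 0)) (arc N \<rho> H) \<le> germ (chart (0, fps_nth H 0)) (arc N \<rho> K)"
      using HK(3,4) unfolding G_def pt_def by (simp only:)
    then have "\<exists>z. z ^ N = 1 \<and> H = fps_act z K"
      by (rule arc_le_imp_act[OF N_pos \<rho>(1) \<rho>(2)[OF HK(1)] \<rho>(2)[OF HK(2)]])
    then show ?thesis using orbit_eq_iff by metis
  qed
  have G_eq: "G H = G K" if "orbit H = orbit K" for H K using that act(2) by (auto simp: orbit_eq_iff)
  have pt_orbit: "pt H = pt K" if "orbit H = orbit K" for H K using that act(1) by (auto simp: orbit_eq_iff)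
  have branches: "branches_at X p = G ` {H \<in> fibre a. pt H = p}" if p: "p \<in> pt ` fibre a" for p
  proof -
    have "branches_at X p = (\<lambda>H. germ p (arc N \<rho> H)) ` {H \<in> fibre a. pt H = p}"
    proof (rule branches_at_Union)
      show "finite {H \<in> fibre a. pt H = p}" using finite_fibre by simp
      show "irreducible_germ p (germ p (arc N \<rho> H))" if "H \<in> {H \<in> fibre a. pt H = p}" for H
      proof -
        have H: "H \<in> fibre a" "p = chart (0, fps_nth H 0)" using that by (auto simp: pt_def)
        show ?thesis unfolding H(2) by (rule arc_irreducible[OF N_pos \<rho>(1) \<rho>(2)[OF H(1)]])
      qed
      show "germ p (arc N \<rho> H) = germ p (arc N \<rho> K)"
        if "H \<in> {H \<in> fibre a. pt H = p}" "K \<in> {H \<in> fibre a. pt H = p}" "germ p (arc N \<rho> H) \<le> germ p (arc N \<rho> K)" for H K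
      proof -
        have HK: "H \<in> fibre a" "K \<in> fibre a" "pt H = p" "pt K = p" using that(1,2) by auto
        then have "G H \<le> G K" using that(3) by (simp add: G_def)
        then have "G H = G K" using G_eq[OF eqI] HK by simp
        then show ?thesis using HK by (simp add: G_def)
      qed
      show "germ p X = germ p (\<Union>H\<in>{H \<in> fibre a. pt H = p}. arc N \<rho> H)"
      proof (rule germ_eqI)
        obtain H0 where p0: "p = chart (0, fps_nth H0 0)" using p unfolding pt_def by blast
        have small: "eventually (\<lambda>q. norm (fst (coord q)) < \<rho> ^ N) (nhds p)"
          unfolding p0 using \<rho>(1) by (intro eventually_norm_fst_less) simp
        have dom: "eventually (\<lambda>q. q \<in> domain) (nhds p)" unfolding p0 eventually_nhds_chart by simp
        \<comment> \<open>Points near p have y close to \<open>y0\<close> and small u, and for small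
          u the value H(u) stays close to H(0), which differs from \<open>y0\<close>.\<close>
        have away: "eventually (\<lambda>q. q \<notin> arc N \<rho> H) (nhds p)" if H: "H \<in> fibre a" "pt H \<noteq> p" for H
        proof -
          define y0 where "y0 = fps_nth H0 0"
          define \<eta> where "\<eta> = dist (eval_fps H 0) y0 / 2"
          have "eval_fps H 0 \<noteq> y0" using H(2) p0 by (auto simp: pt_def y0_def eval_fps_at_0)
          then have \<eta>: "0 < \<eta>" by (simp add: \<eta>_def)
          have "isCont (eval_fps H) 0" by (rule isCont_eval_fps_0[OF \<rho>(1) \<rho>(2)[OF H(1)]])
          then obtain \<delta> where \<delta>: "0 < \<delta>" "\<And>u. dist u 0 < \<delta> \<Longrightarrow> dist (eval_fps H u) (eval_fps H 0) < \<eta>"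
            using \<eta> unfolding continuous_at_eps_delta by blast
          have "eventually (\<lambda>z. dist (snd z) y0 < \<eta>) (nhds (0 :: complex, y0))"
          proof -
            have "open {z :: complex \<times> complex. dist (snd z) y0 < \<eta>}" by (intro open_Collect_less continuous_intros)
            from eventually_nhds_in_open[OF this, of "(0, y0)"] \<eta> show ?thesis by simp
          qed
          then have 1: "eventually (\<lambda>q. dist (snd (coord q)) y0 < \<eta>) (nhds p)"
            unfolding p0 eventually_nhds_chart coord_chart y0_def .
          have 2: "eventually (\<lambda>q. norm (fst (coord q)) < \<delta> ^ N) (nhds p)"
            unfolding p0 using \<delta>(1) by (intro eventually_norm_fst_less) simp
          from 1 2 show ?thesis
          proof eventually_elim
            case (elim q)
            show ?case
            proof
              assume "q \<in> arc N \<rho> H"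
              then obtain u where u: "q = chart (u ^ N, eval_fps H u)" unfolding arc_def by blast
              then have "norm u ^ N < \<delta> ^ N" using elim(2) by (simp add: norm_power)
              then have "norm u < \<delta>" using \<delta>(1) by (simp add: power_less_imp_less_base)
              then have "dist (eval_fps H u) (eval_fps H 0) < \<eta>" using \<delta>(2)[of u] by simp
              moreover have "dist (eval_fps H u) y0 < \<eta>" using elim(1) u by simp
              ultimately show False
                using dist_triangle_less_add[of "eval_fps H 0" "eval_fps H u" \<eta> y0 \<eta>] by (simp add: \<eta>_def dist_commute)
            qed
          qed
        qed
        have "eventually (\<lambda>q. \<forall>H\<in>{H \<in> fibre a. pt H \<noteq> p}. q \<notin> arc N \<rho> H) (nhds p)"
          using finite_fibre away by (intro eventually_ball_finite) auto
        then show "eventually (\<lambda>q. q \<in> X \<longleftrightarrow> q \<in> (\<Union>H\<in>{H \<in> fibre a. pt H = p}. arc N \<rho> H)) (nhds p)"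
          using small dom
        proof eventually_elim
          case (elim q)
          have q: "q = chart (coord q)" using chart_coord[OF elim(3)] by simp
          obtain u where u: "u ^ N = fst (coord q)" "norm u < \<rho>"
            using nth_root_in_disc[OF elim(2) N_pos \<rho>(1)] by blast
          have "q \<in> X \<longleftrightarrow> chart (coord q) \<in> curve a" using chart_in_proj_closure[of "coord q" a] q by (simp add: X_def)
          also have "\<dots> \<longleftrightarrow> (\<exists>H\<in>fibre a. snd (coord q) = eval_fps H u)"
            using \<rho>(3)[OF u(2), of "snd (coord q)"] by (simp add: chart_in_curve power_mult u(1))
          also have "\<dots> \<longleftrightarrow> (\<exists>H\<in>fibre a. q \<in> arc N \<rho> H)"
          proof
            assume "\<exists>H\<in>fibre a. snd (coord q) = eval_fps H u"
            then obtain H where H: "H \<in> fibre a" "snd (coord q) = eval_fps H u" by blast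
            then have "q = chart (u ^ N, eval_fps H u)" using q u(1) by (metis prod.collapse)
            then show "\<exists>H\<in>fibre a. q \<in> arc N \<rho> H" using H(1) u(2) unfolding arc_def by blast
          next
            assume "\<exists>H\<in>fibre a. q \<in> arc N \<rho> H"
            then obtain H x where x: "H \<in> fibre a" "norm x < \<rho>" "q = chart (x ^ N, eval_fps H x)"
              unfolding arc_def by blast
            then have "poly (eval_inner (x ^ N) E) (snd (coord q)) = a * x ^ (N * d)" using \<rho>(3)[OF x(2)] by auto
            moreover have "x ^ N = u ^ N" using x(3) u(1) by simp
            ultimately have "poly (eval_inner (u ^ N) E) (snd (coord q)) = a * u ^ (N * d)" by (simp add: power_mult)
            then show "\<exists>H\<in>fibre a. snd (coord q) = eval_fps H u" using \<rho>(3)[OF u(2)] by blast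
          qed
          also have "\<dots> \<longleftrightarrow> q \<in> (\<Union>H\<in>{H \<in> fibre a. pt H = p}. arc N \<rho> H)" using elim(1) by blast
          finally show ?case .
        qed
      qed
    qed
    also have "\<dots> = G ` {H \<in> fibre a. pt H = p}" unfolding G_def by (intro image_cong) auto
    finally show ?thesis .
  qed
  \<comment> \<open>Each germ is paired with its point because \<open>nu\<close> is a sum over
    points.\<close>
  have "orbit H = orbit K \<longleftrightarrow> (pt H, G H) = (pt K, G K)" if "H \<in> fibre a" "K \<in> fibre a" for H K
    using eqI[OF that] pt_orbit[of H K] G_eq[of H K] by (metis order_refl prod.inject)
  then have "orbit_count a = card ((\<lambda>H. (pt H, G H)) ` fibre a)"
    unfolding orbit_count_def by (rule card_image_cong_kernel)
  also have "(\<lambda>H. (pt H, G H)) ` fibre a = Sigma (pt ` fibre a) (branches_at X)"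
  proof (intro subset_antisym subsetI)
    fix x assume "x \<in> (\<lambda>H. (pt H, G H)) ` fibre a"
    then obtain H where H: "H \<in> fibre a" "x = (pt H, G H)" by blast
    have "G H \<in> branches_at X (pt H)" unfolding branches[OF imageI[OF H(1)]] using H(1) by blast
    then show "x \<in> Sigma (pt ` fibre a) (branches_at X)" using H by blast
  next
    fix x assume "x \<in> Sigma (pt ` fibre a) (branches_at X)"
    then obtain p B where x: "x = (p, B)" "p \<in> pt ` fibre a" "B \<in> branches_at X p" by blast
    then obtain H where "H \<in> fibre a" "pt H = p" "B = G H" unfolding branches[OF x(2)] by blast
    then show "x \<in> (\<lambda>H. (pt H, G H)) ` fibre a" using x(1) by blast
  qed
  also have "card \<dots> = (\<Sum>p\<in>pt ` fibre a. card (branches_at X p))"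
  proof (rule card_SigmaI)
    show "\<forall>p\<in>pt ` fibre a. finite (branches_at X p)"
    proof
      fix p assume "p \<in> pt ` fibre a"
      then show "finite (branches_at X p)" unfolding branches[OF \<open>p \<in> pt ` fibre a\<close>] using finite_fibre by simp
    qed
    show "finite (pt ` fibre a)" using finite_fibre by (rule finite_imageI)
  qed
  also have "\<dots> = nu f a"
    unfolding nu_def fibre_at_infinity_eq X_def pt_def ..
  finally show ?thesis ..
qed

lemma card_fibre_at_infinity:
  "card (fibre_at_infinity f a) = card ((\<lambda>H. fps_nth H 0) ` fibre a)"
proof -
  have "inj_on (\<lambda>y. chart (0, y)) A" for A by (rule inj_onI) (metis coord_chart prod.inject)
  then have "card ((\<lambda>y. chart (0, y)) ` (\<lambda>H. fps_nth H 0) ` fibre a) = card ((\<lambda>H. fps_nth H 0) ` fibre a)"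
    by (rule card_image)
  then show ?thesis by (simp add: fibre_at_infinity_eq image_image)
qed

text \<open>As d > 0, the term a w^d vanishes on w = 0; so the points at infinity are the same for
  all a, and \<open>points_at_infinity_count\<close> is well defined.\<close>

lemma constant_terms_fibre: "(\<lambda>H. fps_nth H 0) ` fibre a = {y. poly (eval_inner 0 E) y = 0}"
proof -
  obtain \<rho> where \<rho>: "0 < \<rho>"
    "\<And>u y. norm u < \<rho> \<Longrightarrow> poly (eval_inner (u ^ N) E) y = a * u ^ (N * d) \<longleftrightarrow> (\<exists>H\<in>fibre a. y = eval_fps H u)"
    by (rule fibre_convergent[of a]) (rule that; assumption)
  then show ?thesis using \<rho>(2)[of 0] E_degree(2) by (auto simp: zero_power eval_fps_at_0)
qed

lemma points_at_infinity_count_eq: "points_at_infinity_count f = card ((\<lambda>H. fps_nth H 0) ` fibre a)"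
  unfolding points_at_infinity_count_def
  by (rule the_equality) (simp_all only: card_fibre_at_infinity constant_terms_fibre simp_thms)

subsection \<open>Regular values at infinity\<close>

definition special_values :: "complex set" where
  "special_values = (\<Union>D\<in>base_dicriticals. poly (branch_poly D) ` {s. poly (pderiv (branch_poly D)) s = 0} \<union>
    (if 2 \<le> ramification D then {poly (branch_poly D) 0} else {}))"

lemma eval_along_series_expansion:
  assumes "h has_fps_expansion F"
  shows "(\<lambda>u. poly (eval_inner (u ^ N) G) (h u)) has_fps_expansion poly (series_poly N G) F"
proof (induction G)
  case 0
  then show ?case by (simp add: series_poly_def)
next
  case (pCons q G)
  then show ?case
    using has_fps_expansion_add[OF series_of_expansion[of q N] has_fps_expansion_mult[OF assms pCons.IH]]
    by (simp add: series_poly_def map_poly_pCons)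
qed

text \<open>Let n be the order of \<open>W\<close> along F, but at most \<open>N * d\<close>. If n
  is smaller, f tends to infinity along the polar; otherwise it has a limit, which is special and so
  differs from \<open>a0\<close>. In both cases the difference from a u^(Nd), divided by u^n, has a
  nonzero limit as (u, a) tends to (0, a0).\<close>

lemma polar_avoids_value:
  assumes a0: "a0 \<notin> special_values" and F: "poly (pderiv W) F = 0" and conv: "0 < fps_conv_radius F"
  shows "eventually (\<lambda>(u, a). u \<noteq> 0 \<longrightarrow> poly (eval_inner (u ^ N) E) (eval_fps F u) \<noteq> a * u ^ (N * d)) (nhds (0, a0))"
proof -
  define Q where "Q = poly W F"
  obtain n where n: "n \<le> N * d" "\<And>m. m < n \<Longrightarrow> fps_nth Q m = 0" "n < N * d \<Longrightarrow> fps_nth Q n \<noteq> 0"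
  proof (cases "\<forall>m<N * d. fps_nth Q m = 0")
    case True
    show ?thesis by (rule that[of "N * d"]) (use True in simp_all)
  next
    case False
    then obtain m where m: "m < N * d" "fps_nth Q m \<noteq> 0" by blast
    have "subdegree Q \<le> m" using m(2) by (rule subdegree_leI)
    then have "subdegree Q \<le> N * d" using m(1) by linarith
    moreover have "Q \<noteq> 0" using m(2) by auto
    then have "fps_nth Q (subdegree Q) \<noteq> 0" by (rule nth_subdegree_nonzero)
    ultimately show ?thesis using nth_less_subdegree_zero[of _ Q] by (intro that[of "subdegree Q"])
  qed
  define S where "S = fps_shift n Q"
  have Q: "Q = fps_X ^ n * S"
    using n(2) by (auto simp: fps_eq_iff S_def fps_X_power_mult_nth)
  have ne: "fps_nth Q n - (if n = N * d then a0 else 0) \<noteq> 0"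
  proof (cases "n = N * d")
    case True
    have "\<exists>D\<in>base_dicriticals. fps_nth Q n \<in> poly (branch_poly D) ` {s. poly (pderiv (branch_poly D)) s = 0} \<or>
        2 \<le> ramification D \<and> fps_nth Q n = poly (branch_poly D) 0"
      by (rule polar_limit[OF F]) (use n(2) True in \<open>simp_all add: Q_def\<close>)
    then obtain D where D: "D \<in> base_dicriticals"
      "fps_nth Q n \<in> poly (branch_poly D) ` {s. poly (pderiv (branch_poly D)) s = 0} \<or>
        2 \<le> ramification D \<and> fps_nth Q n = poly (branch_poly D) 0" by (rule bexE)
    from D(2) have "fps_nth Q n \<in> poly (branch_poly D) ` {s. poly (pderiv (branch_poly D)) s = 0} \<union>
        (if 2 \<le> ramification D then {poly (branch_poly D) 0} else {})"
    proof
      assume "2 \<le> ramification D \<and> fps_nth Q n = poly (branch_poly D) 0"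
      then show ?thesis by (intro UnI2) simp
    qed (rule UnI1)
    with D(1) have "fps_nth Q n \<in> special_values" unfolding special_values_def by (rule UN_I)
    then show ?thesis using a0 True by auto
  next
    case False
    then show ?thesis using n(1,3) by simp
  qed
  have exp1: "(\<lambda>u. poly (eval_inner (u ^ N) E) (eval_fps F u)) has_fps_expansion Q"
    unfolding Q_def by (rule eval_along_series_expansion[OF eval_fps_has_fps_expansion[OF conv]])
  then have "0 < fps_conv_radius Q" by (simp add: has_fps_expansion_def)
  then have S: "eval_fps S has_fps_expansion S"
    by (intro eval_fps_has_fps_expansion) (simp add: S_def fps_conv_radius_shift)
  have exp2: "(\<lambda>u. u ^ n * eval_fps S u) has_fps_expansion Q"
    unfolding Q by (rule has_fps_expansion_mult[OF has_fps_expansion_fps_X_power S])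
  have "eventually (\<lambda>u. eval_fps Q u = poly (eval_inner (u ^ N) E) (eval_fps F u)) (nhds 0)"
    using exp1 by (simp add: has_fps_expansion_def)
  moreover have "eventually (\<lambda>u. eval_fps Q u = u ^ n * eval_fps S u) (nhds 0)"
    using exp2 by (simp add: has_fps_expansion_def)
  ultimately have eq: "eventually (\<lambda>u. poly (eval_inner (u ^ N) E) (eval_fps F u) = u ^ n * eval_fps S u) (nhds 0)"
    by eventually_elim simp
  have "isCont (eval_fps S) 0" using has_fps_expansion_imp_continuous[OF S, of UNIV] by simp
  then have Scont: "(eval_fps S \<longlongrightarrow> fps_nth S 0) (nhds 0)"
    unfolding isCont_def tendsto_at_iff_tendsto_nhds[of "eval_fps S"] by (simp add: eval_fps_at_0)
  have fst0: "filterlim fst (nhds 0) (nhds (0::complex, a0))" and snd0: "filterlim snd (nhds a0) (nhds (0::complex, a0))"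
    using iffD1[OF tendsto_at_iff_tendsto_nhds[of fst "(0::complex, a0)"] tendsto_fst[OF tendsto_ident_at]]
      iffD1[OF tendsto_at_iff_tendsto_nhds[of snd "(0::complex, a0)"] tendsto_snd[OF tendsto_ident_at]]
    by (simp_all only: fst_conv snd_conv)
  \<comment> \<open>Because \<open>0 ^ 0 = 1\<close>, the term with \<open>a0\<close> survives in
    the limit exactly when \<open>n = N * d\<close>.\<close>
  have "((\<lambda>p. eval_fps S (fst p) - snd p * fst p ^ (N * d - n)) \<longlongrightarrow> fps_nth S 0 - a0 * 0 ^ (N * d - n)) (nhds (0, a0))"
    by (intro tendsto_intros fst0 snd0 filterlim_compose[OF Scont])
  moreover have "fps_nth S 0 - a0 * 0 ^ (N * d - n) \<noteq> 0"
    using ne n(1) by (auto simp: S_def zero_power split: if_splits)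
  ultimately have "eventually (\<lambda>p. eval_fps S (fst p) - snd p * fst p ^ (N * d - n) \<noteq> 0) (nhds (0, a0))"
    by (rule tendsto_imp_eventually_ne)
  moreover have "eventually (\<lambda>p. poly (eval_inner (fst p ^ N) E) (eval_fps F (fst p)) = fst p ^ n * eval_fps S (fst p)) (nhds (0, a0))"
    using eventually_compose_filterlim[OF eq fst0] .
  ultimately show ?thesis
  proof eventually_elim
    case (elim p)
    have pow: "fst p ^ (N * d) = fst p ^ n * fst p ^ (N * d - n)" using n(1) by (simp flip: power_add)
    have "snd p * fst p ^ (N * d) \<noteq> poly (eval_inner (fst p ^ N) E) (eval_fps F (fst p))" if "fst p \<noteq> 0"
      unfolding elim(2) pow using elim(1) that by (simp add: mult.left_commute)
    then show ?case unfolding case_prod_unfold by metis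
  qed
qed

text \<open>A multiple root over w lies on one of finitely many polar series, and each of these
  avoids all values near \<open>a0\<close> for small u.\<close>

lemma simple_roots_near:
  assumes a0: "a0 \<notin> special_values"
  shows "\<exists>\<rho>>0. \<exists>r>0. \<forall>w a y. 0 < norm w \<longrightarrow> norm w < \<rho> \<longrightarrow> a \<in> ball a0 r \<longrightarrow>
    poly (eval_inner w E) y = a * w ^ d \<longrightarrow> poly (pderiv (eval_inner w E)) y \<noteq> 0"
proof -
  obtain \<rho>1 where \<rho>1: "0 < \<rho>1" "finite {F. poly (pderiv W) F = 0}"
    "\<And>F. poly (pderiv W) F = 0 \<Longrightarrow> ereal \<rho>1 \<le> fps_conv_radius F"
    "\<And>u y. norm u < \<rho>1 \<Longrightarrow> poly (pderiv (eval_inner (u ^ N) E)) y = 0 \<longleftrightarrow>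
      (\<exists>F. poly (pderiv W) F = 0 \<and> y = eval_fps F u)"
    by (rule polar_convergent) (rule that; assumption)
  have "eventually (\<lambda>p. \<forall>F\<in>{F. poly (pderiv W) F = 0}. (\<lambda>(u, a). u \<noteq> 0 \<longrightarrow>
      poly (eval_inner (u ^ N) E) (eval_fps F u) \<noteq> a * u ^ (N * d)) p) (nhds (0, a0))"
  proof (rule eventually_ball_finite[OF \<rho>1(2)], rule ballI)
    fix F assume F: "F \<in> {F. poly (pderiv W) F = 0}"
    have "0 < ereal \<rho>1" using \<rho>1(1) by simp
    then have "0 < fps_conv_radius F" by (rule less_le_trans) (use \<rho>1(3)[of F] F in simp)
    then show "eventually (\<lambda>(u, a). u \<noteq> 0 \<longrightarrow> poly (eval_inner (u ^ N) E) (eval_fps F u) \<noteq> a * u ^ (N * d)) (nhds (0, a0))"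
      using F by (intro polar_avoids_value[OF a0]) auto
  qed
  then obtain \<epsilon> where \<epsilon>: "0 < \<epsilon>" "\<And>u a F. dist (u, a) (0, a0) < \<epsilon> \<Longrightarrow> poly (pderiv W) F = 0 \<Longrightarrow> u \<noteq> 0 \<Longrightarrow>
      poly (eval_inner (u ^ N) E) (eval_fps F u) \<noteq> a * u ^ (N * d)"
    unfolding eventually_nhds_metric by fastforce
  define \<rho>2 where "\<rho>2 = min \<rho>1 (\<epsilon> / 2)"
  have \<rho>2: "0 < \<rho>2" "\<rho>2 \<le> \<rho>1" "\<rho>2 \<le> \<epsilon> / 2" using \<rho>1(1) \<epsilon>(1) by (auto simp: \<rho>2_def)
  have main: "poly (pderiv (eval_inner w E)) y \<noteq> 0" if w: "0 < norm w" "norm w < \<rho>2 ^ N" and a: "a \<in> ball a0 (\<epsilon> / 2)"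
      and y: "poly (eval_inner w E) y = a * w ^ d" for w a y
  proof
    assume y': "poly (pderiv (eval_inner w E)) y = 0"
    obtain u where u: "u ^ N = w" "norm u < \<rho>2" using nth_root_in_disc[OF w(2) N_pos \<rho>2(1)] by blast
    obtain F where F: "poly (pderiv W) F = 0" "y = eval_fps F u"
      using \<rho>1(4)[of u y] u \<rho>2(2) y' by auto
    have "dist (u, a) (0, a0) \<le> dist u 0 + dist a a0" by (simp add: dist_Pair_Pair sqrt_sum_squares_le_sum)
    also have "\<dots> < \<epsilon>" using u(2) \<rho>2(3) a by (simp add: dist_commute)
    finally have "dist (u, a) (0, a0) < \<epsilon>" .
    moreover have "u \<noteq> 0" using u(1) w(1) N_pos by (auto simp: zero_power)
    ultimately show False using \<epsilon>(2)[of u a F] F y u(1) by (auto simp: power_mult)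
  qed
  have pos: "0 < \<rho>2 ^ N" "0 < \<epsilon> / 2" using \<epsilon>(1) \<rho>2(1) by auto
  show ?thesis
    by (rule exI[of _ "\<rho>2 ^ N"], rule conjI[OF pos(1)], rule exI[of _ "\<epsilon> / 2"], rule conjI[OF pos(2)],
        intro allI impI, rule main)
qed

text \<open>\<open>wco\<close> and \<open>yco\<close> are the coordinates of the chart at infinity on the affine plane, and \<open>pt\<close> is their inverse.\<close>

definition xco :: "complex^2 \<Rightarrow> complex" where "xco p = p $ 1 - s * p $ 2"
definition wco :: "complex^2 \<Rightarrow> complex" where "wco p = inverse (xco p)"
definition yco :: "complex^2 \<Rightarrow> complex" where "yco p = p $ 2 * wco p"
definition pt :: "complex \<Rightarrow> complex \<Rightarrow> complex^2" where "pt w y = vector [(1 + s * y) / w, y / w]"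

lemma pt_coords:
  assumes "w \<noteq> 0"
  shows "xco (pt w y) = inverse w" "wco (pt w y) = w" "yco (pt w y) = y"
proof -
  show x: "xco (pt w y) = inverse w" using assms by (simp add: xco_def pt_def field_simps)
  then show w: "wco (pt w y) = w" by (simp add: wco_def)
  have "pt w y $ 2 = y / w" by (simp add: pt_def)
  then show "yco (pt w y) = y" using assms by (simp add: yco_def w)
qed

lemma coords_pt:
  assumes "xco p \<noteq> 0"
  shows "pt (wco p) (yco p) = p"
proof -
  have "p $ 1 = xco p + s * p $ 2" by (simp add: xco_def)
  then have "(1 + s * yco p) / wco p = p $ 1"
    using assms by (simp add: wco_def yco_def field_simps)
  moreover have "yco p / wco p = p $ 2" using assms by (simp add: wco_def yco_def)
  ultimately show ?thesis by (simp add: vec_eq_iff forall_2 pt_def)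
qed

lemma f_pt_iff:
  assumes "w \<noteq> 0"
  shows "f (pt w y) = a \<longleftrightarrow> poly (eval_inner w E) y = a * w ^ d"
  using chart_affine[OF assms, of y] affine_in_curve[of "pt w y" a] chart_in_curve[of "(w, y)" a]
  by (simp add: pt_def)

section \<open>Smoothness of the coordinates near infinity\<close>

lemma smooth_on_f: "open U \<Longrightarrow> smooth_on U f"
proof -
  assume U: "open U"
  have "Ck_on k (\<lambda>p :: complex^2. \<Sum>(i, j) \<in> {(i, j). i + j \<le> d}. c i j * (p $ 1) ^ i * (p $ 2) ^ j) U" for k
    unfolding case_prod_unfold
    by (intro Ck_on_sum Ck_on_mult Ck_on_power Ck_on_const Ck_on_bounded_linear bounded_linear_vec_nth U)
  moreover have "f = (\<lambda>p :: complex^2. \<Sum>(i, j) \<in> {(i, j). i + j \<le> d}. c i j * (p $ 1) ^ i * (p $ 2) ^ j)"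
    using f_eq by (rule ext)
  ultimately show ?thesis by (simp add: smooth_on_def)
qed

lemma smooth_on_xco: "open U \<Longrightarrow> smooth_on U xco"
proof -
  assume U: "open U"
  have "Ck_on k (\<lambda>p :: complex^2. p $ 1 + (- s) * p $ 2) U" for k
    by (intro Ck_on_add Ck_on_mult Ck_on_const Ck_on_bounded_linear bounded_linear_vec_nth U)
  moreover have "xco = (\<lambda>p :: complex^2. p $ 1 + (- s) * p $ 2)" by (simp add: xco_def fun_eq_iff)
  ultimately show ?thesis by (simp add: smooth_on_def)
qed

lemma smooth_on_wco:
  assumes "open U" "\<And>p. p \<in> U \<Longrightarrow> xco p \<noteq> 0"
  shows "smooth_on U wco"
  unfolding smooth_on_def wco_def
proof
  show "Ck_on k (\<lambda>p. inverse (xco p)) U" for k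
    using smooth_on_xco[OF assms(1)] by (intro Ck_on_inverse assms) (auto simp: smooth_on_def)
qed

lemma smooth_on_yco:
  assumes "open U" "\<And>p. p \<in> U \<Longrightarrow> xco p \<noteq> 0"
  shows "smooth_on U yco"
  unfolding smooth_on_def yco_def
proof
  show "Ck_on k (\<lambda>p. p $ 2 * wco p) U" for k
    using smooth_on_wco[OF assms]
    by (intro Ck_on_mult[OF assms(1) Ck_on_bounded_linear[OF assms(1) bounded_linear_vec_nth]]) (auto simp: smooth_on_def)
qed

lemma smooth_on_pt:
  assumes U: "open U" and w: "smooth_on U w" "\<And>x. x \<in> U \<Longrightarrow> w x \<noteq> 0" and y: "smooth_on U y"
  shows "smooth_on U (\<lambda>x. pt (w x) (y x))"
  unfolding pt_def
proof (rule smooth_on_vector_2[OF U])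
  have C: "Ck_on k (\<lambda>x. inverse (w x)) U" "Ck_on k y U" for k
    using w(1) y by (auto simp: smooth_on_def intro!: Ck_on_inverse[OF U w(2)])
  have "Ck_on k (\<lambda>x. (1 + s * y x) * inverse (w x)) U" for k
    by (intro Ck_on_mult Ck_on_add Ck_on_const C U)
  then show "smooth_on U (\<lambda>x. (1 + s * y x) / w x)" by (simp add: smooth_on_def divide_inverse)
  have "Ck_on k (\<lambda>x. y x * inverse (w x)) U" for k by (intro Ck_on_mult C U)
  then show "smooth_on U (\<lambda>x. y x / w x)" by (simp add: smooth_on_def divide_inverse)
qed

text \<open>If x = p1 - s p2 is bounded and y = p2 is large, the point [p1 : p2 : 1] is close to
  [s : 1 : 0], where \<open>hom\<close> is close to \<open>lc\<close>. Then |f(p)| is at least |y|^d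
  |lc| / 2, which is impossible when f(p) stays in a disc.\<close>

lemma compact_tube: "compact {p :: complex^2. norm (xco p) \<le> R \<and> f p \<in> cball a r}"
proof -
  define K where "K = {p :: complex^2. norm (xco p) \<le> R \<and> f p \<in> cball a r}"
  have cf: "continuous_on UNIV f" and cx: "continuous_on UNIV xco"
    by (auto intro: smooth_on_imp_continuous_on smooth_on_f smooth_on_xco)
  have "closed ({p :: complex^2. norm (xco p) \<le> R} \<inter> {p. dist a (f p) \<le> r})"
    by (intro closed_Int closed_Collect_le continuous_intros cf cx)
  moreover have "K = {p :: complex^2. norm (xco p) \<le> R} \<inter> {p. dist a (f p) \<le> r}" by (auto simp: K_def)
  ultimately have closedK: "closed K" by simp
  define v0 :: "complex^3" where "v0 = vector [s, 1, 0]"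
  have hom0: "hom v0 = lc" by (simp add: hom_def v0_def lc_eq)
  have "continuous_on UNIV hom"
    unfolding hom_def case_prod_unfold by (intro continuous_intros)
  then have "isCont hom v0" by (simp add: continuous_on_eq_continuous_at)
  moreover have "0 < norm lc / 2" using lc_nonzero by simp
  ultimately obtain \<delta> where \<delta>: "0 < \<delta>" "\<And>v. dist v v0 < \<delta> \<Longrightarrow> dist (hom v) lc < norm lc / 2"
    unfolding continuous_at_eps_delta hom0 by blast
  \<comment> \<open>For |y| beyond \<open>B\<close> the entries ensure, in this order: |y| <= |y|^d,
    the vector \<open>v\<close> is within \<open>\<delta>\<close> of \<open>v0\<close>, and |y| |lc|
    / 2 exceeds the bound on |f|.\<close>
  define B where "B = Max {1, (\<bar>R\<bar> + 2) / \<delta>, 2 * (norm a + \<bar>r\<bar>) / norm lc}"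
  have B: "1 \<le> B" "(\<bar>R\<bar> + 2) / \<delta> \<le> B" "2 * (norm a + \<bar>r\<bar>) / norm lc \<le> B" by (auto simp: B_def)
  have bound2: "norm (p $ 2) \<le> B" if p: "p \<in> K" for p :: "complex^2"
  proof (rule ccontr)
    define y where "y = p $ 2"
    define x where "x = xco p"
    assume "\<not> norm (p $ 2) \<le> B"
    then have y: "B < norm y" by (simp add: y_def)
    then have "1 < norm y" using B(1) by simp
    then have y0: "y \<noteq> 0" by auto
    define v :: "complex^3" where "v = vector [s + x / y, 1, 1 / y]"
    have "y * v $ 1 = p $ 1" "y * v $ 2 = p $ 2" "y * v $ 3 = 1"
      using y0 by (simp_all add: v_def y_def x_def xco_def field_simps)
    then have "f p = y ^ d * hom v" using hom_scale[of y v] by (simp add: hom_def f_eq)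
    moreover have "dist v v0 < \<delta>"
    proof -
      have "dist v v0 \<le> norm (x / y) + norm (1 / y)"
        using norm_vec_le_sum[of "v - v0"] by (simp add: dist_norm sum_3 v_def v0_def)
      also have "\<dots> = (norm x + 1) / norm y" by (simp add: norm_divide add_divide_distrib)
      also have "\<dots> < (\<bar>R\<bar> + 2) / norm y"
        using p \<open>1 < norm y\<close> by (intro divide_strict_right_mono) (auto simp: K_def x_def)
      also have "\<dots> \<le> \<delta>"
      proof -
        have "(\<bar>R\<bar> + 2) / \<delta> \<le> norm y" using B(2) y by linarith
        then show ?thesis using \<delta>(1) \<open>1 < norm y\<close> by (simp add: divide_le_eq) (simp add: field_simps)
      qed
      finally show ?thesis .
    qed
    then have "dist (hom v) lc < norm lc / 2" by (rule \<delta>(2))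
    then have "norm lc / 2 < norm (hom v)"
      using norm_triangle_sub[of lc "hom v"] by (simp add: dist_norm norm_minus_commute)
    moreover have "norm y \<le> norm y ^ d"
      using \<open>1 < norm y\<close> E_degree(2) by (simp add: self_le_power)
    ultimately have "norm y * (norm lc / 2) \<le> norm (f p)"
      by (simp only: norm_mult norm_power) (intro mult_mono, auto)
    also have "\<dots> \<le> norm a + \<bar>r\<bar>"
      using p norm_triangle_sub[of "f p" a] by (auto simp: K_def dist_norm norm_minus_commute)
    finally have "norm y \<le> 2 * (norm a + \<bar>r\<bar>) / norm lc" using lc_nonzero by (simp add: field_simps)
    then show False using y B(3) by linarith
  qed
  have "norm p \<le> (\<bar>R\<bar> + norm s * B) + B" if p: "p \<in> K" for p :: "complex^2"
  proof -
    have "norm (p $ 1) \<le> norm (xco p) + norm (s * p $ 2)"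
      using norm_triangle_ineq[of "xco p" "s * p $ 2"] by (simp add: xco_def)
    also have "\<dots> \<le> \<bar>R\<bar> + norm s * B"
      using p bound2[OF p] by (intro add_mono) (auto simp: K_def norm_mult intro!: mult_left_mono)
    finally have "norm (p $ 1) \<le> \<bar>R\<bar> + norm s * B" .
    then show ?thesis using norm_vec_le_sum[of p] bound2[OF p] by (simp add: sum_2)
  qed
  then have "bounded K" by (auto simp: bounded_iff)
  then show ?thesis using closedK unfolding K_def by (simp add: compact_eq_bounded_closed)
qed

text \<open>With \<open>w\<close> fixed, the value of \<open>f\<close> is moved along a segment and the simple root \<open>y\<close> is followed, i.e.\ the
  homotopy is lifted to the covering of simple roots.\<close>

lemma not_bifurcation:
  assumes a0: "a0 \<notin> special_values"
  shows "a0 \<notin> bifurcation_at_infinity f"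
proof -
  obtain \<rho> r where \<rho>: "0 < \<rho>" and r: "0 < r" and simple: "\<And>w a y. 0 < norm w \<Longrightarrow> norm w < \<rho> \<Longrightarrow> a \<in> ball a0 r \<Longrightarrow>
    poly (eval_inner w E) y = a * w ^ d \<Longrightarrow> poly (pderiv (eval_inner w E)) y \<noteq> 0"
    using simple_roots_near[OF a0] by blast
  define D where "D = ball a0 r"
  \<comment> \<open>The closed disc makes K compact. Since w is the inverse of \<open>xco\<close>,
    outside K one has 0 < |w| < \<open>\<rho>\<close>; the lift below keeps w fixed and so can
    neither enter K nor escape to infinity.\<close>
  define K where "K = {p :: complex^2. norm (xco p) \<le> inverse \<rho> \<and> f p \<in> cball a0 r}"
  define M where "M = f -` D - K"
  have a0D: "a0 \<in> D" using r by (simp add: D_def)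
  have openM: "open M"
  proof -
    have "compact K" unfolding K_def by (rule compact_tube)
    moreover have "continuous_on UNIV f" by (intro smooth_on_imp_continuous_on smooth_on_f open_UNIV)
    then have "open (f -` D)" by (intro open_vimage) (auto simp: D_def)
    ultimately show ?thesis unfolding M_def by (intro open_Diff compact_imp_closed)
  qed
  have M: "p \<in> M \<longleftrightarrow> f p \<in> D \<and> xco p \<noteq> 0 \<and> norm (wco p) < \<rho>" for p :: "complex^2"
  proof -
    have "inverse \<rho> < norm (xco p) \<longleftrightarrow> xco p \<noteq> 0 \<and> norm (wco p) < \<rho>"
      using \<rho> by (cases "xco p = 0") (auto simp: wco_def norm_divide field_simps)
    then show ?thesis unfolding M_def K_def D_def by auto
  qed
  have xM: "xco p \<noteq> 0" and wM: "wco p \<noteq> 0" if "p \<in> M" for p using that M by (auto simp: wco_def)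
  define S :: "(complex \<times> complex) set" where "S = {(w, a). 0 < norm w \<and> norm w < \<rho> \<and> a \<in> D}"
  \<comment> \<open>The roots of \<open>G (w, a)\<close> are the y over w at which f has the value
    a; dividing by \<open>lc\<close> makes it monic.\<close>
  define G where "G z = smult (inverse lc) (eval_inner (fst z) (E - [:monom (snd z) d:]))" for z :: "complex \<times> complex"
  define C where "C = {(z, y). z \<in> S \<and> poly (G z) y = 0}"
  have polyG: "poly (G z) y = inverse lc * (poly (eval_inner (fst z) E) y - snd z * fst z ^ d)" for z y
    by (simp add: G_def eval_inner_diff poly_monom)
  have C: "((w, a), y) \<in> C \<longleftrightarrow> w \<noteq> 0 \<and> norm w < \<rho> \<and> a \<in> D \<and> poly (eval_inner w E) y = a * w ^ d" for w a y
    using lc_nonzero by (auto simp: C_def S_def polyG)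
  have cov: "covering_space C fst S"
    unfolding C_def
  proof (rule covering_space_simple_roots)
    show "continuous_on S (\<lambda>z. poly (G z) y)" for y
      unfolding polyG poly_eval_inner by (intro continuous_intros)
    show deg: "degree (G z) = d" for z
      using degree_eval_inner(1)[OF shifted_lead(2) lc_nonzero, of "fst z" "snd z"] lc_nonzero
      by (simp add: G_def shifted_lead(1))
    show "lead_coeff (G z) = 1" for z
      using degree_eval_inner(2)[OF shifted_lead(2) lc_nonzero, of "fst z" "snd z"] lc_nonzero
      by (simp add: G_def)
    show "card {y. poly (G z) y = 0} = d" if "z \<in> S" for z
    proof -
      have "rsquarefree (G z)"
        unfolding rsquarefree_roots
      proof (intro allI notI, elim conjE)
        fix y assume "poly (G z) y = 0" "poly (pderiv (G z)) y = 0"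
        then have "poly (eval_inner (fst z) E) y = snd z * fst z ^ d" "poly (pderiv (eval_inner (fst z) E)) y = 0"
          using lc_nonzero by (simp_all add: polyG) (simp add: G_def pderiv_smult eval_inner_diff pderiv_diff pderiv_pCons)
        then show False using simple[of "fst z" "snd z" y] that by (auto simp: S_def D_def)
      qed
      from card_roots_rsquarefree[OF this] show ?thesis by (simp add: deg)
    qed
  qed (rule d_pos)
  \<comment> \<open>The argument is \<open>((((w, a), y), b), t)\<close>: from the point y over (w,
    a), the value moves straight from a to b in time t.\<close>
  define h :: "(((complex \<times> complex) \<times> complex) \<times> complex) \<times> real \<Rightarrow> complex \<times> complex" where
    "h z = (fst (fst (fst (fst z))), (1 - snd z) *\<^sub>R snd (fst (fst (fst z))) + snd z *\<^sub>R snd (fst z))" for z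
  have hS: "h (((w_a, y), b), t) \<in> S" if "(w_a, y) \<in> C" "b \<in> D" "t \<in> {0..1}" for w_a y b t
  proof -
    obtain w a where wa: "w_a = (w, a)" by (cases w_a)
    have "(1 - t) *\<^sub>R a + t *\<^sub>R b \<in> D"
      using that C[of w a y] convex_ball[of a0 r] unfolding wa D_def by (intro convexD) auto
    then show ?thesis using that(1) C[of w a y] by (simp add: wa h_def S_def)
  qed
  obtain k where k: "continuous_on ((C \<times> D) \<times> {0..1}) k" "k \<in> (C \<times> D) \<times> {0..1} \<rightarrow> C"
    "\<And>z. z \<in> C \<times> D \<Longrightarrow> k (z, 0) = fst z" "\<And>z. z \<in> (C \<times> D) \<times> {0..1} \<Longrightarrow> h z = fst (k z)"
  proof (rule covering_space_lift_homotopy_alt[OF cov, of "C \<times> D" h fst])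
    show "continuous_on ((C \<times> D) \<times> {0..1}) h" unfolding h_def by (intro continuous_intros)
    show "h \<in> (C \<times> D) \<times> {0..1} \<rightarrow> S" using hS by auto
    show "h (z, 0) = fst (fst z)" if "z \<in> C \<times> D" for z by (simp add: h_def)
  qed (auto intro: continuous_intros)
  define T where "T z = k (z, 1)" for z
  have contT: "continuous_on (C \<times> D) T"
    unfolding T_def by (rule continuous_on_compose2[OF k(1)]) (auto intro!: continuous_intros)
  have TC: "T (q, b) \<in> C" if "q \<in> C" "b \<in> D" for q b unfolding T_def using k(2) that by (auto simp: Pi_iff)
  have fstT: "fst (T (q, b)) = (fst (fst q), b)" if "q \<in> C" "b \<in> D" for q b
    using k(4)[of "((q, b), 1)"] that by (simp add: T_def h_def)
  have T_inverse: "T (T (q, b), snd (fst q)) = q" if q: "q \<in> C" and b: "b \<in> D" for q b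
  proof -
    define a where "a = snd (fst q)"
    have a: "a \<in> D" using q C[of "fst (fst q)" a "snd q"] by (simp add: a_def)
    have Tq: "T (q, b) \<in> C" using TC[OF q b] .
    \<comment> \<open>The lift that returns from b to a and the first lift run backwards cover the
      same path and agree at the start, so they agree at the end.\<close>
    have "k ((T (q, b), a), 1) = k ((q, b), 1 - 1)"
    proof (rule covering_space_lift_unique[OF cov, of "\<lambda>t. k ((T (q, b), a), t)" 0 "\<lambda>t. k ((q, b), 1 - t)" "{0..1}"
          "\<lambda>t. h ((T (q, b), a), t)"])
      show "k ((T (q, b), a), 0) = k ((q, b), 1 - 0)" using k(3) Tq a by (simp add: T_def)
      show "continuous_on {0..1} (\<lambda>t. h ((T (q, b), a), t))" unfolding h_def by (intro continuous_intros)
      show "(\<lambda>t. h ((T (q, b), a), t)) \<in> {0..1} \<rightarrow> S" using hS[of "fst (T (q, b))" "snd (T (q, b))"] Tq a by auto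
      show "continuous_on {0..1} (\<lambda>t. k ((T (q, b), a), t))"
        by (rule continuous_on_compose2[OF k(1)]) (use Tq a in \<open>auto intro!: continuous_intros\<close>)
      show "continuous_on {0..1} (\<lambda>t. k ((q, b), 1 - t))"
        by (rule continuous_on_compose2[OF k(1)]) (use q b in \<open>auto intro!: continuous_intros\<close>)
      show "(\<lambda>t. k ((T (q, b), a), t)) \<in> {0..1} \<rightarrow> C" using k(2) Tq a by (auto simp: Pi_iff)
      show "(\<lambda>t. k ((q, b), 1 - t)) \<in> {0..1} \<rightarrow> C" using k(2) q b by (auto simp: Pi_iff)
      show "h ((T (q, b), a), t) = fst (k ((T (q, b), a), t))" if "t \<in> {0..1}" for t
        using k(4)[of "((T (q, b), a), t)"] Tq a that by simp
      show "h ((T (q, b), a), t) = fst (k ((q, b), 1 - t))" if "t \<in> {0..1}" for t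
        using k(4)[of "((q, b), 1 - t)"] q b that fstT[OF q b] by (simp add: h_def a_def add.commute)
    qed auto
    then show ?thesis using k(3)[of "(q, b)"] q b by (simp add: T_def a_def)
  qed
  define \<iota> where "\<iota> p = ((wco p, f p), yco p)" for p :: "complex^2"
  \<comment> \<open>\<open>\<Psi> (p, b)\<close> transports p into the fibre over b with the same w;
    with \<open>b = a0\<close> it gives the projection to the typical fibre, and on that fibre it is
    the inverse of the trivialisation.\<close>
  define \<Psi> where "\<Psi> z = pt (wco (fst z)) (snd (T (\<iota> (fst z), snd z)))" for z :: "(complex^2) \<times> complex"
  have f_iff: "poly (eval_inner (wco p) E) (yco p) = f p * wco p ^ d" if "p \<in> M" for p
    using f_pt_iff[OF wM[OF that], of "yco p" "f p"] coords_pt[OF xM[OF that]] by simp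
  have \<iota>C: "\<iota> p \<in> C" if "p \<in> M" for p
    using that f_iff[OF that] wM[OF that] M by (simp add: \<iota>_def C)
  have root: "poly (eval_inner (wco p) E) (snd (T (\<iota> p, b))) = b * wco p ^ d" if p: "p \<in> M" and b: "b \<in> D" for p b
    using TC[OF \<iota>C[OF p] b] fstT[OF \<iota>C[OF p] b] C[of "wco p" b "snd (T (\<iota> p, b))"]
    by (cases "T (\<iota> p, b)") (simp add: \<iota>_def)
  have \<Psi>M: "\<Psi> (p, b) \<in> M" and f\<Psi>: "f (\<Psi> (p, b)) = b" and \<iota>\<Psi>: "\<iota> (\<Psi> (p, b)) = T (\<iota> p, b)" if p: "p \<in> M" and b: "b \<in> D" for p b
  proof -
    note w = wM[OF p]
    show 1: "f (\<Psi> (p, b)) = b" using root[OF p b] f_pt_iff[OF w] by (simp add: \<Psi>_def)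
    show "\<Psi> (p, b) \<in> M"
      using 1 b p w pt_coords[OF w, of "snd (T (\<iota> p, b))"] unfolding M by (simp add: \<Psi>_def)
    show "\<iota> (\<Psi> (p, b)) = T (\<iota> p, b)"
      using 1 pt_coords[OF w, of "snd (T (\<iota> p, b))"] fstT[OF \<iota>C[OF p] b]
      by (simp add: prod_eq_iff) (simp add: \<iota>_def \<Psi>_def)
  qed
  have \<Psi>\<Psi>: "\<Psi> (\<Psi> (p, b), f p) = p" if p: "p \<in> M" and b: "b \<in> D" for p b
  proof -
    have "T (\<iota> (\<Psi> (p, b)), f p) = \<iota> p"
      using T_inverse[OF \<iota>C[OF p] b] \<iota>\<Psi>[OF p b] by (simp add: \<iota>_def)
    moreover have "wco (\<Psi> (p, b)) = wco p" using pt_coords(2)[OF wM[OF p]] by (simp add: \<Psi>_def)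
    ultimately show ?thesis using coords_pt[OF xM[OF p]] by (simp add: \<Psi>_def[of "(\<Psi> (p, b), f p)"] \<iota>_def)
  qed
  have fD: "f p \<in> D" if "p \<in> M" for p using that M by blast
  have openD: "open D" by (simp add: D_def)
  have openMD: "open (M \<times> D)" using openM openD by (rule open_Times)
  have sw: "smooth_on M wco" by (rule smooth_on_wco[OF openM xM])
  have swMD: "smooth_on (M \<times> D) (\<lambda>z. wco (fst z))" by (rule smooth_on_compose_fst[OF openM openD sw])
  have cont\<iota>: "continuous_on M \<iota>"
    unfolding \<iota>_def using smooth_on_yco[OF openM xM] sw smooth_on_f[OF openM]
    by (intro continuous_intros smooth_on_imp_continuous_on)
  have smooth_power: "Ck_on j (\<lambda>p. b p * wco p ^ d) M" if "Ck_on j b M" for b j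
    using sw that by (intro Ck_on_mult Ck_on_power openM) (auto simp: smooth_on_def)
  have "smooth_on (M \<times> D) (\<lambda>z. snd (T (\<iota> (fst z), snd z)))"
  proof (rule smooth_on_implicit[OF openMD _ swMD])
    show "continuous_on (M \<times> D) (\<lambda>z. snd (T (\<iota> (fst z), snd z)))"
      by (intro continuous_on_snd continuous_on_compose2[OF contT] continuous_on_Pair
          continuous_on_compose2[OF cont\<iota>] continuous_on_fst continuous_on_id) (use \<iota>C in auto)
    show "smooth_on (M \<times> D) (\<lambda>z. snd z * wco (fst z) ^ d)"
      using swMD unfolding smooth_on_def
      by (intro allI Ck_on_mult[OF openMD Ck_on_bounded_linear[OF openMD bounded_linear_snd]] Ck_on_power openMD) auto
    fix z assume z: "z \<in> M \<times> D"
    then show eq: "poly (eval_inner (wco (fst z)) E) (snd (T (\<iota> (fst z), snd z))) = snd z * wco (fst z) ^ d"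
      using root by auto
    show "poly (pderiv (eval_inner (wco (fst z)) E)) (snd (T (\<iota> (fst z), snd z))) \<noteq> 0"
      using z wM[of "fst z"] M[of "fst z"] by (intro simple[OF _ _ _ eq]) (auto simp: D_def)
  qed
  then have smooth\<Psi>: "smooth_on (M \<times> D) \<Psi>"
    unfolding \<Psi>_def using wM by (intro smooth_on_pt[OF openMD swMD]) auto
  \<comment> \<open>The same implicit equation with the target value frozen at \<open>a0\<close>
    gives smoothness of the first component of the trivialisation.\<close>
  have "smooth_on M (\<lambda>p. snd (T (\<iota> p, a0)))"
  proof (rule smooth_on_implicit[OF openM _ sw])
    show "continuous_on M (\<lambda>p. snd (T (\<iota> p, a0)))"
      by (intro continuous_on_snd continuous_on_compose2[OF contT] continuous_on_Pair cont\<iota> continuous_on_const)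
         (use \<iota>C a0D in auto)
    show "smooth_on M (\<lambda>p. a0 * wco p ^ d)"
      unfolding smooth_on_def by (intro allI smooth_power Ck_on_const openM)
    fix p assume p: "p \<in> M"
    then show eq: "poly (eval_inner (wco p) E) (snd (T (\<iota> p, a0))) = a0 * wco p ^ d" using root a0D by auto
    show "poly (pderiv (eval_inner (wco p) E)) (snd (T (\<iota> p, a0))) \<noteq> 0"
      using p wM[of p] M[of p] a0D by (intro simple[OF _ _ _ eq]) (auto simp: D_def)
  qed
  then have "smooth_on M (\<lambda>p. pt (wco p) (snd (T (\<iota> p, a0))))"
    using wM by (intro smooth_on_pt[OF openM sw]) auto
  then have smooth\<phi>: "smooth_on M (\<lambda>p. (\<Psi> (p, a0), f p))"
    unfolding \<Psi>_def fst_conv snd_conv by (intro smooth_on_Pair openM smooth_on_f)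
  define F where "F = {p \<in> M. f p = a0}"
  have "homeomorphism M (F \<times> D) (\<lambda>p. (\<Psi> (p, a0), f p)) \<Psi>"
  proof
    show "continuous_on M (\<lambda>p. (\<Psi> (p, a0), f p))" using smooth\<phi> by (rule smooth_on_imp_continuous_on)
    show "continuous_on (F \<times> D) \<Psi>"
      using smooth_on_imp_continuous_on[OF smooth\<Psi>] by (rule continuous_on_subset) (auto simp: F_def)
    show "(\<lambda>p. (\<Psi> (p, a0), f p)) ` M \<subseteq> F \<times> D" using \<Psi>M f\<Psi> a0D fD by (auto simp: F_def)
    show "\<Psi> ` (F \<times> D) \<subseteq> M" using \<Psi>M by (auto simp: F_def)
    show "\<Psi> (\<Psi> (p, a0), f p) = p" if "p \<in> M" for p using \<Psi>\<Psi>[OF that a0D] .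
    show "(\<Psi> (\<Psi> z, a0), f (\<Psi> z)) = z" if "z \<in> F \<times> D" for z
    proof -
      obtain p b where z: "z = (p, b)" "p \<in> M" "f p = a0" "b \<in> D" using \<open>z \<in> F \<times> D\<close> by (auto simp: F_def)
      then show ?thesis using \<Psi>\<Psi>[OF z(2,4)] f\<Psi>[OF z(2,4)] by simp
    qed
  qed
  moreover have "smooth_map_on (\<lambda>p. (\<Psi> (p, a0), f p)) M"
    by (rule smooth_on_imp_smooth_map_on[OF openM subset_refl smooth\<phi>])
  moreover have "smooth_map_on \<Psi> (F \<times> D)"
    by (rule smooth_on_imp_smooth_map_on[OF openMD _ smooth\<Psi>]) (auto simp: F_def)
  ultimately have "diffeomorphism_between M (F \<times> D) (\<lambda>p. (\<Psi> (p, a0), f p)) \<Psi>"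
    by (simp add: diffeomorphism_between_def)
  then have "smooth_trivial_fibration f (f -` ball a0 r - K) (ball a0 r)"
    unfolding smooth_trivial_fibration_def M_def[symmetric] D_def[symmetric]
    by (intro exI conjI) (assumption, simp)
  moreover have "compact K" unfolding K_def by (rule compact_tube)
  ultimately show ?thesis unfolding bifurcation_at_infinity_def using r by blast
qed

subsection \<open>Counting special values\<close>

abbreviation "critical_values D \<equiv> poly (branch_poly D) ` {s. poly (pderiv (branch_poly D)) s = 0}"
abbreviation "preimages D a \<equiv> {s. poly (branch_poly D) s = a}"

definition ramified :: "(complex fps \<times> nat) set" where
  "ramified = {D \<in> base_dicriticals. 2 \<le> ramification D}"

definition total_degree :: nat where
  "total_degree = (\<Sum>D\<in>base_dicriticals. degree (branch_poly D))"

lemma branch_poly_degree: "D \<in> base_dicriticals \<Longrightarrow> 0 < degree (branch_poly D)"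
  using branch_poly(4) base_dicriticals_subset by blast

lemma finite_ramified: "finite ramified"
  and card_ramified_le: "card ramified \<le> card base_dicriticals"
  using finite_base_dicriticals by (auto simp: ramified_def intro: card_mono)

lemma special_values_alt:
  "special_values = (\<Union>D\<in>base_dicriticals. critical_values D) \<union> (\<lambda>D. poly (branch_poly D) 0) ` ramified"
  by (auto simp: special_values_def ramified_def split: if_splits)

lemma finite_special_values: "finite special_values"
  unfolding special_values_alt
  using finite_base_dicriticals finite_ramified card_critical_values_le(3)[OF branch_poly_degree] by auto

lemma card_critical_le:
  "card (\<Union>D\<in>base_dicriticals. critical_values D) + card base_dicriticals \<le> total_degree"
proof -
  have "card (\<Union>D\<in>base_dicriticals. critical_values D) + card base_dicriticals
      \<le> (\<Sum>D\<in>base_dicriticals. card (critical_values D)) + (\<Sum>D\<in>base_dicriticals. 1)"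
    using card_UN_le[OF finite_base_dicriticals, of critical_values] by simp
  also have "\<dots> \<le> total_degree"
    unfolding sum.distrib[symmetric] total_degree_def
    by (intro sum_mono card_critical_values_le(4) branch_poly_degree)
  finally show ?thesis .
qed

lemma card_special_le: "card special_values + card base_dicriticals \<le> total_degree + card ramified"
proof -
  have "card special_values \<le> card (\<Union>D\<in>base_dicriticals. critical_values D) + card ((\<lambda>D. poly (branch_poly D) 0) ` ramified)"
    unfolding special_values_alt by (rule card_Un_le)
  then show ?thesis
    using card_critical_le card_image_le[OF finite_ramified, of "\<lambda>D. poly (branch_poly D) 0"] by linarith
qed

lemma card_base_dicriticals_le_nu: "card base_dicriticals \<le> nu f a"
proof -
  have "card base_dicriticals = (\<Sum>D\<in>base_dicriticals. 1)" by simp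
  also have "\<dots> \<le> (\<Sum>D\<in>base_dicriticals. card (preimages D a))"
  proof (rule sum_mono)
    fix D assume "D \<in> base_dicriticals"
    from card_critical_values_le(1)[OF branch_poly_degree[OF this], of a]
    show "1 \<le> card (preimages D a)" by linarith
  qed
  finally show ?thesis using sum_roots_le_orbit_count[of a] by (simp add: nu_eq_orbit_count)
qed

text \<open>Here nu_a takes the place of nu_gen: for each D the critical values other than a number
  at most the solutions of R_D = a minus one, and these solutions sum up to at most nu_a.\<close>

lemma card_special_minus_le:
  "card (special_values - {a}) + card base_dicriticals \<le> nu f a + card ramified"
proof -
  let ?V = "\<Union>D\<in>base_dicriticals. critical_values D - {a}" and ?P = "(\<lambda>D. poly (branch_poly D) 0) ` ramified"
  have "finite (?V \<union> ?P)" using finite_special_values unfolding special_values_alt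
    by (rule rev_finite_subset) auto
  then have "card (special_values - {a}) \<le> card (?V \<union> ?P)"
    by (rule card_mono) (auto simp: special_values_alt)
  also have "\<dots> \<le> card ?V + card ?P" by (rule card_Un_le)
  also have "\<dots> \<le> (\<Sum>D\<in>base_dicriticals. card (critical_values D - {a})) + card ramified"
    by (intro add_mono card_UN_le card_image_le finite_base_dicriticals finite_ramified)
  finally have 1: "card (special_values - {a}) \<le> (\<Sum>D\<in>base_dicriticals. card (critical_values D - {a})) + card ramified" .
  have "(\<Sum>D\<in>base_dicriticals. card (critical_values D - {a})) + card base_dicriticals =
      (\<Sum>D\<in>base_dicriticals. card (critical_values D - {a}) + 1)"
    unfolding sum.distrib by simp
  also have "\<dots> \<le> (\<Sum>D\<in>base_dicriticals. card (preimages D a))"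
    by (intro sum_mono card_critical_values_le(1) branch_poly_degree)
  also have "\<dots> \<le> nu f a" using sum_roots_le_orbit_count[of a] by (simp add: nu_eq_orbit_count)
  finally show ?thesis using 1 by linarith
qed

lemma total_degree_le_nu:
  assumes "a \<notin> (\<Union>D\<in>base_dicriticals. critical_values D)"
  shows "total_degree \<le> nu f a"
proof -
  have "total_degree = (\<Sum>D\<in>base_dicriticals. card (preimages D a))"
    unfolding total_degree_def using assms
    by (intro sum.cong refl card_critical_values_le(2)[symmetric] branch_poly_degree) blast+
  then show ?thesis using sum_roots_le_orbit_count[of a] by (simp add: nu_eq_orbit_count)
qed

lemma nu_le_total_degree:
  assumes "a \<notin> (\<lambda>D. poly (branch_poly D) 0) ` ramified"
  shows "nu f a \<le> total_degree"
  unfolding nu_eq_orbit_count total_degree_def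
  using assms by (intro orbit_count_le_sum_degree) (auto simp: ramified_def)

lemma nu_gen_eq: "nu_gen f = total_degree"
proof -
  have sub: "{a. nu f a \<noteq> total_degree} \<subseteq> special_values"
    using total_degree_le_nu nu_le_total_degree unfolding special_values_alt by (auto intro: antisym)
  then have fin: "finite {a. nu f a \<noteq> total_degree}" using finite_special_values by (rule finite_subset)
  show ?thesis
    unfolding nu_gen_def
  proof (rule the_equality)
    fix n assume "finite {a. nu f a \<noteq> n}"
    with fin have "finite ({a. nu f a \<noteq> total_degree} \<union> {a. nu f a \<noteq> n})" by blast
    moreover have "infinite (UNIV :: complex set)" by (rule infinite_UNIV_char_0)
    ultimately have "{a. nu f a \<noteq> total_degree} \<union> {a. nu f a \<noteq> n} \<noteq> UNIV" by metis
    then show "n = total_degree" by blast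
  qed (rule fin)
qed

lemma bifurcation_subset: "bifurcation_at_infinity f \<subseteq> special_values"
  using not_bifurcation by blast

text \<open>Off the critical values every R_D = a has deg R_D solutions, so nu_a cannot drop. Off
  the values R_D(0) with m >= 2 every orbit through D has at least m members, so nu_a cannot jump
  up.\<close>

lemma less_subset: "{a. nu f a < nu_gen f} \<subseteq> (\<Union>D\<in>base_dicriticals. critical_values D)"
  and greater_subset: "{a. nu f a > nu_gen f} \<subseteq> (\<lambda>D. poly (branch_poly D) 0) ` ramified"
  unfolding nu_gen_eq using total_degree_le_nu nu_le_total_degree by (force simp: not_le[symmetric])+

text \<open>If every m were at least 2, then twice the sum of the deg R_D would be at most the sum
  of the m deg R_D, hence at most d.\<close>

lemma unramified_exists:
  assumes "real (nu_gen f) > real d / 2"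
  shows "card ramified < card base_dicriticals"
proof (rule ccontr)
  assume "\<not> ?thesis"
  then have "card ramified = card base_dicriticals" using card_ramified_le by linarith
  then have "ramified = base_dicriticals"
    by (intro card_subset_eq finite_base_dicriticals) (auto simp: ramified_def)
  then have "2 * total_degree \<le> (\<Sum>D\<in>base_dicriticals. ramification D * degree (branch_poly D))"
    unfolding total_degree_def sum_distrib_left by (intro sum_mono mult_right_mono) (auto simp: ramified_def)
  also have "\<dots> \<le> d" by (rule sum_ramification_degree_le)
  finally have "real (2 * total_degree) \<le> real d" by (rule of_nat_mono)
  then show False using assms unfolding nu_gen_eq by simp
qed

end

text \<open>The top-degree part of f at [s : 1 : 0] is a nonzero polynomial in s, so some s avoids
  its zeros. The factor \<open>0 ^ (d - i - j)\<close> selects the terms of top degree.\<close>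

lemma sheared_polynomial_exists:
  assumes "polynomial_of_degree f d" "\<not> f constant_on UNIV"
  shows "\<exists>E lc s c. sheared_polynomial E lc d s f c"
proof -
  obtain c i0 j0 where f: "\<And>p. f p = (\<Sum>(i, j) \<in> {(i, j). i + j \<le> d}. c i j * (p $ 1) ^ i * (p $ 2) ^ j)"
    and top: "i0 + j0 = d" "c i0 j0 \<noteq> 0"
    using assms(1) unfolding polynomial_of_degree_def by blast
  define A where "A = {(i, j). i + j \<le> d}"
  have finA: "finite A" by (rule finite_subset[of _ "{..d} \<times> {..d}"]) (auto simp: A_def)
  have d: "0 < d"
  proof (rule ccontr)
    assume "\<not> 0 < d"
    then have "{(i, j). i + j \<le> d} = {(0, 0)}" by auto
    then have "f p = c 0 0" for p using f[of p] by simp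
    then show False using assms(2) by (auto simp: constant_on_def)
  qed
  define lc where "lc s = (\<Sum>(i, j) \<in> A. c i j * s ^ i * 0 ^ (d - i - j))" for s
  define q where "q = (\<Sum>(i, j) \<in> A. monom (c i j * 0 ^ (d - i - j)) i)"
  have lc: "lc s = poly q s" for s
    unfolding lc_def q_def poly_sum by (intro sum.cong) (auto simp: poly_monom)
  \<comment> \<open>Within the top degree i determines j, so a single term has exponent
    \<open>i0\<close>.\<close>
  have "coeff q i0 = (\<Sum>(i, j) \<in> A. if i = i0 then c i j * 0 ^ (d - i - j) else 0)"
    unfolding q_def coeff_sum by (intro sum.cong) auto
  also have "\<dots> = (\<Sum>(i, j) \<in> {(i0, j0)}. if i = i0 then c i j * 0 ^ (d - i - j) else 0)"
    using top finA by (intro sum.mono_neutral_right) (auto simp: A_def zero_power split: if_splits)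
  finally have "q \<noteq> 0" using top by auto
  then obtain s where "poly q s \<noteq> 0" using poly_all_0_iff_0 by blast
  then have lc0: "lc s \<noteq> 0" by (simp add: lc)
  \<comment> \<open>\<open>monom 1 j\<close> is y^j and \<open>[:1, [:s:]:]\<close> is 1 + s y; the
    scalar is the coefficient times the power of w.\<close>
  define E where "E = (\<Sum>(i, j) \<in> A. smult (monom (c i j) (d - i - j)) (monom 1 j * [:1, [:s:]:] ^ i))"
  have E_eq: "poly (eval_inner w E) y = (\<Sum>(i, j) \<in> A. c i j * (1 + s * y) ^ i * y ^ j * w ^ (d - i - j))" for w y
    unfolding poly_eval_inner E_def poly_sum
    by (intro sum.cong) (auto simp: poly_monom poly_power mult_ac)
  have deg_le: "degree E \<le> d"
    unfolding E_def
  proof (rule degree_sum_le[OF finA], clarify)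
    fix i j assume "(i, j) \<in> A"
    have "degree (monom 1 j * [:1, [:s:]:] ^ i :: complex poly poly) \<le> j + 1 * i"
      by (intro order.trans[OF degree_mult_le] add_mono degree_monom_le order.trans[OF degree_power_le] mult_right_mono) auto
    then show "degree (smult (monom (c i j) (d - i - j)) (monom 1 j * [:1, [:s:]:] ^ i)) \<le> d"
      using \<open>(i, j) \<in> A\<close> by (intro order.trans[OF degree_smult_le]) (auto simp: A_def)
  qed
  have "coeff E d = (\<Sum>(i, j) \<in> A. [:c i j * s ^ i * 0 ^ (d - i - j):])"
    unfolding E_def coeff_sum
  proof (intro sum.cong refl, clarify)
    fix i j assume ij: "(i, j) \<in> A"
    show "coeff (smult (monom (c i j) (d - i - j)) (monom 1 j * [:1, [:s:]:] ^ i)) d = [:c i j * s ^ i * 0 ^ (d - i - j):]"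
    proof (cases "i + j = d")
      case True
      then have "d - j = i" "j \<le> d" by auto
      moreover have "coeff ([:1, [:s:]:] ^ i) i = [:s ^ i:]" by (simp add: coeff_linear_poly_power poly_const_pow)
      ultimately show ?thesis using True by (simp add: coeff_monom_mult monom_0)
    next
      case False
      then have "i < d - j" "0 < d - i - j" "j \<le> d" using ij by (auto simp: A_def)
      moreover have "degree ([:1, [:s:]:] ^ i) \<le> i"
        by (rule order.trans[OF degree_power_le]) simp
      ultimately have "coeff ([:1, [:s:]:] ^ i) (d - j) = 0" by (intro coeff_eq_0) linarith
      then show ?thesis using \<open>0 < d - i - j\<close> \<open>j \<le> d\<close> by (simp add: coeff_monom_mult zero_power)
    qed
  qed
  also have "\<dots> = [:lc s:]" unfolding lc_def using finA by (induction A rule: finite_induct) (auto simp: case_prod_unfold)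
  finally have cE: "coeff E d = [:lc s:]" .
  then have degE: "degree E = d" using deg_le lc0 by (intro antisym le_degree) auto
  have "sheared_polynomial E (lc s) d s f c"
    by unfold_locales (use degE cE d lc0 f E_eq in \<open>simp_all add: lc_def A_def\<close>)
  then show ?thesis by blast
qed

theorem theorem1p1:
  fixes f :: "complex^2 \<Rightarrow> complex" and d :: nat
  assumes "polynomial_of_degree f d"
    and "\<not> f constant_on UNIV"
  shows "(finite (bifurcation_at_infinity f) \<and>
          card (bifurcation_at_infinity f) \<le> min (nu_gen f) (nu_min f + 1)) \<and>
         (finite {a. nu f a < nu_gen f} \<and>
          int (card {a. nu f a < nu_gen f}) \<le> int (nu_gen f) - int (points_at_infinity_count f)) \<and>
         (finite {a. nu f a > nu_gen f} \<and>
          card {a. nu f a > nu_gen f} \<le> nu_min f) \<and>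
         (real (nu_gen f) > real d / 2 \<longrightarrow>
          int (card (bifurcation_at_infinity f)) \<le> min (int (nu_gen f) - 1) (int (nu_min f)) \<and>
          int (card {a. nu f a > nu_gen f}) \<le> int (nu_min f) - 1)"
proof -
  obtain E lc s c where "sheared_polynomial E lc d s f c" using sheared_polynomial_exists[OF assms] by blast
  then interpret sheared_polynomial E lc d s f c .
  \<comment> \<open>An infimum of natural numbers is attained.\<close>
  obtain a1 where a1: "nu_min f = nu f a1"
    using Inf_nat_def1[of "range (nu f)"] unfolding nu_min_def by blast
  let ?B = "bifurcation_at_infinity f" and ?L = "{a. nu f a < nu_gen f}" and ?G = "{a. nu f a > nu_gen f}"
  have finB: "finite ?B" using bifurcation_subset finite_special_values by (rule finite_subset)
  have "card ?B \<le> card special_values" by (rule card_mono[OF finite_special_values bifurcation_subset])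
  then have B1: "card ?B + card base_dicriticals \<le> nu_gen f + card ramified"
    using card_special_le by (simp add: nu_gen_eq)
  \<comment> \<open>The minimising value may itself be special; this is the 1 in
    \<open>nu_min f + 1\<close>.\<close>
  have "card special_values \<le> card (special_values - {a1}) + 1"
    using card_Diff_singleton_if[of special_values a1] by (auto split: if_splits)
  then have B2: "card ?B + card base_dicriticals \<le> nu_min f + 1 + card ramified"
    using card_special_minus_le[of a1] \<open>card ?B \<le> card special_values\<close> by (simp add: a1)
  have finC: "finite (\<Union>D\<in>base_dicriticals. critical_values D)"
    using finite_special_values unfolding special_values_alt by simp
  have finL: "finite ?L" using less_subset finC by (rule finite_subset)
  have "card ?L \<le> card (\<Union>D\<in>base_dicriticals. critical_values D)" by (rule card_mono[OF finC less_subset])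
  \<comment> \<open>The number of base dicriticals, which \<open>card_critical_le\<close> leaves
    over, is at least the number of points at infinity.\<close>
  then have L: "card ?L + points_at_infinity_count f \<le> nu_gen f"
    using card_critical_le card_constant_terms_le[of 0] points_at_infinity_count_eq[of 0] by (simp add: nu_gen_eq)
  have finP: "finite ((\<lambda>D. poly (branch_poly D) 0) ` ramified)" using finite_ramified by simp
  have finG: "finite ?G" using greater_subset finP by (rule finite_subset)
  have "card ?G \<le> card ((\<lambda>D. poly (branch_poly D) 0) ` ramified)" by (rule card_mono[OF finP greater_subset])
  also have "\<dots> \<le> card ramified" by (rule card_image_le[OF finite_ramified])
  finally have G: "card ?G \<le> card ramified" .
  have T: "card base_dicriticals \<le> nu_min f" unfolding a1 by (rule card_base_dicriticals_le_nu)
  show ?thesis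
    using finB finL finG B1 B2 L G T card_ramified_le unramified_exists by linarith
qed

end
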